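(* For every $n\ge1$, the $k$-algebra homomorphism $\phi:b_n\to b_n'$ given by $U_i\mapsto \mathsf U_i$ ($1\le i\le n-1$), $e\mapsto\mathsf e$ is an isomorphism $b_n\cong b_n'$ from the algebra $b_n$ defined by generators and relations to the blob diagram algebra $b_n'$.
   Context: Presented algebra. Let $K$ be a commutative ring with $1$, $x\in K$ invertible, $q=x^2$, and $\gamma,\delta_e\in K$. For $n\ge 1$, $b_n^K$ is the unital associative $K$-algebra with generators $e,U_1,\ldots,U_{n-1}$ and relations $U_iU_i=(q+q^{-1})U_i$; $U_iU_{i\pm1}U_i=U_i$ (whenever both indices lie in $\{1,\dots,n-1\}$); $U_iU_j=U_jU_i$ if $|i-j|\ne 1$; $U_1eU_1=\gamma U_1$; $ee=\delta_e e$; $U_ie=eU_i$ if $i\ne 1$. For $k$ a field which is a $K$-algebra, $b_n=k\otimes_K b_n^K$. Diagram algebra. A Temperley–Lieb diagram on $n$ points is (the isotopy class of) a rectangular frame with $n$ vertices on the northern edge and $n$ on the southern edge, joined in pairs by $n$ non-crossing lines inside the frame. A blob diagram is a Temperley–Lieb diagram in which any line which may be deformed isotopically (without crossing other lines) to touch the western edge of the frame may be decorated with a (single) blob. $B_n$ is the set of blob diagrams with $n$ vertices on each of the northern and southern edges. $b_n'$ is the $k$-algebra with basis $B_n$ and product of $d_1,d_2\in B_n$ given by concatenation: juxtapose so that the $j$-th southern vertex of $d_1$ is identified with the $j$-th northern vertex of $d_2$, ignore the internal vertices; replace each undecorated closed loop by a scalar factor $\delta=q+q^{-1}$; remove each second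 blob occurring on a line or loop (repeatedly, until at most one blob remains) at the cost of a scalar factor $\delta_e$; then replace each decorated closed loop by a scalar factor $\gamma$. The result is a scalar times an element of $B_n$. $\mathsf U_i\in B_n$ is the undecorated diagram in which northern vertices $i,i+1$ are joined, southern vertices $i,i+1$ are joined, and northern vertex $j$ is joined to southern vertex $j$ for all $j\ne i,i+1$. $\mathsf e\in B_n$ is the identity diagram (northern vertex $j$ joined to southern vertex $j$ for all $j$) with a blob on the first (westernmost) line only. *)

theory Defs
  imports
    "HOL-Library.Poly_Mapping"
    "HOL-Library.Disjoint_Sets"
    "HOL-Algebra.QuotRing"
    "HOL-Algebra.Module"
begin

section \<open>Unital associative algebras\<close>

definition scalar_ring :: "'a::comm_ring_1 ring" where
  "scalar_ring = \<lparr>carrier = UNIV, mult = (*), one = 1, zero = 0, add = (+)\<rparr>"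

text \<open>The library locale \<^locale>\<open>algebra\<close> is restricted to commutative algebras.\<close>

locale unital_algebra = Module.module R A + ring A for R and A (structure) +
  assumes smult_mult_left:
      "\<lbrakk>c \<in> carrier R; a \<in> carrier A; b \<in> carrier A\<rbrakk> \<Longrightarrow>
        (c \<odot>\<^bsub>A\<^esub> a) \<otimes>\<^bsub>A\<^esub> b = c \<odot>\<^bsub>A\<^esub> (a \<otimes>\<^bsub>A\<^esub> b)"
    and smult_mult_right:
      "\<lbrakk>c \<in> carrier R; a \<in> carrier A; b \<in> carrier A\<rbrakk> \<Longrightarrow>
        a \<otimes>\<^bsub>A\<^esub> (c \<odot>\<^bsub>A\<^esub> b) = c \<odot>\<^bsub>A\<^esub> (a \<otimes>\<^bsub>A\<^esub> b)"

definition algebra_hom :: "('c, 'a) module \<Rightarrow> ('c, 'b) module \<Rightarrow> ('a \<Rightarrow> 'b) set" where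
  "algebra_hom A B =
     {f \<in> ring_hom A B. \<forall>c. \<forall>a \<in> carrier A. f (c \<odot>\<^bsub>A\<^esub> a) = c \<odot>\<^bsub>B\<^esub> f a}"

definition algebra_iso :: "('c, 'a) module \<Rightarrow> ('c, 'b) module \<Rightarrow> ('a \<Rightarrow> 'b) set" where
  "algebra_iso A B = {f \<in> algebra_hom A B. bij_betw f (carrier A) (carrier B)}"

text \<open>The free module on the set \<open>B\<close>, with the bilinear product for which
  \<open>b \<cdot> b' = coef b b' \<cdot> prd b b'\<close> on basis elements, and with the basis element \<open>u\<close> as unit.\<close>

definition based_algebra ::
  "'b set \<Rightarrow> ('b \<Rightarrow> 'b \<Rightarrow> 'c) \<Rightarrow> ('b \<Rightarrow> 'b \<Rightarrow> 'b) \<Rightarrow> 'b \<Rightarrow> ('c::comm_ring_1, 'b \<Rightarrow>\<^sub>0 'c) module" where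
  "based_algebra B coef prd u =
    \<lparr>carrier = {f. Poly_Mapping.keys f \<subseteq> B},
     mult = (\<lambda>f g. \<Sum>b \<in> Poly_Mapping.keys f. \<Sum>b' \<in> Poly_Mapping.keys g.
        Poly_Mapping.single (prd b b')
          (Poly_Mapping.lookup f b * Poly_Mapping.lookup g b' * coef b b')),
     one = Poly_Mapping.single u 1,
     zero = 0,
     add = (+),
     smult = (\<lambda>c. Poly_Mapping.map ((*) c))\<rparr>"

definition free_algebra :: "'g set \<Rightarrow> ('c::comm_ring_1, 'g list \<Rightarrow>\<^sub>0 'c) module" where
  "free_algebra X = based_algebra (lists X) (\<lambda>_ _. 1) (@) []"

definition quotient_algebra :: "('c, 'a) module \<Rightarrow> 'a set \<Rightarrow> ('c, 'a set) module" where
  "quotient_algebra A I =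
    \<lparr>carrier = carrier (A Quot I),
     mult = (\<otimes>\<^bsub>A Quot I\<^esub>),
     one = \<one>\<^bsub>A Quot I\<^esub>,
     zero = \<zero>\<^bsub>A Quot I\<^esub>,
     add = (\<oplus>\<^bsub>A Quot I\<^esub>),
     smult = (\<lambda>c S. \<Union>a \<in> S. I +>\<^bsub>A\<^esub> (c \<odot>\<^bsub>A\<^esub> a))\<rparr>"

text \<open>The algebra with generators \<open>X\<close> and relations \<open>r = 0\<close> for \<open>r \<in> R\<close>.\<close>

definition presented_algebra ::
  "'g set \<Rightarrow> ('g list \<Rightarrow>\<^sub>0 'c) set \<Rightarrow> ('c::comm_ring_1, ('g list \<Rightarrow>\<^sub>0 'c) set) module" where
  "presented_algebra X R = quotient_algebra (free_algebra X) (Idl\<^bsub>free_algebra X\<^esub> R)"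

definition presented_gen ::
  "'g set \<Rightarrow> ('g list \<Rightarrow>\<^sub>0 'c) set \<Rightarrow> 'g \<Rightarrow> ('g list \<Rightarrow>\<^sub>0 'c::comm_ring_1) set" where
  "presented_gen X R g =
     Idl\<^bsub>free_algebra X\<^esub> R +>\<^bsub>free_algebra X\<^esub> Poly_Mapping.single [g] 1"


section \<open>Extension of scalars\<close>

text \<open>For a ring homomorphism \<open>h\<close> from \<open>'c\<close> to \<open>'d\<close> and a \<open>'c\<close>-algebra \<open>A\<close>, the tensor product
  of \<open>'d\<close> and \<open>A\<close> over \<open>'c\<close> is the free abelian group on the pairs \<open>(s, a)\<close> modulo the subgroup
  generated by the bilinearity relations.  With respect to the product
  \<open>(s, a) \<cdot> (t, b) = (s * t, a \<otimes> b)\<close> the set of these relations is stable under multiplication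
  by pairs from either side, so the subgroup it generates is the ideal it generates.\<close>

definition pair_ring :: "('c, 'a) module \<Rightarrow> (int, 'd::comm_ring_1 \<times> 'a \<Rightarrow>\<^sub>0 int) module" where
  "pair_ring A = based_algebra (UNIV \<times> carrier A) (\<lambda>_ _. 1)
     (\<lambda>(s, a) (t, b). (s * t, a \<otimes>\<^bsub>A\<^esub> b)) (1, \<one>\<^bsub>A\<^esub>)"

abbreviation pair :: "'d \<Rightarrow> 'a \<Rightarrow> ('d \<times> 'a \<Rightarrow>\<^sub>0 int)" where
  "pair s a \<equiv> Poly_Mapping.single (s, a) 1"

definition bilinearity_relations ::
  "('c \<Rightarrow> 'd) \<Rightarrow> ('c, 'a) module \<Rightarrow> ('d::comm_ring_1 \<times> 'a \<Rightarrow>\<^sub>0 int) set" where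
  "bilinearity_relations h A =
     {pair (s + t) a - pair s a - pair t a | s t a. a \<in> carrier A} \<union>
     {pair s (a \<oplus>\<^bsub>A\<^esub> b) - pair s a - pair s b | s a b. a \<in> carrier A \<and> b \<in> carrier A} \<union>
     {pair (s * h c) a - pair s (c \<odot>\<^bsub>A\<^esub> a) | s c a. a \<in> carrier A}"

definition tensor_ideal ::
  "('c \<Rightarrow> 'd) \<Rightarrow> ('c, 'a) module \<Rightarrow> ('d::comm_ring_1 \<times> 'a \<Rightarrow>\<^sub>0 int) set" where
  "tensor_ideal h A = Idl\<^bsub>pair_ring A\<^esub> (bilinearity_relations h A)"

definition pure_tensor ::
  "('c \<Rightarrow> 'd) \<Rightarrow> ('c, 'a) module \<Rightarrow> 'd \<Rightarrow> 'a \<Rightarrow> ('d::comm_ring_1 \<times> 'a \<Rightarrow>\<^sub>0 int) set" where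
  "pure_tensor h A s a = tensor_ideal h A +>\<^bsub>pair_ring A\<^esub> pair s a"

text \<open>The scalar \<open>s\<close> acts on the tensor product as multiplication by the pure tensor of \<open>s\<close> and \<open>1\<close>.\<close>

definition base_change ::
  "('c \<Rightarrow> 'd) \<Rightarrow> ('c, 'a) module \<Rightarrow> ('d::comm_ring_1, ('d \<times> 'a \<Rightarrow>\<^sub>0 int) set) module" where
  "base_change h A =
    (let T = pair_ring A Quot tensor_ideal h A in
     \<lparr>carrier = carrier T,
      mult = (\<otimes>\<^bsub>T\<^esub>),
      one = \<one>\<^bsub>T\<^esub>,
      zero = \<zero>\<^bsub>T\<^esub>,
      add = (\<oplus>\<^bsub>T\<^esub>),
      smult = (\<lambda>s S. pure_tensor h A s \<one>\<^bsub>A\<^esub> \<otimes>\<^bsub>T\<^esub> S)\<rparr>)"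


section \<open>The blob algebra by generators and relations\<close>

datatype blob_gen = E | U nat

definition blob_gens :: "nat \<Rightarrow> blob_gen set" where
  "blob_gens n = insert E (U ` {1..<n})"

abbreviation word :: "'g list \<Rightarrow> ('g list \<Rightarrow>\<^sub>0 'c::comm_ring_1)" where
  "word w \<equiv> Poly_Mapping.single w 1"

abbreviation scaled_word :: "'c::comm_ring_1 \<Rightarrow> 'g list \<Rightarrow> ('g list \<Rightarrow>\<^sub>0 'c)" where
  "scaled_word c w \<equiv> Poly_Mapping.single w c"

definition blob_relations ::
  "nat \<Rightarrow> 'c \<Rightarrow> 'c \<Rightarrow> 'c \<Rightarrow> (blob_gen list \<Rightarrow>\<^sub>0 'c::comm_ring_1) set" where
  "blob_relations n \<delta> \<gamma> \<delta>\<^sub>e =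
     {word [U i, U i] - scaled_word \<delta> [U i] | i. i \<in> {1..<n}} \<union>
     {word [U i, U j, U i] - word [U i] | i j.
        i \<in> {1..<n} \<and> j \<in> {1..<n} \<and> \<bar>int i - int j\<bar> = 1} \<union>
     {word [U i, U j] - word [U j, U i] | i j.
        i \<in> {1..<n} \<and> j \<in> {1..<n} \<and> \<bar>int i - int j\<bar> \<noteq> 1} \<union>
     {word [U i, E, U i] - scaled_word \<gamma> [U i] | i. i \<in> {1..<n} \<and> i = 1} \<union>
     {word [E, E] - scaled_word \<delta>\<^sub>e [E]} \<union>
     {word [U i, E] - word [E, U i] | i. i \<in> {1..<n} \<and> i \<noteq> 1}"

definition presented_blob_algebra ::
  "nat \<Rightarrow> 'c \<Rightarrow> 'c \<Rightarrow> 'c \<Rightarrow> ('c::comm_ring_1, (blob_gen list \<Rightarrow>\<^sub>0 'c) set) module" where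
  "presented_blob_algebra n \<delta> \<gamma> \<delta>\<^sub>e =
     presented_algebra (blob_gens n) (blob_relations n \<delta> \<gamma> \<delta>\<^sub>e)"

definition presented_blob_gen ::
  "nat \<Rightarrow> 'c \<Rightarrow> 'c \<Rightarrow> 'c \<Rightarrow> blob_gen \<Rightarrow> (blob_gen list \<Rightarrow>\<^sub>0 'c::comm_ring_1) set" where
  "presented_blob_gen n \<delta> \<gamma> \<delta>\<^sub>e =
     presented_gen (blob_gens n) (blob_relations n \<delta> \<gamma> \<delta>\<^sub>e)"


section \<open>Blob diagrams\<close>

datatype vertex = North nat | South nat

definition vertices :: "nat \<Rightarrow> vertex set" where
  "vertices n = North ` {1..n} \<union> South ` {1..n}"

text \<open>Position of a vertex when the frame is traversed clockwise from its north-western corner;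
  the western edge lies between the last and the first position.\<close>

fun position :: "nat \<Rightarrow> vertex \<Rightarrow> nat" where
  "position n (North j) = j"
| "position n (South j) = 2 * n + 1 - j"

definition crosses :: "nat \<Rightarrow> vertex set \<Rightarrow> vertex set \<Rightarrow> bool" where
  "crosses n l m \<longleftrightarrow> (\<exists>a b c d. l = {a, b} \<and> m = {c, d} \<and>
     position n a < position n c \<and> position n c < position n b \<and> position n b < position n d)"

text \<open>A line is the pair of vertices it joins, and an isotopy class of diagrams of non-crossing
  lines is the set of its lines.\<close>

definition TL_diagrams :: "nat \<Rightarrow> vertex set set set" where
  "TL_diagrams n = {L. partition_on (vertices n) L \<and> (\<forall>l \<in> L. card l = 2) \<and>
     (\<forall>l \<in> L. \<forall>m \<in> L. \<not> crosses n l m)}"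

text \<open>The line \<open>l\<close> separates the line \<open>m\<close> from the western edge iff both ends of \<open>m\<close> lie
  strictly between the ends of \<open>l\<close>.\<close>

definition shields :: "nat \<Rightarrow> vertex set \<Rightarrow> vertex set \<Rightarrow> bool" where
  "shields n l m \<longleftrightarrow> (\<exists>a b. l = {a, b} \<and>
     (\<forall>c \<in> m. position n a < position n c \<and> position n c < position n b))"

definition west_exposed :: "nat \<Rightarrow> vertex set set \<Rightarrow> vertex set set" where
  "west_exposed n L = {m \<in> L. \<forall>l \<in> L. \<not> shields n l m}"

text \<open>The second component consists of the lines that carry a blob.\<close>

type_synonym diagram = "vertex set set \<times> vertex set set"

definition blob_diagrams :: "nat \<Rightarrow> diagram set" where
  "blob_diagrams n = {(L, D). L \<in> TL_diagrams n \<and> D \<subseteq> west_exposed n L}"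

definition identity_diagram :: "nat \<Rightarrow> diagram" where
  "identity_diagram n = ({{North j, South j} | j. j \<in> {1..n}}, {})"

definition e_diagram :: "nat \<Rightarrow> diagram" where
  "e_diagram n = ({{North j, South j} | j. j \<in> {1..n}}, {{North 1, South 1}})"

definition U_diagram :: "nat \<Rightarrow> nat \<Rightarrow> diagram" where
  "U_diagram n i =
     ({{North i, North (i + 1)}, {South i, South (i + 1)}} \<union>
      {{North j, South j} | j. j \<in> {1..n} - {i, i + 1}}, {})"


subsection \<open>Concatenation\<close>

text \<open>Points of the juxtaposition of two diagrams: the southern vertices of the upper and the
  northern vertices of the lower diagram become the points \<open>Mid j\<close>.\<close>

datatype point = Top nat | Mid nat | Bot nat

definition points :: "nat \<Rightarrow> point set" where
  "points n = Top ` {1..n} \<union> Mid ` {1..n} \<union> Bot ` {1..n}"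

fun upper :: "vertex \<Rightarrow> point" where
  "upper (North j) = Top j"
| "upper (South j) = Mid j"

fun lower :: "vertex \<Rightarrow> point" where
  "lower (North j) = Mid j"
| "lower (South j) = Bot j"

definition joined :: "diagram \<Rightarrow> diagram \<Rightarrow> (point \<times> point) set" where
  "joined d1 d2 =
     {(upper v, upper w) | v w. \<exists>l \<in> fst d1. v \<in> l \<and> w \<in> l} \<union>
     {(lower v, lower w) | v w. \<exists>l \<in> fst d2. v \<in> l \<and> w \<in> l}"

text \<open>The lines and loops of the juxtaposition, each given by the set of points it passes through.\<close>

definition strands :: "nat \<Rightarrow> diagram \<Rightarrow> diagram \<Rightarrow> point set set" where
  "strands n d1 d2 = {(joined d1 d2)\<^sup>* `` {p} | p. p \<in> points n}"

definition is_loop :: "point set \<Rightarrow> bool" where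
  "is_loop C \<longleftrightarrow> C \<subseteq> range Mid"

definition blob_count :: "diagram \<Rightarrow> diagram \<Rightarrow> point set \<Rightarrow> nat" where
  "blob_count d1 d2 C =
     card {l \<in> snd d1. upper ` l \<subseteq> C} + card {l \<in> snd d2. lower ` l \<subseteq> C}"

definition strand_ends :: "point set \<Rightarrow> vertex set" where
  "strand_ends C = {North j | j. Top j \<in> C} \<union> {South j | j. Bot j \<in> C}"

definition concat_diagram :: "nat \<Rightarrow> diagram \<Rightarrow> diagram \<Rightarrow> diagram" where
  "concat_diagram n d1 d2 =
     (strand_ends ` {C \<in> strands n d1 d2. \<not> is_loop C},
      strand_ends ` {C \<in> strands n d1 d2. \<not> is_loop C \<and> blob_count d1 d2 C > 0})"

text \<open>A strand with \<open>m > 0\<close> blobs loses \<open>m - 1\<close> of them, each for a factor \<open>\<delta>\<^sub>e\<close>.\<close>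

definition concat_scalar ::
  "nat \<Rightarrow> 'c \<Rightarrow> 'c \<Rightarrow> 'c \<Rightarrow> diagram \<Rightarrow> diagram \<Rightarrow> 'c::comm_ring_1" where
  "concat_scalar n \<delta> \<gamma> \<delta>\<^sub>e d1 d2 =
     (\<Prod>C \<in> strands n d1 d2.
        \<delta>\<^sub>e ^ (blob_count d1 d2 C - 1) *
        (if is_loop C then if blob_count d1 d2 C = 0 then \<delta> else \<gamma> else 1))"

definition diagram_blob_algebra ::
  "nat \<Rightarrow> 'c \<Rightarrow> 'c \<Rightarrow> 'c \<Rightarrow> ('c::comm_ring_1, diagram \<Rightarrow>\<^sub>0 'c) module" where
  "diagram_blob_algebra n \<delta> \<gamma> \<delta>\<^sub>e =
     based_algebra (blob_diagrams n) (concat_scalar n \<delta> \<gamma> \<delta>\<^sub>e) (concat_diagram n)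
       (identity_diagram n)"

definition diagram_blob_gen :: "nat \<Rightarrow> blob_gen \<Rightarrow> (diagram \<Rightarrow>\<^sub>0 'c::comm_ring_1)" where
  "diagram_blob_gen n g =
     Poly_Mapping.single (case g of E \<Rightarrow> e_diagram n | U i \<Rightarrow> U_diagram n i) 1"

end

theory Submission
  imports Defs
begin

text \<open>
  The generators of the diagram algebra satisfy the defining relations, and concatenation is associative,
  so words are sent to scalar multiples of diagrams.  Write \<open>g\<^sub>0 = e\<close>, \<open>g\<^sub>i = U\<^sub>i\<close> and
  \<open>T\<^sub>m\<^sub>,\<^sub>b = g\<^sub>b g\<^sub>b\<^sub>+\<^sub>1 \<dots> g\<^sub>m\<^sub>-\<^sub>1\<close>.  By the relations every word is a scalar multiple of a normal word
  \<open>T\<^sub>n\<^sub>,\<^sub>b\<^sub>n \<dots> T\<^sub>2\<^sub>,\<^sub>b\<^sub>2 T\<^sub>1\<^sub>,\<^sub>b\<^sub>1\<close> with \<open>b\<^sub>m\<^sub>+\<^sub>1 \<le> max b\<^sub>m 1 + 1\<close>; the essential step is the exchange rule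
  \<open>T\<^sub>m\<^sub>+\<^sub>1\<^sub>,\<^sub>b T\<^sub>m\<^sub>,\<^sub>a = T\<^sub>m\<^sub>+\<^sub>1\<^sub>,\<^sub>a T\<^sub>m\<^sub>,\<^sub>b\<^sub>-\<^sub>2\<close> for \<open>b \<ge> max a 1 + 2\<close>.  On the diagram side, normal words yield
  pairwise different diagrams with scalar \<open>1\<close>, since \<open>b\<^sub>n\<close> is the position of the first northern cup, and each
  letter of a normal word acts by an invertible reconnection of two lines.  Every blob diagram is
  a product of generators because it contains an innermost cup (or a last straight line) that can be
  stripped off.  So normal words form a spanning set that is mapped bijectively onto the basis of diagrams.
\<close>

text \<open>Writing 0 for e turns the blocks into integer intervals and lets e commute with U_i, i
  >= 2, by the same rule as distant U_i. The asymmetry that remains is that e U_1 e admits no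
  shortening; it is the source of the \<open>max a 1\<close>. The exchange rule must lengthen a word
  before it can reorder it, so normalisation terminates by induction on levels and block starts, not
  on length. Concatenation is given by connected components of the juxtaposition. Associativity
  therefore compares both bracketings with one gluing of three layers: loops add up, and the
  exponent of \<open>\<delta>\<^sub>e\<close> follows from conservation of blobs. Only left
  multiplication by generators is computed explicitly; closure of blob diagrams under concatenation
  and the right unit law are transferred from words. The presented algebra is not known in advance
  to be free over K, so the tensor product is not analysed structurally: each element is brought to
  a combination of normal words with coefficients in k, and these coefficients reappear as
  coordinates of its image.\<close>

declare upt_Suc [simp del]

section \<open>Reduction of words to normal form\<close>

text \<open>A formal derivation of the identity u = c v, kept apart from any algebra so that it can
  be read both in the presented algebra and on diagrams. Only rules with scalar 1 are reversible,
  since the parameters need not be invertible. As the letter 0 is e, \<open>commute\<close> contains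
  both the far commutation of the U_i and U_i e = e U_i.\<close>

inductive reduces :: "'c::comm_ring_1 \<Rightarrow> 'c \<Rightarrow> 'c \<Rightarrow> nat \<Rightarrow> nat list \<Rightarrow> 'c \<Rightarrow> nat list \<Rightarrow> bool"
  for \<delta> \<gamma> \<delta>\<^sub>e n where
  same: "reduces \<delta> \<gamma> \<delta>\<^sub>e n w 1 w"
| compose: "\<lbrakk>reduces \<delta> \<gamma> \<delta>\<^sub>e n u c v; reduces \<delta> \<gamma> \<delta>\<^sub>e n v d w\<rbrakk> \<Longrightarrow> reduces \<delta> \<gamma> \<delta>\<^sub>e n u (c * d) w"
| in_context: "reduces \<delta> \<gamma> \<delta>\<^sub>e n u c v \<Longrightarrow> reduces \<delta> \<gamma> \<delta>\<^sub>e n (x @ u @ y) c (x @ v @ y)"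
| square: "i < n \<Longrightarrow> reduces \<delta> \<gamma> \<delta>\<^sub>e n [i, i] (if i = 0 then \<delta>\<^sub>e else \<delta>) [i]"
| cancel: "\<lbrakk>0 < i; 0 < j; i < n; j < n; i = Suc j \<or> j = Suc i\<rbrakk> \<Longrightarrow> reduces \<delta> \<gamma> \<delta>\<^sub>e n [i, j, i] 1 [i]"
| uncancel: "\<lbrakk>0 < i; 0 < j; i < n; j < n; i = Suc j \<or> j = Suc i\<rbrakk> \<Longrightarrow> reduces \<delta> \<gamma> \<delta>\<^sub>e n [i] 1 [i, j, i]"
| blob: "1 < n \<Longrightarrow> reduces \<delta> \<gamma> \<delta>\<^sub>e n [1, 0, 1] \<gamma> [1]"
| commute: "\<lbrakk>i < n; j < n; Suc i < j \<or> Suc j < i\<rbrakk> \<Longrightarrow> reduces \<delta> \<gamma> \<delta>\<^sub>e n [i, j] 1 [j, i]"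

text \<open>The second argument is the start of the leading block, and equals the level
  \<open>m\<close> if that block is empty. The bound is \<open>Suc (max a 1)\<close> and not
  \<open>Suc a\<close> because exchanging a block from 2 with one from 0 would require e = e U_1
  e.\<close>

inductive normal_word :: "nat \<Rightarrow> nat \<Rightarrow> nat list \<Rightarrow> bool" where
  empty: "normal_word 0 0 []"
| block: "\<lbrakk>normal_word m a v; b \<le> Suc m; b \<le> Suc (max a 1)\<rbrakk> \<Longrightarrow> normal_word (Suc m) b ([b..<Suc m] @ v)"

lemma normal_word_Suc:
  assumes "normal_word (Suc m) b w"
  obtains a v where "normal_word m a v" "b \<le> Suc m" "b \<le> Suc (max a 1)" "w = [b..<Suc m] @ v"
  using assms by (cases rule: normal_word.cases) auto

lemma normal_word_le: "normal_word m a w \<Longrightarrow> a \<le> m"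
  by (induction rule: normal_word.induct) auto

lemma normal_word_letters: "normal_word m a w \<Longrightarrow> set w \<subseteq> {..<m}"
  by (induction rule: normal_word.induct) auto

lemma normal_word_Nil: "normal_word m m []"
proof (induction m)
  case (Suc m)
  from normal_word.block[OF Suc, of "Suc m"] show ?case by simp
qed (rule normal_word.empty)

section \<open>Normalising a word letter by letter\<close>

context
  fixes \<delta> \<gamma> \<delta>\<^sub>e :: "'c::comm_ring_1" and n :: nat
begin

abbreviation red where "red \<equiv> reduces \<delta> \<gamma> \<delta>\<^sub>e n"

lemma red_trans1: "red u 1 v \<Longrightarrow> red v c w \<Longrightarrow> red u c w"
  using reduces.compose[of \<delta> \<gamma> \<delta>\<^sub>e n u 1 v c w] by simp

lemma red_trans2: "red u c v \<Longrightarrow> red v 1 w \<Longrightarrow> red u c w"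
  using reduces.compose[of \<delta> \<gamma> \<delta>\<^sub>e n u c v 1 w] by simp

lemma red_append_left: "red u c v \<Longrightarrow> red (x @ u) c (x @ v)"
  using reduces.in_context[of \<delta> \<gamma> \<delta>\<^sub>e n u c v x "[]"] by simp

lemma red_append_right: "red u c v \<Longrightarrow> red (u @ y) c (v @ y)"
  using reduces.in_context[of \<delta> \<gamma> \<delta>\<^sub>e n u c v "[]" y] by simp

lemma red_commute1:
  assumes "i < n" "set v \<subseteq> {..<n}" "\<And>j. j \<in> set v \<Longrightarrow> Suc i < j \<or> Suc j < i"
  shows "red (i # v) 1 (v @ [i])"
  using assms(2,3)
proof (induction v)
  case (Cons j v)
  have "red ([i, j] @ v) 1 ([j, i] @ v)"
    by (rule red_append_right, rule reduces.commute) (use Cons.prems assms(1) in auto)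
  moreover have "red ([j] @ (i # v)) 1 ([j] @ (v @ [i]))"
    by (rule red_append_left, rule Cons.IH) (use Cons.prems in auto)
  ultimately show ?case using red_trans1 by force
qed (simp add: reduces.same)

lemma red_commute:
  assumes "set u \<subseteq> {..<n}" "set v \<subseteq> {..<n}"
    "\<And>i j. i \<in> set u \<Longrightarrow> j \<in> set v \<Longrightarrow> Suc i < j \<or> Suc j < i"
  shows "red (u @ v) 1 (v @ u)"
  using assms(1,3)
proof (induction u)
  case (Cons i u)
  have "red ([i] @ (u @ v)) 1 ([i] @ (v @ u))"
    by (rule red_append_left, rule Cons.IH) (use Cons.prems in auto)
  moreover have "red ((i # v) @ u) 1 ((v @ [i]) @ u)"
    by (rule red_append_right, rule red_commute1) (use Cons.prems assms(2) in auto)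
  ultimately show ?case using red_trans1 by force
qed (simp add: reduces.same)

text \<open>Put b = k + 2. The block from b commutes with all letters up to k; then k is inflated to
  k, k + 1, k, and the second copy of k moves right through the block from b. The inserted k + 1
  closes the gap between k and b. Inflating is possible only for k >= 1, hence the hypothesis with
  \<open>max a 1\<close>.\<close>

lemma red_exchange:
  assumes "Suc m \<le> n" "b \<le> Suc m" "Suc (Suc (max a 1)) \<le> b"
  shows "red ([b..<Suc m] @ [a..<m]) 1 ([a..<Suc m] @ [b - 2..<m])"
proof -
  obtain k where b: "b = Suc (Suc k)" and k: "1 \<le> k" "a \<le> k" "Suc k \<le> m"
    using assms by (cases b; cases "b - 1") auto
  let ?A = "[a..<k]" and ?B = "[b..<Suc m]" and ?C = "[Suc k..<m]"
  have a: "[a..<m] = (?A @ [k]) @ ?C" "[a..<Suc m] = ?A @ [k, Suc k] @ ?B" "[b - 2..<m] = [k] @ ?C"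
    using k b upt_add_eq_append[of a k "m - k"] upt_add_eq_append[of a k "Suc m - k"]
    by (simp_all add: upt_conv_Cons)
  have 1: "red ((?B @ (?A @ [k])) @ ?C) 1 (((?A @ [k]) @ ?B) @ ?C)"
    by (rule red_append_right, rule red_commute) (use k b assms(1) in auto)
  have 2: "red (?A @ [k] @ (?B @ ?C)) 1 (?A @ [k, Suc k, k] @ (?B @ ?C))"
    by (rule reduces.in_context, rule reduces.uncancel) (use k assms(1) in auto)
  have 3: "red ((?A @ [k, Suc k]) @ (([k] @ ?B) @ ?C)) 1 ((?A @ [k, Suc k]) @ ((?B @ [k]) @ ?C))"
    by (rule red_append_left, rule red_append_right, rule red_commute) (use k b assms(1) in auto)
  show ?thesis unfolding a
    by (rule red_trans1[OF red_trans1]) (use 1 2 3 in \<open>simp_all only: append_assoc append_Cons append_Nil\<close>)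
qed

text \<open>Restores normality when the leading block starts too far right. An exchange makes the
  start of the leading block smaller and disturbs only the levels below, so the outer induction runs
  over the level and the inner one over the start \<open>b\<close>.\<close>

lemma red_block:
  assumes "normal_word m a v" "b \<le> Suc m" "Suc m \<le> n"
  shows "\<exists>a' w. normal_word (Suc m) a' w \<and> red ([b..<Suc m] @ v) 1 w"
  using assms
proof (induction m arbitrary: a v b)
  case 0
  then have "normal_word (Suc 0) b ([b..<Suc 0] @ v)"
    by (intro normal_word.block) auto
  then show ?case using reduces.same by blast
next
  case (Suc m)
  note outer = Suc.IH
  show ?case using Suc.prems
  proof (induction b arbitrary: a v rule: less_induct)
    case (less b)
    show ?case
    proof (cases "b \<le> Suc (max a 1)")
      case True
      then have "normal_word (Suc (Suc m)) b ([b..<Suc (Suc m)] @ v)"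
        using less.prems by (intro normal_word.block)
      then show ?thesis using reduces.same by blast
    next
      case False
      from less.prems(1) obtain a0 v0 where v: "normal_word m a0 v0" "a \<le> Suc m"
        "v = [a..<Suc m] @ v0" by (rule normal_word_Suc)
      \<comment> \<open>After the exchange the second block starts at \<open>b - 2\<close>, which
        may be inadmissible over \<open>v0\<close>; the outer hypothesis repairs it one level
        below.\<close>
      have "b - 2 \<le> Suc m" "Suc m \<le> n" using less.prems by auto
      from outer[OF v(1) this] obtain a1 v1 where
        1: "normal_word (Suc m) a1 v1" "red ([b - 2..<Suc m] @ v0) 1 v1" by blast
      have "red (([b..<Suc (Suc m)] @ [a..<Suc m]) @ v0) 1 (([a..<Suc (Suc m)] @ [b - 2..<Suc m]) @ v0)"
        by (rule red_append_right, rule red_exchange) (use False less.prems in auto)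
      moreover have "red ([a..<Suc (Suc m)] @ ([b - 2..<Suc m] @ v0)) 1 ([a..<Suc (Suc m)] @ v1)"
        by (rule red_append_left, rule 1)
      ultimately have 2: "red ([b..<Suc (Suc m)] @ v) 1 ([a..<Suc (Suc m)] @ v1)"
        unfolding v append_assoc by (rule red_trans1)
      have "a < b" using False by auto
      from less.IH[OF this 1(1)] v(2) less.prems(3) obtain a2 v2 where
        "normal_word (Suc (Suc m)) a2 v2" "red ([a..<Suc (Suc m)] @ v1) 1 v2" by auto
      then show ?thesis using 2 red_trans1 by blast
    qed
  qed
qed

text \<open>A word is absorbed from its last letter to its first, so that only the prepending of a
  single letter has to be studied.\<close>

lemma red_prefix:
  assumes "\<And>i a v. normal_word m a v \<Longrightarrow> i < m \<Longrightarrow> \<exists>c a' w. normal_word m a' w \<and> red (i # v) c w"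
    and "set u \<subseteq> {..<m}" "normal_word m a v"
  shows "\<exists>c a' w. normal_word m a' w \<and> red (u @ v) c w"
  using assms(2)
proof (induction u)
  case Nil
  then show ?case using assms(3) reduces.same by fastforce
next
  case (Cons i u)
  then obtain c a1 w1 where 1: "normal_word m a1 w1" "red (u @ v) c w1" by auto
  from assms(1)[OF 1(1), of i] Cons.prems obtain d a2 w2 where 2: "normal_word m a2 w2" "red (i # w1) d w2" by auto
  have "red ([i] @ u @ v) c ([i] @ w1)" by (rule red_append_left, rule 1)
  then show ?case using 2 reduces.compose by fastforce
qed

text \<open>The cases compare \<open>i\<close> with the start \<open>a\<close> of the leading block:
  \<open>i\<close> is absorbed by it, extends it, commutes past it, or meets its own copy in it, and
  that meeting cancels a neighbour.\<close>

lemma red_letter: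
  assumes "normal_word m a w" "i < m" "m \<le> n"
  shows "\<exists>c a' w'. normal_word m a' w' \<and> red (i # w) c w'"
  using assms
proof (induction m arbitrary: a w i)
  case 0
  then show ?case by simp
next
  case (Suc m)
  from Suc.prems(1) obtain a0 v where v: "normal_word m a0 v" "a \<le> Suc m" "w = [a..<Suc m] @ v"
    by (rule normal_word_Suc)
  \<comment> \<open>Every case except i = a ends with a normal word under a leading block whose
    start may be inadmissible.\<close>
  have block: ?case if "red (i # w) c ([b..<Suc m] @ v')" "normal_word m a1 v'" "b \<le> Suc m" for b c v' a1
    using red_block[OF that(2,3) Suc.prems(3)] that(1) red_trans2 by blast
  have im: "i < n" "m < n" using Suc.prems by auto
  consider "i = a" | "Suc i = a" | "Suc i < a" | "i = Suc a" | "Suc a < i" by linarith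
  then show ?case
  proof cases
    case 1
    have "red ([i, i] @ ([Suc i..<Suc m] @ v)) (if i = 0 then \<delta>\<^sub>e else \<delta>) ([i] @ ([Suc i..<Suc m] @ v))"
      by (rule red_append_right, rule reduces.square) (rule im)
    then show ?thesis using Suc.prems 1 v
      by (intro exI conjI[of "normal_word (Suc m) a w"]) (simp_all add: upt_conv_Cons)
  next
    case 2
    then have "i # w = [i..<Suc m] @ v" using v Suc.prems by (simp add: upt_conv_Cons)
    then have "red (i # w) 1 ([i..<Suc m] @ v)" by (simp add: reduces.same)
    then show ?thesis by (rule block) (use v Suc.prems in auto)
  next
    case 3
    have "red (([i] @ [a..<Suc m]) @ v) 1 (([a..<Suc m] @ [i]) @ v)"
      by (rule red_append_right, rule red_commute) (use 3 im in auto)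
    moreover obtain c a1 v1 where 4: "normal_word m a1 v1" "red (i # v) c v1"
      using Suc.IH[OF v(1), of i] 3 v(2) Suc.prems(3) by auto
    moreover have "red ([a..<Suc m] @ (i # v)) c ([a..<Suc m] @ v1)"
      by (rule red_append_left, rule 4)
    ultimately have "red (i # w) c ([a..<Suc m] @ v1)"
      using red_trans1 v(3) by simp
    then show ?thesis by (rule block) (use 4 v in auto)
  next
    case 4
    then have w: "i # w = [Suc a, a, Suc a] @ ([Suc (Suc a)..<Suc m] @ v)"
      using Suc.prems v by (simp add: upt_conv_Cons)
    have "red [Suc a, a, Suc a] (if a = 0 then \<gamma> else 1) [Suc a]"
      using reduces.blob[of n \<delta> \<gamma> \<delta>\<^sub>e] reduces.cancel[of "Suc a" a n \<delta> \<gamma> \<delta>\<^sub>e] im 4 by auto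
    then have "red (i # w) (if a = 0 then \<gamma> else 1) ([Suc a] @ ([Suc (Suc a)..<Suc m] @ v))"
      unfolding w by (rule red_append_right)
    moreover have "[Suc a] @ ([Suc (Suc a)..<Suc m] @ v) = [Suc a..<Suc m] @ v"
      using 4 Suc.prems by (simp add: upt_conv_Cons)
    ultimately have "red (i # w) (if a = 0 then \<gamma> else 1) ([Suc a..<Suc m] @ v)"
      by (simp only: append_assoc[symmetric])
    then show ?thesis by (rule block) (use v 4 Suc.prems in auto)
  next
    case 5
    \<comment> \<open>Here \<open>i\<close> passes the letters below k and meets k, i, which cancels
      to i. The rest of the block then moves to the front; the letters it leaves behind are smaller
      than \<open>m\<close>, so the induction hypothesis absorbs them into \<open>v\<close>.\<close>
    obtain k where k: "i = Suc k" "a < k" "k < m" using 5 Suc.prems by (cases i) auto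
    let ?A = "[a..<k]" and ?B = "[Suc i..<Suc m]"
    have w: "i # w = ([i] @ ?A) @ ([k, i] @ ?B @ v)"
      using k v upt_add_eq_append[of a k "Suc m - k"] by (simp add: upt_conv_Cons)
    have "red (([i] @ ?A) @ ([k, i] @ ?B @ v)) 1 ((?A @ [i]) @ ([k, i] @ ?B @ v))"
      by (rule red_append_right, rule red_commute) (use k im in auto)
    then have 6: "red (i # w) 1 (?A @ [i, k, i] @ (?B @ v))" unfolding w by simp
    have 7: "red (?A @ [i, k, i] @ (?B @ v)) 1 (?A @ [i] @ (?B @ v))"
      by (rule reduces.in_context, rule reduces.cancel) (use k im in auto)
    have "red ((?A @ [i..<Suc m]) @ v) 1 (([i..<Suc m] @ ?A) @ v)"
      by (rule red_append_right, rule red_commute) (use k im in auto)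
    moreover have "[i..<Suc m] = [i] @ ?B"
      using k by (simp add: upt_conv_Cons)
    ultimately have 8: "red (?A @ [i] @ (?B @ v)) 1 ([i..<Suc m] @ (?A @ v))" by simp
    have 6: "red (i # w) 1 ([i..<Suc m] @ (?A @ v))"
      using red_trans1[OF red_trans1[OF 6 7] 8] .
    obtain c a1 v1 where 7: "normal_word m a1 v1" "red (?A @ v) c v1"
    proof -
      have A: "set ?A \<subseteq> {..<m}" using k by auto
      have "\<exists>c a' w. normal_word m a' w \<and> red (?A @ v) c w"
        by (rule red_prefix[OF _ A v(1)], rule Suc.IH) (use Suc.prems(3) in auto)
      then show thesis using that by blast
    qed
    have "red (i # w) c ([i..<Suc m] @ v1)"
      using 6 red_append_left[OF 7(2)] red_trans1 by blast
    then show ?thesis by (rule block) (use 7 Suc.prems in auto)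
  qed
qed

lemma red_normal_word:
  assumes "set w \<subseteq> {..<n}"
  shows "\<exists>c a v. normal_word n a v \<and> red w c v"
proof -
  have "\<exists>c a v. normal_word n a v \<and> red (w @ []) c v"
    by (rule red_prefix[OF _ assms normal_word_Nil], rule red_letter) auto
  then show ?thesis by simp
qed

lemma red_letters: "red u c v \<Longrightarrow> set u \<subseteq> {..<n} \<Longrightarrow> set v \<subseteq> {..<n}"
  by (induction rule: reduces.induct) auto

end

section \<open>Components of a family of lines\<close>

definition linked :: "'p set set \<Rightarrow> ('p \<times> 'p) set" where
  "linked F = {(x, y). \<exists>l \<in> F. x \<in> l \<and> y \<in> l}"

definition component_of :: "'p set set \<Rightarrow> 'p \<Rightarrow> 'p set" where
  "component_of F x = (linked F)\<^sup>* `` {x}"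

definition components :: "'p set \<Rightarrow> 'p set set \<Rightarrow> 'p set set" where
  "components V F = component_of F ` V"

definition contains_line :: "'p set set \<Rightarrow> 'p set \<Rightarrow> bool" where
  "contains_line D C \<longleftrightarrow> (\<exists>l \<in> D. l \<subseteq> C)"

lemma linkedI: "l \<in> F \<Longrightarrow> x \<in> l \<Longrightarrow> y \<in> l \<Longrightarrow> (x, y) \<in> linked F"
  by (auto simp: linked_def)

lemma linked_mono: "F \<subseteq> G \<Longrightarrow> linked F \<subseteq> linked G"
  by (auto simp: linked_def)

lemma linked_Un: "linked (F \<union> G) = linked F \<union> linked G"
  by (auto simp: linked_def)

lemma linked_rtrancl_sym: "(x, y) \<in> (linked F)\<^sup>* \<Longrightarrow> (y, x) \<in> (linked F)\<^sup>*"
  by (rule symD[OF sym_rtrancl]) (auto simp: sym_def linked_def)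

lemma mem_component_of: "y \<in> component_of F x \<longleftrightarrow> (x, y) \<in> (linked F)\<^sup>*"
  by (simp add: component_of_def)

lemma component_of_self [simp]: "x \<in> component_of F x"
  by (simp add: mem_component_of)

lemma component_of_eq: "y \<in> component_of F x \<Longrightarrow> component_of F y = component_of F x"
  unfolding component_of_def using linked_rtrancl_sym[of x y F] by (auto intro: rtrancl_trans)

lemma component_of_mono: "F \<subseteq> G \<Longrightarrow> component_of F x \<subseteq> component_of G x"
  using rtrancl_mono[OF linked_mono] by (auto simp: component_of_def)

lemma components_eq_component_of: "C \<in> components V F \<Longrightarrow> x \<in> C \<Longrightarrow> C = component_of F x"
  by (auto simp: components_def dest: component_of_eq)

lemma component_of_subset:
  assumes "\<Union>F \<subseteq> V" "x \<in> V"
  shows "component_of F x \<subseteq> V"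
proof
  fix y assume "y \<in> component_of F x"
  then have "(x, y) \<in> (linked F)\<^sup>*" by (simp add: mem_component_of)
  then show "y \<in> V" by (induction) (use assms in \<open>auto simp: linked_def\<close>)
qed

lemma components_subset:
  assumes "\<Union>F \<subseteq> V" "C \<in> components V F"
  shows "C \<subseteq> V"
proof -
  from assms(2) obtain x where "x \<in> V" "C = component_of F x" by (auto simp: components_def)
  then show ?thesis using component_of_subset[OF assms(1)] by simp
qed

lemma components_nonempty: "C \<in> components V F \<Longrightarrow> C \<noteq> {}"
  by (auto simp: components_def component_of_def)

lemma components_disjoint:
  "C \<in> components V F \<Longrightarrow> C' \<in> components V F \<Longrightarrow> x \<in> C \<Longrightarrow> x \<in> C' \<Longrightarrow> C = C'"
  using components_eq_component_of by metis

lemma component_of_in_components: "x \<in> V \<Longrightarrow> component_of F x \<in> components V F"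
  by (simp add: components_def)

lemma line_subset_component_of: "l \<in> F \<Longrightarrow> x \<in> l \<Longrightarrow> l \<subseteq> component_of F x"
  by (auto simp: mem_component_of linked_def intro!: r_into_rtrancl)

lemma partition_on_components:
  assumes "\<Union>F \<subseteq> V"
  shows "partition_on V (components V F)"
proof (rule partition_onI)
  show "\<Union>(components V F) = V"
  proof
    show "\<Union>(components V F) \<subseteq> V" using components_subset[OF assms] by auto
    show "V \<subseteq> \<Union>(components V F)" unfolding components_def by force
  qed
  show "{} \<notin> components V F" using components_nonempty by metis
  show "disjnt C C'" if "C \<in> components V F" "C' \<in> components V F" "C \<noteq> C'" for C C'
    using components_disjoint[OF that(1,2)] that(3) by (auto simp: disjnt_def)
qed

text \<open>A partition that breaks no line and has connected parts can be neither too fine nor too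
  coarse. It serves to read off the strands of a concrete product without following paths.\<close>

lemma components_eqI:
  assumes "partition_on V P" "\<And>l. l \<in> F \<Longrightarrow> \<exists>C \<in> P. l \<subseteq> C"
    and "\<And>C x y. C \<in> P \<Longrightarrow> x \<in> C \<Longrightarrow> y \<in> C \<Longrightarrow> (x, y) \<in> (linked F)\<^sup>*"
  shows "components V F = P"
proof -
  have eq: "component_of F x = C" if "C \<in> P" "x \<in> C" for x C
  proof
    show "C \<subseteq> component_of F x" using assms(3) that by (auto simp: mem_component_of)
    show "component_of F x \<subseteq> C"
    proof
      fix y assume "y \<in> component_of F x"
      then have "(x, y) \<in> (linked F)\<^sup>*" by (simp add: mem_component_of)
      then show "y \<in> C"
      proof induction
        case (step y z)
        then obtain l where l: "l \<in> F" "y \<in> l" "z \<in> l" by (auto simp: linked_def)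
        with assms(2) obtain C' where C': "C' \<in> P" "l \<subseteq> C'" by blast
        then have "C' = C"
          using step.IH l that partition_onD2[OF assms(1)] by (metis disjointD disjoint_iff subsetD)
        then show ?case using C' l by blast
      qed (rule that)
    qed
  qed
  have "\<exists>C \<in> P. x \<in> C" if "x \<in> V" for x
    using assms(1) that by (auto simp: partition_on_def)
  moreover have "\<exists>x \<in> V. x \<in> C" if "C \<in> P" for C
    using partition_onD1[OF assms(1)] partition_onD3[OF assms(1)] that
    by (metis UnionI ex_in_conv)
  ultimately show ?thesis unfolding components_def using eq by blast
qed

lemma component_of_image:
  assumes "inj f"
  shows "component_of ((`) f ` F) (f x) = f ` component_of F x"
proof (intro equalityI subsetI)
  fix y assume "y \<in> component_of ((`) f ` F) (f x)"
  then have "(f x, y) \<in> (linked ((`) f ` F))\<^sup>*" by (simp add: mem_component_of)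
  then show "y \<in> f ` component_of F x"
  proof induction
    case (step y z)
    then obtain y' where y': "y = f y'" "(x, y') \<in> (linked F)\<^sup>*" by (auto simp: mem_component_of)
    from step.hyps(2) obtain l where l: "l \<in> F" "y \<in> f ` l" "z \<in> f ` l" by (auto simp: linked_def)
    then obtain z' where z': "z = f z'" "z' \<in> l" by auto
    have "y' \<in> l" using l(2) y'(1) assms by (auto dest: injD)
    then have "(x, z') \<in> (linked F)\<^sup>*"
      using y'(2) linkedI[OF l(1) _ z'(2)] by (metis rtrancl.rtrancl_into_rtrancl)
    then show ?case using z' by (simp add: mem_component_of)
  qed simp
next
  fix y assume "y \<in> f ` component_of F x"
  then obtain y' where y': "y = f y'" "(x, y') \<in> (linked F)\<^sup>*" by (auto simp: mem_component_of)
  from y'(2) have "(f x, f y') \<in> (linked ((`) f ` F))\<^sup>*"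
  proof induction
    case (step y z)
    then have "(f y, f z) \<in> linked ((`) f ` F)" by (auto simp: linked_def)
    then show ?case using step.IH by simp
  qed simp
  then show "y \<in> component_of ((`) f ` F) (f x)" by (simp add: y' mem_component_of)
qed

lemma components_image:
  assumes "inj f"
  shows "components (f ` V) ((`) f ` F) = (`) f ` components V F"
  using component_of_image[OF assms] by (auto simp: components_def image_image)

lemma contains_line_image:
  assumes "inj f"
  shows "contains_line ((`) f ` D) (f ` C) \<longleftrightarrow> contains_line D C"
  using assms by (simp add: contains_line_def inj_image_subset_iff)

text \<open>With \<open>M\<close> the middle points of a juxtaposition, this yields the lines of the product.\<close>

definition contract :: "'p set \<Rightarrow> 'p set set \<Rightarrow> 'p set \<Rightarrow> 'p set set \<Rightarrow> 'p set set" where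
  "contract V F M D = (\<lambda>C. C - M) ` {C \<in> components V F. \<not> C \<subseteq> M \<and> contains_line D C}"

text \<open>\<open>FA\<close> consists of the two layers glued first, \<open>M\<close> is the level
  at which they meet, and \<open>FB\<close> is the third layer. As \<open>VB\<close> avoids
  \<open>M\<close>, the third layer sees the other two only through points outside \<open>M\<close>,
  so contracting those two to their outer ends before gluing loses nothing but the loops inside
  \<open>M\<close>. \<open>DA\<close> and \<open>DB\<close> are the decorated lines.\<close>

locale contraction =
  fixes VA VB M :: "'p set" and FA FB DA DB :: "'p set set"
  assumes FA: "\<Union>FA \<subseteq> VA" "{} \<notin> FA" and FB: "\<Union>FB \<subseteq> VB" "{} \<notin> FB"
    and M: "VB \<inter> M = {}" "M \<subseteq> VA" and D: "DA \<subseteq> FA" "DB \<subseteq> FB"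
    and VA: "VA \<subseteq> \<Union>FA"
begin

abbreviation "FA' \<equiv> contract VA FA M FA"
abbreviation "DA' \<equiv> contract VA FA M DA"

lemma component_contains_line:
  assumes "C \<in> components VA FA"
  shows "contains_line FA C"
proof -
  from assms obtain x where x: "x \<in> VA" "C = component_of FA x" by (auto simp: components_def)
  then obtain l where "l \<in> FA" "x \<in> l" using VA by auto
  then have "l \<subseteq> C" using line_subset_component_of x(2) by metis
  then show ?thesis using \<open>l \<in> FA\<close> by (auto simp: contains_line_def)
qed

lemma contract_link:
  assumes "x \<notin> M" "y \<notin> M" "(x, y) \<in> (linked FA)\<^sup>*"
  shows "(x, y) \<in> (linked (FA' \<union> FB))\<^sup>*"
proof (cases "x = y")
  case False
  with assms(3) obtain z where "(x, z) \<in> linked FA" by (meson converse_rtranclE)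
  then have "x \<in> VA" using FA by (auto simp: linked_def)
  then have C: "component_of FA x \<in> components VA FA" by (rule component_of_in_components)
  have x: "x \<in> component_of FA x - M" and y: "y \<in> component_of FA x - M"
    using assms by (simp_all add: mem_component_of)
  have "component_of FA x - M \<in> FA'"
    unfolding contract_def using component_contains_line[OF C] C x by blast
  then have "component_of FA x - M \<in> FA' \<union> FB" ..
  then show ?thesis using linkedI[OF _ x y] by blast
qed simp

lemma contract_rtrancl_iff:
  assumes "x \<notin> M" "y \<notin> M"
  shows "(x, y) \<in> (linked (FA' \<union> FB))\<^sup>* \<longleftrightarrow> (x, y) \<in> (linked (FA \<union> FB))\<^sup>*"
proof
  assume "(x, y) \<in> (linked (FA \<union> FB))\<^sup>*"
  \<comment> \<open>The induction is strengthened from \<open>y\<close> to all outer points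
    \<open>w\<close> connected to \<open>y\<close> within \<open>FA\<close>: a path may pause at a
    point of \<open>M\<close>, which the contracted family no longer contains.\<close>
  then have "\<forall>w. w \<notin> M \<longrightarrow> (y, w) \<in> (linked FA)\<^sup>* \<longrightarrow> (x, w) \<in> (linked (FA' \<union> FB))\<^sup>*"
  proof induction
    case base
    then show ?case using contract_link assms by blast
  next
    case (step y z)
    show ?case
    proof (intro allI impI)
      fix w assume w: "w \<notin> M" "(z, w) \<in> (linked FA)\<^sup>*"
      from step.hyps(2) have "(y, z) \<in> linked FA \<or> (y, z) \<in> linked FB" by (simp add: linked_Un)
      then consider "(y, z) \<in> linked FA" | "(y, z) \<in> linked FB" by blast
      then show "(x, w) \<in> (linked (FA' \<union> FB))\<^sup>*"
      proof cases
        case 1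
        then show ?thesis using step.IH w by (meson converse_rtrancl_into_rtrancl)
      next
        case 2
        then have "y \<notin> M" "z \<notin> M" using FB M by (auto simp: linked_def)
        then have "(x, y) \<in> (linked (FA' \<union> FB))\<^sup>*" "(z, w) \<in> (linked (FA' \<union> FB))\<^sup>*"
          using step.IH contract_link w by auto
        moreover have "(y, z) \<in> linked (FA' \<union> FB)" using 2 by (simp add: linked_Un)
        ultimately show ?thesis by (metis rtrancl.rtrancl_into_rtrancl rtrancl_trans)
      qed
    qed
  qed
  then show "(x, y) \<in> (linked (FA' \<union> FB))\<^sup>*" using assms by blast
next
  assume "(x, y) \<in> (linked (FA' \<union> FB))\<^sup>*"
  then show "(x, y) \<in> (linked (FA \<union> FB))\<^sup>*"
  proof induction
    case (step y z)
    have "(y, z) \<in> (linked (FA \<union> FB))\<^sup>*"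
    proof (cases "(y, z) \<in> linked FB")
      case False
      then obtain C where "C \<in> components VA FA" "y \<in> C" "z \<in> C"
        using step.hyps(2) by (auto simp: linked_def contract_def)
      then have "(y, z) \<in> (linked FA)\<^sup>*"
        using components_eq_component_of mem_component_of by metis
      then show ?thesis using rtrancl_mono[OF linked_mono[of FA "FA \<union> FB"]] by blast
    qed (auto simp: linked_Un)
    then show ?case using step.IH by (rule rtrancl_trans[rotated])
  qed simp
qed

lemma component_of_contract:
  assumes "x \<notin> M"
  shows "component_of (FA' \<union> FB) x = component_of (FA \<union> FB) x - M"
proof -
  have "\<Union>(FA' \<union> FB) \<subseteq> - M" using FB M by (auto simp: contract_def)
  then have "component_of (FA' \<union> FB) x \<subseteq> - M" using assms by (intro component_of_subset) auto
  then have *: "y \<notin> M" if "y \<in> component_of (FA' \<union> FB) x" for y using that by blast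
  show ?thesis
  proof (intro equalityI subsetI)
    fix y assume "y \<in> component_of (FA' \<union> FB) x"
    then show "y \<in> component_of (FA \<union> FB) x - M"
      using *[of y] contract_rtrancl_iff[OF assms, of y] by (simp add: mem_component_of)
  next
    fix y assume "y \<in> component_of (FA \<union> FB) x - M"
    then show "y \<in> component_of (FA' \<union> FB) x"
      using contract_rtrancl_iff[OF assms, of y] by (simp add: mem_component_of)
  qed
qed

lemma components_contract:
  "components (VA \<union> VB - M) (FA' \<union> FB) = (\<lambda>C. C - M) ` {C \<in> components (VA \<union> VB) (FA \<union> FB). \<not> C \<subseteq> M}"
proof (intro equalityI subsetI)
  fix C assume "C \<in> components (VA \<union> VB - M) (FA' \<union> FB)"
  then obtain x where x: "x \<in> VA \<union> VB" "x \<notin> M" "C = component_of (FA' \<union> FB) x"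
    unfolding components_def by blast
  then have "C = component_of (FA \<union> FB) x - M" by (simp add: component_of_contract)
  moreover have "\<not> component_of (FA \<union> FB) x \<subseteq> M"
    using component_of_self[of x "FA \<union> FB"] x(2) by blast
  ultimately have "C = component_of (FA \<union> FB) x - M" "\<not> component_of (FA \<union> FB) x \<subseteq> M" .
  then show "C \<in> (\<lambda>C. C - M) ` {C \<in> components (VA \<union> VB) (FA \<union> FB). \<not> C \<subseteq> M}"
    using component_of_in_components[OF x(1), of "FA \<union> FB"] by simp
next
  fix C assume "C \<in> (\<lambda>C. C - M) ` {C \<in> components (VA \<union> VB) (FA \<union> FB). \<not> C \<subseteq> M}"
  then obtain C' x where C': "C' \<in> components (VA \<union> VB) (FA \<union> FB)" "x \<in> C'" "x \<notin> M" "C = C' - M" by auto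
  then have "x \<in> VA \<union> VB" using components_subset[OF _ C'(1)] FA FB by auto
  moreover have "C = component_of (FA' \<union> FB) x"
    using components_eq_component_of[OF C'(1,2)] component_of_contract[OF C'(3)] C'(4) by simp
  ultimately show "C \<in> components (VA \<union> VB - M) (FA' \<union> FB)"
    using C'(3) by (simp add: components_def)
qed

text \<open>A component that stays inside \<open>M\<close> cannot be left along a line of
  \<open>FB\<close>, since those lines avoid \<open>M\<close>.\<close>

lemma component_of_internal:
  assumes "x \<in> M" "component_of FA x \<subseteq> M \<or> component_of (FA \<union> FB) x \<subseteq> M"
  shows "component_of (FA \<union> FB) x = component_of FA x"
proof
  show sub: "component_of FA x \<subseteq> component_of (FA \<union> FB) x"
    by (simp add: component_of_mono)
  show "component_of (FA \<union> FB) x \<subseteq> component_of FA x"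
  proof
    fix y assume "y \<in> component_of (FA \<union> FB) x"
    then have "(x, y) \<in> (linked (FA \<union> FB))\<^sup>*" by (simp add: mem_component_of)
    then show "y \<in> component_of FA x"
    proof induction
      case (step y z)
      then have "y \<in> M" using assms sub by blast
      then have "(y, z) \<in> linked FA"
        using step.hyps(2) FB M by (auto simp: linked_def)
      then show ?case using step.IH by (simp add: mem_component_of)
    qed simp
  qed
qed

lemma internal_components:
  assumes "C \<subseteq> M"
  shows "C \<in> components (VA \<union> VB) (FA \<union> FB) \<longleftrightarrow> C \<in> components VA FA"
proof
  assume C: "C \<in> components (VA \<union> VB) (FA \<union> FB)"
  then obtain x where x: "x \<in> C" using components_nonempty by fastforce
  have "x \<in> M" "x \<in> VA" using x assms M by auto
  have "C = component_of (FA \<union> FB) x" using components_eq_component_of[OF C x] .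
  also have "\<dots> = component_of FA x"
    by (rule component_of_internal[OF \<open>x \<in> M\<close>]) (use assms calculation in simp)
  finally show "C \<in> components VA FA" using component_of_in_components[OF \<open>x \<in> VA\<close>] by simp
next
  assume C: "C \<in> components VA FA"
  then obtain x where x: "x \<in> C" using components_nonempty by fastforce
  have "x \<in> M" "x \<in> VA \<union> VB" using x assms M by auto
  have "C = component_of FA x" using components_eq_component_of[OF C x] .
  also have "\<dots> = component_of (FA \<union> FB) x"
    by (rule component_of_internal[OF \<open>x \<in> M\<close>, symmetric]) (use assms calculation in simp)
  finally show "C \<in> components (VA \<union> VB) (FA \<union> FB)"
    using component_of_in_components[OF \<open>x \<in> VA \<union> VB\<close>] by simp
qed

lemma DB_outside: "l \<in> DB \<Longrightarrow> l \<noteq> {} \<and> l \<inter> M = {}"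
  using D(2) FB M(1) by blast

lemma contains_line_internal:
  assumes "C \<subseteq> M"
  shows "contains_line (DA \<union> DB) C \<longleftrightarrow> contains_line DA C"
proof -
  have "\<not> l \<subseteq> C" if "l \<in> DB" for l
    using DB_outside[OF that] assms by blast
  then show ?thesis unfolding contains_line_def by blast
qed

lemma contains_line_contract:
  assumes C: "C \<in> components (VA \<union> VB) (FA \<union> FB)" "\<not> C \<subseteq> M"
  shows "contains_line (DA' \<union> DB) (C - M) \<longleftrightarrow> contains_line (DA \<union> DB) C"
proof
  assume "contains_line (DA \<union> DB) C"
  then obtain l where l: "l \<in> DA \<union> DB" "l \<subseteq> C" by (auto simp: contains_line_def)
  show "contains_line (DA' \<union> DB) (C - M)"
  proof (cases "l \<in> DB")
    case True
    then have "l \<subseteq> C - M" using DB_outside l by blast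
    then show ?thesis using True unfolding contains_line_def by blast
  next
    case False
    then have l': "l \<in> DA" "l \<in> FA" using l D by auto
    then have "l \<noteq> {}" using FA(2) by metis
    then obtain x where x: "x \<in> l" "x \<in> VA" using FA(1) l' by blast
    let ?S = "component_of FA x"
    have S: "?S \<in> components VA FA" using component_of_in_components[OF x(2)] .
    have "C = component_of (FA \<union> FB) x"
      using components_eq_component_of[OF C(1)] x l by blast
    then have SC: "?S \<subseteq> C"
      by (simp add: component_of_mono)
    \<comment> \<open>A component of \<open>FA\<close> inside \<open>M\<close> is not enlarged by
      \<open>FB\<close>; it would be all of \<open>C\<close>, which reaches outside
      \<open>M\<close>.\<close>
    have "\<not> ?S \<subseteq> M"
    proof
      assume "?S \<subseteq> M"
      then have "?S \<in> components (VA \<union> VB) (FA \<union> FB)" using internal_components S by blast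
      then have "?S = C" using components_disjoint[OF _ C(1) component_of_self[of x FA]] SC component_of_self[of x FA] by (metis subsetD)
      with C(2) \<open>?S \<subseteq> M\<close> show False by simp
    qed
    moreover have "contains_line DA ?S"
      using line_subset_component_of[OF l'(2) x(1)] l'(1) unfolding contains_line_def by blast
    ultimately have "?S - M \<in> DA'" using S unfolding contract_def by blast
    moreover have "?S - M \<subseteq> C - M" using SC by blast
    ultimately show ?thesis unfolding contains_line_def by blast
  qed
next
  assume "contains_line (DA' \<union> DB) (C - M)"
  then obtain l where l: "l \<in> DA' \<union> DB" "l \<subseteq> C - M" by (auto simp: contains_line_def)
  show "contains_line (DA \<union> DB) C"
  proof (cases "l \<in> DB")
    case False
    then obtain S k where S: "S \<in> components VA FA" "\<not> S \<subseteq> M" "l = S - M" "k \<in> DA" "k \<subseteq> S"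
      using l(1) unfolding contract_def contains_line_def by blast
    then obtain x where x: "x \<in> S" "x \<in> C" using l by blast
    then have "C = component_of (FA \<union> FB) x" "S = component_of FA x"
      using components_eq_component_of[OF C(1)] components_eq_component_of[OF S(1)] by auto
    then have "S \<subseteq> C"
      by (simp add: component_of_mono)
    then show ?thesis using S unfolding contains_line_def by blast
  next
    case True
    then show ?thesis using l unfolding contains_line_def by blast
  qed
qed

lemma inj_on_contract: "inj_on (\<lambda>C. C - M) {C \<in> components (VA \<union> VB) (FA \<union> FB). \<not> C \<subseteq> M}"
proof (rule inj_onI)
  fix C C'
  assume *: "C \<in> {C \<in> components (VA \<union> VB) (FA \<union> FB). \<not> C \<subseteq> M}"
    "C' \<in> {C \<in> components (VA \<union> VB) (FA \<union> FB). \<not> C \<subseteq> M}" "C - M = C' - M"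
  then obtain x where x: "x \<in> C" "x \<notin> M" by auto
  then have "x \<in> C'" using *(3) by blast
  with x * show "C = C'" using components_disjoint[of C "VA \<union> VB" "FA \<union> FB" C' x] by simp
qed

text \<open>The disjunction lets one statement serve both components of a diagram: the decorated
  lines, and the lines altogether when the whole family is taken as the marked one.\<close>

lemma contract_contract:
  assumes "D' = DA' \<union> DB \<and> DC = DA \<union> DB \<or> D' = FA' \<union> FB \<and> DC = FA \<union> FB"
  shows "contract (VA \<union> VB - M) (FA' \<union> FB) N D' = contract (VA \<union> VB) (FA \<union> FB) (M \<union> N) DC"
proof -
  have *: "contains_line D' (C - M) \<longleftrightarrow> contains_line DC C"
    if "C \<in> components (VA \<union> VB) (FA \<union> FB)" "\<not> C \<subseteq> M" for C
  proof -
    interpret F: contraction VA VB M FA FB FA FB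
      by unfold_locales (use FA FB M VA in auto)
    show ?thesis using contains_line_contract[OF that] F.contains_line_contract[OF that] assms by blast
  qed
  have sub: "C - M \<subseteq> N \<longleftrightarrow> C \<subseteq> M \<union> N" for C by blast
  have "contract (VA \<union> VB - M) (FA' \<union> FB) N D' =
    (\<lambda>C. C - N) ` {C \<in> (\<lambda>C. C - M) ` {C \<in> components (VA \<union> VB) (FA \<union> FB). \<not> C \<subseteq> M}.
      \<not> C \<subseteq> N \<and> contains_line D' C}"
    unfolding components_contract[symmetric] by (simp only: contract_def)
  also have "\<dots> = (\<lambda>C. C - N) ` (\<lambda>C. C - M) ` {C \<in> components (VA \<union> VB) (FA \<union> FB).
      \<not> C \<subseteq> M \<and> \<not> C - M \<subseteq> N \<and> contains_line D' (C - M)}"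
    by (simp only: Compr_image_eq mem_Collect_eq conj_assoc)
  also have "{C \<in> components (VA \<union> VB) (FA \<union> FB).
      \<not> C \<subseteq> M \<and> \<not> C - M \<subseteq> N \<and> contains_line D' (C - M)} =
    {C \<in> components (VA \<union> VB) (FA \<union> FB). \<not> C \<subseteq> M \<union> N \<and> contains_line DC C}"
    using *[simplified] sub by (intro Collect_cong) (metis le_supI1)
  finally show ?thesis
    by (simp add: contract_def image_image Diff_eq Int_assoc)
qed

text \<open>Loops closed at the first stage lie in \<open>M\<close> and are untouched by
  \<open>FB\<close>; any other loop turns into a loop of the second stage by deleting
  \<open>M\<close>. With \<open>b\<close> as the mark, the number of loops is additive for decorated
  and undecorated ones separately.\<close>

lemma card_internal:
  assumes "finite VA" "finite VB" "M \<inter> N = {}"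
  shows "card {C \<in> components (VA \<union> VB) (FA \<union> FB). C \<subseteq> M \<union> N \<and> (contains_line (DA \<union> DB) C \<longleftrightarrow> b)} =
    card {C \<in> components VA FA. C \<subseteq> M \<and> (contains_line DA C \<longleftrightarrow> b)} +
    card {C \<in> components (VA \<union> VB - M) (FA' \<union> FB). C \<subseteq> N \<and> (contains_line (DA' \<union> DB) C \<longleftrightarrow> b)}"
    (is "card ?T = card ?A + card ?B")
proof -
  let ?K = "components (VA \<union> VB) (FA \<union> FB)"
  let ?B' = "{C \<in> ?K. \<not> C \<subseteq> M \<and> C \<subseteq> M \<union> N \<and> (contains_line (DA \<union> DB) C \<longleftrightarrow> b)}"
  have fin: "finite ?K" using assms by (simp add: components_def)
  have "?T = ?A \<union> ?B'"
  proof (intro equalityI subsetI)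
    fix C assume "C \<in> ?T"
    then show "C \<in> ?A \<union> ?B'"
      using internal_components[of C] contains_line_internal[of C] by (cases "C \<subseteq> M") simp_all
  next
    fix C assume "C \<in> ?A \<union> ?B'"
    then show "C \<in> ?T"
      using internal_components[of C] contains_line_internal[of C] by (cases "C \<subseteq> M") (auto simp: le_supI1)
  qed
  moreover have "?A \<inter> ?B' = {}" by auto
  moreover have "finite ?A" "finite ?B'" using fin assms by (auto simp: components_def)
  moreover have "?B = (\<lambda>C. C - M) ` {C \<in> ?K. \<not> C \<subseteq> M \<and> C - M \<subseteq> N \<and> (contains_line (DA' \<union> DB) (C - M) \<longleftrightarrow> b)}"
    unfolding components_contract by blast
  moreover have "\<dots> = (\<lambda>C. C - M) ` ?B'"
    using contains_line_contract by (intro arg_cong[where f = "(`) (\<lambda>C. C - M)"] Collect_cong conj_cong refl) auto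
  moreover have "inj_on (\<lambda>C. C - M) ?B'"
    by (rule inj_on_subset[OF inj_on_contract]) auto
  ultimately show ?thesis by (simp add: card_Un_disjoint card_image)
qed

end

section \<open>Associativity of concatenation\<close>

text \<open>Associativity is proved for set partitions with marked blocks, which concatenation
  visibly preserves, so that it is available before concatenation is known to preserve
  planarity.\<close>

definition partition_diagram :: "nat \<Rightarrow> diagram \<Rightarrow> bool" where
  "partition_diagram n d \<longleftrightarrow> partition_on (vertices n) (fst d) \<and> snd d \<subseteq> fst d"

text \<open>Three stacked diagrams occupy four levels. The grid of pairs (level, index) is a common
  home for the points of every juxtaposition that occurs in either bracketing.\<close>

fun place :: "nat \<Rightarrow> nat \<Rightarrow> vertex \<Rightarrow> nat \<times> nat" where
  "place a b (North j) = (a, j)"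
| "place a b (South j) = (b, j)"

fun place_point :: "nat \<Rightarrow> nat \<Rightarrow> nat \<Rightarrow> point \<Rightarrow> nat \<times> nat" where
  "place_point a b c (Top j) = (a, j)"
| "place_point a b c (Mid j) = (b, j)"
| "place_point a b c (Bot j) = (c, j)"

definition glue :: "vertex set set \<Rightarrow> vertex set set \<Rightarrow> point set set" where
  "glue F G = (`) upper ` F \<union> (`) lower ` G"

definition marked_loops :: "nat \<Rightarrow> diagram \<Rightarrow> diagram \<Rightarrow> bool \<Rightarrow> point set set" where
  "marked_loops n d1 d2 b = {C \<in> strands n d1 d2. is_loop C \<and> (blob_count d1 d2 C > 0 \<longleftrightarrow> b)}"

lemma finite_vertices [simp]: "finite (vertices n)"
  by (simp add: vertices_def)

lemma finite_points [simp]: "finite (points n)"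
  by (simp add: points_def)

lemma place_point_upper [simp]: "place_point a b c (upper v) = place a b v"
  by (cases v) auto

lemma place_point_lower [simp]: "place_point a b c (lower v) = place b c v"
  by (cases v) auto

lemma inj_place: "a \<noteq> b \<Longrightarrow> inj (place a b)"
proof (rule injI)
  fix v w assume "a \<noteq> b" "place a b v = place a b w"
  then show "v = w" by (cases v; cases w) auto
qed

lemma inj_place_point: "distinct [a, b, c] \<Longrightarrow> inj (place_point a b c)"
proof (rule injI)
  fix v w assume "distinct [a, b, c]" "place_point a b c v = place_point a b c w"
  then show "v = w" by (cases v; cases w) auto
qed

lemma inj_image_set: "inj f \<Longrightarrow> inj ((`) f)"
  by (rule injI) (simp add: inj_image_eq_iff)

lemma points_eq: "points n = upper ` vertices n \<union> lower ` vertices n"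
  by (auto simp: vertices_def points_def image_Un image_image)

lemma place_vertices: "place a b ` vertices n = {a, b} \<times> {1..n}"
  by (auto simp: vertices_def image_Un image_image)

lemma place_points: "place_point a b c ` points n = {a, b, c} \<times> {1..n}"
  by (auto simp: points_def image_Un image_image)

lemma place_glue: "(`) (place_point a b c) ` glue F G = (`) (place a b) ` F \<union> (`) (place b c) ` G"
  by (simp add: glue_def image_Un image_image)

lemma strands_eq: "strands n d1 d2 = components (points n) (glue (fst d1) (fst d2))"
proof -
  have "joined d1 d2 = linked (glue (fst d1) (fst d2))"
    by (auto simp: joined_def linked_def glue_def)
  then show ?thesis by (auto simp: strands_def components_def component_of_def)
qed

lemma partition_diagramD:
  assumes "partition_diagram n d"
  shows "\<Union>(fst d) = vertices n" "{} \<notin> fst d" "finite (fst d)" "finite (snd d)" "snd d \<subseteq> fst d"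
    "l \<in> fst d \<Longrightarrow> l' \<in> fst d \<Longrightarrow> v \<in> l \<Longrightarrow> v \<in> l' \<Longrightarrow> l = l'"
proof -
  have p: "partition_on (vertices n) (fst d)" and s: "snd d \<subseteq> fst d"
    using assms by (simp_all add: partition_diagram_def)
  show "\<Union>(fst d) = vertices n" "{} \<notin> fst d"
    using partition_onD1[OF p] partition_onD3[OF p] by auto
  show f: "finite (fst d)" using finite_elements[OF _ p] by simp
  show "finite (snd d)" using s f finite_subset by auto
  show "snd d \<subseteq> fst d" by (rule s)
  show "l = l'" if "l \<in> fst d" "l' \<in> fst d" "v \<in> l" "v \<in> l'"
    using partition_onD2[OF p] that by (auto simp: disjoint_def)
qed

section \<open>Lines, loops and blobs of a single juxtaposition\<close>

context
  fixes n :: nat and d1 d2 :: diagram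
  assumes d1: "partition_diagram n d1" and d2: "partition_diagram n d2"
begin

lemma glue_cover: "\<Union>(glue (fst d1) (fst d2)) = points n"
proof -
  have "\<Union>(glue (fst d1) (fst d2)) = upper ` \<Union>(fst d1) \<union> lower ` \<Union>(fst d2)"
    by (auto simp: glue_def)
  then show ?thesis
    by (simp add: points_eq partition_diagramD(1)[OF d1] partition_diagramD(1)[OF d2])
qed

lemma partition_on_strands: "partition_on (points n) (strands n d1 d2)"
  unfolding strands_eq by (rule partition_on_components) (simp add: glue_cover)

lemma finite_strands: "finite (strands n d1 d2)"
  using finite_elements[OF _ partition_on_strands] by simp

lemma strand_subset: "C \<in> strands n d1 d2 \<Longrightarrow> C \<subseteq> points n"
  using partition_onD1[OF partition_on_strands] by auto

lemma blob_count_pos: "blob_count d1 d2 C > 0 \<longleftrightarrow> contains_line (glue (snd d1) (snd d2)) C"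
proof -
  have "finite {l \<in> snd d1. upper ` l \<subseteq> C}" "finite {l \<in> snd d2. lower ` l \<subseteq> C}"
    using partition_diagramD(4)[OF d1] partition_diagramD(4)[OF d2] by auto
  then have "blob_count d1 d2 C > 0 \<longleftrightarrow> {l \<in> snd d1. upper ` l \<subseteq> C} \<noteq> {} \<or> {l \<in> snd d2. lower ` l \<subseteq> C} \<noteq> {}"
    by (simp only: blob_count_def add_gr_0 card_gt_0_iff simp_thms)
  also have "\<dots> \<longleftrightarrow> contains_line (glue (snd d1) (snd d2)) C"
    by (auto simp: contains_line_def glue_def)
  finally show ?thesis .
qed

lemma strand_ends_nonempty: "\<not> is_loop C \<Longrightarrow> strand_ends C \<noteq> {}"
proof -
  assume "\<not> is_loop C"
  then obtain p where "p \<in> C" "p \<notin> range Mid" by (auto simp: is_loop_def)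
  then show ?thesis by (cases p) (auto simp: strand_ends_def)
qed

lemma strand_ends_inj:
  assumes "C \<in> strands n d1 d2" "C' \<in> strands n d1 d2" "v \<in> strand_ends C" "v \<in> strand_ends C'"
  shows "C = C'"
proof -
  have "\<exists>p. p \<in> C \<and> p \<in> C'" using assms(3,4) by (cases v) (auto simp: strand_ends_def)
  then show ?thesis using components_disjoint assms(1,2) unfolding strands_eq by metis
qed

lemma partition_diagram_concat: "partition_diagram n (concat_diagram n d1 d2)"
  unfolding partition_diagram_def
proof (intro conjI partition_onI)
  show "snd (concat_diagram n d1 d2) \<subseteq> fst (concat_diagram n d1 d2)"
    by (auto simp: concat_diagram_def)
  show "{} \<notin> fst (concat_diagram n d1 d2)"
    using strand_ends_nonempty by (auto simp: concat_diagram_def)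
  show "disjnt l l'" if "l \<in> fst (concat_diagram n d1 d2)" "l' \<in> fst (concat_diagram n d1 d2)" "l \<noteq> l'" for l l'
  proof -
    from that obtain C C' where "C \<in> strands n d1 d2" "C' \<in> strands n d1 d2" "l = strand_ends C" "l' = strand_ends C'"
      by (auto simp: concat_diagram_def)
    then show ?thesis using strand_ends_inj[of C C'] that(3) by (auto simp: disjnt_def)
  qed
  show "\<Union>(fst (concat_diagram n d1 d2)) = vertices n"
  proof (intro equalityI subsetI)
    fix v assume "v \<in> \<Union>(fst (concat_diagram n d1 d2))"
    then obtain C where "C \<in> strands n d1 d2" "v \<in> strand_ends C" by (auto simp: concat_diagram_def)
    then show "v \<in> vertices n" using strand_subset[of C]
      by (auto simp: strand_ends_def points_def vertices_def)
  next
    fix v assume v: "v \<in> vertices n"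
    define p where "p = (case v of North j \<Rightarrow> Top j | South j \<Rightarrow> Bot j)"
    have "p \<in> points n" using v by (auto simp: p_def vertices_def points_def)
    then obtain C where C: "C \<in> strands n d1 d2" "p \<in> C"
      using partition_onD1[OF partition_on_strands] by auto
    then have "\<not> is_loop C" "v \<in> strand_ends C"
      by (auto simp: p_def is_loop_def strand_ends_def split: vertex.splits)
    then show "v \<in> \<Union>(fst (concat_diagram n d1 d2))" using C by (auto simp: concat_diagram_def)
  qed
qed

lemma place_strand_ends:
  assumes "distinct [a, b, c]" "C \<subseteq> points n"
  shows "place a c ` strand_ends C = place_point a b c ` C - {b} \<times> {1..n}"
proof (intro equalityI subsetI)
  fix x assume "x \<in> place a c ` strand_ends C"
  then show "x \<in> place_point a b c ` C - {b} \<times> {1..n}"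
    using assms(1) by (force simp: strand_ends_def)
next
  fix x assume "x \<in> place_point a b c ` C - {b} \<times> {1..n}"
  then obtain p where p: "p \<in> C" "x = place_point a b c p" "x \<notin> {b} \<times> {1..n}" by auto
  show "x \<in> place a c ` strand_ends C"
  proof (cases p)
    case (Top j)
    then show ?thesis using p by (intro image_eqI[of _ _ "North j"]) (auto simp: strand_ends_def)
  next
    case (Mid j)
    then have "Mid j \<in> points n" using assms(2) p(1) by blast
    then show ?thesis using p Mid by (auto simp: points_def)
  next
    case (Bot j)
    then show ?thesis using p by (intro image_eqI[of _ _ "South j"]) (auto simp: strand_ends_def)
  qed
qed

lemma is_loop_place:
  assumes "distinct [a, b, c]" "C \<subseteq> points n"
  shows "place_point a b c ` C \<subseteq> {b} \<times> {1..n} \<longleftrightarrow> is_loop C"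
proof
  assume *: "place_point a b c ` C \<subseteq> {b} \<times> {1..n}"
  have "p \<in> range Mid" if "p \<in> C" for p
  proof -
    have "place_point a b c p \<in> {b} \<times> {1..n}" using * that by blast
    then show ?thesis using assms(1) by (cases p) auto
  qed
  then show "is_loop C" by (auto simp: is_loop_def)
next
  assume "is_loop C"
  then show "place_point a b c ` C \<subseteq> {b} \<times> {1..n}"
    using assms(2) by (fastforce simp: is_loop_def points_def)
qed

context
  fixes a b c :: nat
  assumes abc: "distinct [a, b, c]"
begin

abbreviation "lines12 \<equiv> (`) (place a b) ` fst d1 \<union> (`) (place b c) ` fst d2"
abbreviation "blobs12 \<equiv> (`) (place a b) ` snd d1 \<union> (`) (place b c) ` snd d2"
abbreviation "space12 \<equiv> {a, b, c} \<times> {1..n}"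
abbreviation "middle12 \<equiv> {b} \<times> {1..n}"

lemma components_place: "components space12 lines12 = (`) (place_point a b c) ` strands n d1 d2"
  unfolding strands_eq components_image[OF inj_place_point[OF abc], symmetric] place_glue place_points ..

lemma contains_line_place:
  "contains_line blobs12 (place_point a b c ` C) \<longleftrightarrow> blob_count d1 d2 C > 0"
  unfolding blob_count_pos contains_line_image[OF inj_place_point[OF abc], symmetric] place_glue ..

lemma place_fst_concat:
  "(`) (place a c) ` fst (concat_diagram n d1 d2) = contract space12 lines12 middle12 lines12"
proof -
  have 1: "contains_line lines12 (place_point a b c ` C)" if "C \<in> strands n d1 d2" for C
  proof -
    have "C \<subseteq> points n" "C \<noteq> {}"
      using strand_subset[OF that] partition_onD3[OF partition_on_strands] that by auto
    then obtain p where "p \<in> C" "p \<in> points n" by auto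
    then obtain l where l: "l \<in> glue (fst d1) (fst d2)" "p \<in> l" using glue_cover by auto
    have "C = component_of (glue (fst d1) (fst d2)) p"
      using components_eq_component_of that \<open>p \<in> C\<close> unfolding strands_eq by metis
    then have "l \<subseteq> C" using line_subset_component_of[OF l] by simp
    then have "contains_line (glue (fst d1) (fst d2)) C" using l(1) by (auto simp: contains_line_def)
    then show ?thesis unfolding place_glue[symmetric] contains_line_image[OF inj_place_point[OF abc]] .
  qed
  have "contract space12 lines12 middle12 lines12 =
    (\<lambda>C. place_point a b c ` C - middle12) `
      {C \<in> strands n d1 d2. \<not> place_point a b c ` C \<subseteq> middle12 \<and> contains_line lines12 (place_point a b c ` C)}"
    unfolding contract_def components_place by (simp only: Compr_image_eq image_image)
  also have "\<dots> = (\<lambda>C. place a c ` strand_ends C) ` {C \<in> strands n d1 d2. \<not> is_loop C}"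
    using 1 is_loop_place[OF abc strand_subset] place_strand_ends[OF abc strand_subset]
    by (intro image_cong Collect_cong) auto
  finally show ?thesis by (simp add: concat_diagram_def image_image)
qed

lemma place_snd_concat:
  "(`) (place a c) ` snd (concat_diagram n d1 d2) = contract space12 lines12 middle12 blobs12"
proof -
  have "contract space12 lines12 middle12 blobs12 =
    (\<lambda>C. place_point a b c ` C - middle12) `
      {C \<in> strands n d1 d2. \<not> place_point a b c ` C \<subseteq> middle12 \<and> contains_line blobs12 (place_point a b c ` C)}"
    unfolding contract_def components_place by (simp only: Compr_image_eq image_image)
  also have "\<dots> = (\<lambda>C. place a c ` strand_ends C) ` {C \<in> strands n d1 d2. \<not> is_loop C \<and> blob_count d1 d2 C > 0}"
    using is_loop_place[OF abc strand_subset] place_strand_ends[OF abc strand_subset]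
    by (intro image_cong Collect_cong) (auto simp: contains_line_place)
  finally show ?thesis by (simp add: concat_diagram_def image_image)
qed

lemma card_marked_loops_place:
  "card (marked_loops n d1 d2 m) =
   card {C \<in> components space12 lines12. C \<subseteq> middle12 \<and> (contains_line blobs12 C \<longleftrightarrow> m)}"
proof -
  have "{C \<in> components space12 lines12. C \<subseteq> middle12 \<and> (contains_line blobs12 C \<longleftrightarrow> m)} =
    (`) (place_point a b c) ` {C \<in> strands n d1 d2. place_point a b c ` C \<subseteq> middle12 \<and>
      (contains_line blobs12 (place_point a b c ` C) \<longleftrightarrow> m)}"
    unfolding components_place by (simp only: Compr_image_eq)
  also have "\<dots> = (`) (place_point a b c) ` marked_loops n d1 d2 m"
    unfolding marked_loops_def
    using is_loop_place[OF abc strand_subset]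
    by (intro image_cong Collect_cong) (auto simp: contains_line_place)
  finally show ?thesis
    by (simp add: card_image[OF inj_on_subset[OF inj_image_set[OF inj_place_point[OF abc]] subset_UNIV]])
qed

end

text \<open>A line is non-empty and connected, hence contained in exactly one strand, and the sum
  over strands counts each blob once.\<close>

lemma card_blobs_in_strands:
  assumes "F \<subseteq> G" "\<And>l. l \<in> G \<Longrightarrow> l \<noteq> {} \<and> f ` l \<in> glue (fst d1) (fst d2)" "finite F"
  shows "(\<Sum>C \<in> strands n d1 d2. card {l \<in> F. f ` l \<subseteq> C}) = card F"
proof -
  have "(\<Sum>C \<in> strands n d1 d2. card {l \<in> F. f ` l \<subseteq> C}) = card (\<Union>C \<in> strands n d1 d2. {l \<in> F. f ` l \<subseteq> C})"
  proof (rule card_UN_disjoint[symmetric])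
    show "\<forall>C \<in> strands n d1 d2. \<forall>C' \<in> strands n d1 d2. C \<noteq> C' \<longrightarrow> {l \<in> F. f ` l \<subseteq> C} \<inter> {l \<in> F. f ` l \<subseteq> C'} = {}"
    proof (intro ballI impI)
      fix C C' assume C: "C \<in> strands n d1 d2" "C' \<in> strands n d1 d2" "C \<noteq> C'"
      then have "C \<inter> C' = {}" using partition_onD2[OF partition_on_strands] by (auto simp: disjoint_def)
      have False if "l \<in> F" "f ` l \<subseteq> C" "f ` l \<subseteq> C'" for l
      proof -
        have "f ` l \<subseteq> C \<inter> C'" using that by simp
        then have "l = {}" using \<open>C \<inter> C' = {}\<close> by simp
        then show False using assms(1) assms(2)[of l] that(1) by blast
      qed
      then show "{l \<in> F. f ` l \<subseteq> C} \<inter> {l \<in> F. f ` l \<subseteq> C'} = {}" by auto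
    qed
  qed (use assms(3) finite_strands in auto)
  also have "(\<Union>C \<in> strands n d1 d2. {l \<in> F. f ` l \<subseteq> C}) = F"
  proof (intro equalityI subsetI)
    fix l assume l: "l \<in> F"
    then have "l \<noteq> {}" and g: "f ` l \<in> glue (fst d1) (fst d2)" using assms(1) assms(2)[of l] by auto
    then obtain v where v: "v \<in> l" by blast
    have "f v \<in> points n" unfolding glue_cover[symmetric] using v g by blast
    then have "component_of (glue (fst d1) (fst d2)) (f v) \<in> strands n d1 d2"
      unfolding strands_eq by (rule component_of_in_components)
    moreover have "f ` l \<subseteq> component_of (glue (fst d1) (fst d2)) (f v)"
      using v by (intro line_subset_component_of[OF g]) auto
    ultimately show "l \<in> (\<Union>C \<in> strands n d1 d2. {l \<in> F. f ` l \<subseteq> C})" using l by blast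
  qed auto
  finally show ?thesis .
qed

lemma sum_blob_count: "(\<Sum>C \<in> strands n d1 d2. blob_count d1 d2 C) = card (snd d1) + card (snd d2)"
proof -
  have "(\<Sum>C \<in> strands n d1 d2. card {l \<in> snd d1. upper ` l \<subseteq> C}) = card (snd d1)"
    by (rule card_blobs_in_strands[of _ "fst d1"])
      (use partition_diagramD(2,4,5)[OF d1] in \<open>auto simp: glue_def\<close>)
  moreover have "(\<Sum>C \<in> strands n d1 d2. card {l \<in> snd d2. lower ` l \<subseteq> C}) = card (snd d2)"
    by (rule card_blobs_in_strands[of _ "fst d2"])
      (use partition_diagramD(2,4,5)[OF d2] in \<open>auto simp: glue_def\<close>)
  ultimately show ?thesis by (simp add: blob_count_def sum.distrib)
qed

text \<open>The exponent of \<open>\<delta>\<^sub>e\<close>. By truncated subtraction a strand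
  without a blob contributes nothing.\<close>

definition excess :: nat where
  "excess = (\<Sum>C \<in> strands n d1 d2. blob_count d1 d2 C - 1)"

text \<open>Conservation of blobs: each blob present before is removed, or is the one left on a
  line, or the one left on a loop. This expresses the exponent of \<open>\<delta>\<^sub>e\<close> by
  quantities that are easier to compare between bracketings than the removed blobs
  themselves.\<close>

lemma excess_eq:
  "excess + card (snd (concat_diagram n d1 d2)) + card (marked_loops n d1 d2 True) = card (snd d1) + card (snd d2)"
proof -
  let ?S = "strands n d1 d2" and ?b = "blob_count d1 d2"
  let ?N = "{C \<in> ?S. \<not> is_loop C \<and> ?b C > 0}"
  have "(\<Sum>C \<in> ?S. ?b C) = (\<Sum>C \<in> ?S. (?b C - 1) + (if ?b C > 0 then 1 else 0))"
    by (rule sum.cong) auto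
  also have "\<dots> = excess + card {C \<in> ?S. ?b C > 0}"
    using finite_strands by (simp add: sum.distrib excess_def sum.If_cases Int_def)
  also have "{C \<in> ?S. ?b C > 0} = ?N \<union> marked_loops n d1 d2 True"
    by (auto simp: marked_loops_def)
  also have "card \<dots> = card ?N + card (marked_loops n d1 d2 True)"
    using finite_strands by (intro card_Un_disjoint) (auto simp: marked_loops_def)
  also have "card ?N = card (snd (concat_diagram n d1 d2))"
  proof -
    have "inj_on strand_ends ?N"
    proof (rule inj_onI)
      fix C C' assume *: "C \<in> ?N" "C' \<in> ?N" "strand_ends C = strand_ends C'"
      then obtain v where "v \<in> strand_ends C" using strand_ends_nonempty by blast
      then show "C = C'" using strand_ends_inj[of C C' v] * by auto
    qed
    then show ?thesis by (simp add: concat_diagram_def card_image)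
  qed
  finally show ?thesis by (simp add: sum_blob_count)
qed

lemma concat_scalar_eq:
  fixes \<delta> \<gamma> \<delta>\<^sub>e :: "'c::comm_ring_1"
  shows "concat_scalar n \<delta> \<gamma> \<delta>\<^sub>e d1 d2 =
    \<delta>\<^sub>e ^ excess * \<delta> ^ card (marked_loops n d1 d2 False) * \<gamma> ^ card (marked_loops n d1 d2 True)"
proof -
  let ?S = "strands n d1 d2" and ?b = "blob_count d1 d2"
  have "(\<Prod>C \<in> ?S. if is_loop C then if ?b C = 0 then \<delta> else \<gamma> else 1) =
    (\<Prod>C \<in> ?S. (if is_loop C \<and> ?b C = 0 then \<delta> else 1) * (if is_loop C \<and> ?b C > 0 then \<gamma> else 1))"
    by (rule prod.cong) auto
  also have "\<dots> = \<delta> ^ card (marked_loops n d1 d2 False) * \<gamma> ^ card (marked_loops n d1 d2 True)"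
    using finite_strands by (simp add: prod.distrib prod.If_cases Int_def marked_loops_def)
  finally show ?thesis
    by (simp add: concat_scalar_def prod.distrib excess_def power_sum mult.assoc)
qed

end

lemma place_finite_cover:
  assumes "partition_diagram n d"
  shows "\<Union>((`) (place a b) ` fst d) = {a, b} \<times> {1..n}" "{} \<notin> (`) (place a b) ` fst d"
    "(`) (place a b) ` snd d \<subseteq> (`) (place a b) ` fst d"
proof -
  have "\<Union>((`) (place a b) ` fst d) = place a b ` \<Union>(fst d)" by auto
  then show "\<Union>((`) (place a b) ` fst d) = {a, b} \<times> {1..n}"
    by (simp add: partition_diagramD(1)[OF assms] place_vertices)
  show "{} \<notin> (`) (place a b) ` fst d" using partition_diagramD(2)[OF assms] by auto
  show "(`) (place a b) ` snd d \<subseteq> (`) (place a b) ` fst d"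
    using partition_diagramD(5)[OF assms] by auto
qed

section \<open>The two bracketings of a triple product\<close>

context
  fixes n :: nat and d1 d2 d3 :: diagram
  assumes d: "partition_diagram n d1" "partition_diagram n d2" "partition_diagram n d3"
begin

private abbreviation "l1 \<equiv> (`) (place 0 1) ` fst d1"
private abbreviation "l2 \<equiv> (`) (place 1 2) ` fst d2"
private abbreviation "l3 \<equiv> (`) (place 2 3) ` fst d3"
private abbreviation "b1 \<equiv> (`) (place 0 1) ` snd d1"
private abbreviation "b2 \<equiv> (`) (place 1 2) ` snd d2"
private abbreviation "b3 \<equiv> (`) (place 2 3) ` snd d3"
private abbreviation layers :: "nat set \<Rightarrow> (nat \<times> nat) set" where "layers X \<equiv> X \<times> {1..n}"

lemma contraction_left: "contraction (layers {0, 1, 2}) (layers {2, 3}) (layers {1}) (l1 \<union> l2) l3 (b1 \<union> b2) b3"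
  by unfold_locales
    (use place_finite_cover[OF d(1)] place_finite_cover[OF d(2)] place_finite_cover[OF d(3)]
      in \<open>simp_all only: Union_Un_distrib Un_iff Un_mono simp_thms order.refl\<close>, auto)

lemma contraction_right: "contraction (layers {1, 2, 3}) (layers {0, 1}) (layers {2}) (l2 \<union> l3) l1 (b2 \<union> b3) b1"
  by unfold_locales
    (use place_finite_cover[OF d(1)] place_finite_cover[OF d(2)] place_finite_cover[OF d(3)]
      in \<open>simp_all only: Union_Un_distrib Un_iff Un_mono simp_thms order.refl\<close>, auto)

text \<open>The layers occupy the levels 0-1, 1-2 and 2-3. The contraction of levels 1 and 2 in the
  gluing of all three layers does not mention a bracketing and is the common value of both sides of
  associativity.\<close>

lemma concat_left:
  shows "(`) (place 0 3) ` fst (concat_diagram n (concat_diagram n d1 d2) d3) =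
      contract (layers {0, 1, 2, 3}) (l1 \<union> l2 \<union> l3) (layers {1, 2}) (l1 \<union> l2 \<union> l3)"
    and "(`) (place 0 3) ` snd (concat_diagram n (concat_diagram n d1 d2) d3) =
      contract (layers {0, 1, 2, 3}) (l1 \<union> l2 \<union> l3) (layers {1, 2}) (b1 \<union> b2 \<union> b3)"
    and "card {C \<in> components (layers {0, 1, 2, 3}) (l1 \<union> l2 \<union> l3). C \<subseteq> layers {1, 2} \<and>
        (contains_line (b1 \<union> b2 \<union> b3) C \<longleftrightarrow> m)} =
      card (marked_loops n d1 d2 m) + card (marked_loops n (concat_diagram n d1 d2) d3 m)"
proof -
  interpret contraction "layers {0, 1, 2}" "layers {2, 3}" "layers {1}" "l1 \<union> l2" l3 "b1 \<union> b2" b3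
    by (rule contraction_left)
  have V: "layers {0, 1, 2} \<union> layers {2, 3} = layers {0, 1, 2, 3}"
    "layers {0, 1, 2, 3} - layers {1} = layers {0, 2, 3}"
    "layers {1} \<union> layers {2} = layers {1, 2}" "layers {1} \<inter> layers {2} = {}" by auto
  note pd = partition_diagram_concat[OF d(1,2)]
  have p: "(`) (place 0 2) ` fst (concat_diagram n d1 d2) = contract (layers {0, 1, 2}) (l1 \<union> l2) (layers {1}) (l1 \<union> l2)"
    "(`) (place 0 2) ` snd (concat_diagram n d1 d2) = contract (layers {0, 1, 2}) (l1 \<union> l2) (layers {1}) (b1 \<union> b2)"
    by (rule place_fst_concat[OF d(1,2)] place_snd_concat[OF d(1,2)], simp)+
  show "(`) (place 0 3) ` fst (concat_diagram n (concat_diagram n d1 d2) d3) =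
      contract (layers {0, 1, 2, 3}) (l1 \<union> l2 \<union> l3) (layers {1, 2}) (l1 \<union> l2 \<union> l3)"
    using place_fst_concat[OF pd d(3), of 0 2 3] contract_contract[of "FA' \<union> l3" "l1 \<union> l2 \<union> l3" "layers {2}"]
    unfolding p V by simp
  show "(`) (place 0 3) ` snd (concat_diagram n (concat_diagram n d1 d2) d3) =
      contract (layers {0, 1, 2, 3}) (l1 \<union> l2 \<union> l3) (layers {1, 2}) (b1 \<union> b2 \<union> b3)"
    using place_snd_concat[OF pd d(3), of 0 2 3] contract_contract[of "DA' \<union> b3" "b1 \<union> b2 \<union> b3" "layers {2}"]
    unfolding p V by simp
  show "card {C \<in> components (layers {0, 1, 2, 3}) (l1 \<union> l2 \<union> l3). C \<subseteq> layers {1, 2} \<and>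
        (contains_line (b1 \<union> b2 \<union> b3) C \<longleftrightarrow> m)} =
      card (marked_loops n d1 d2 m) + card (marked_loops n (concat_diagram n d1 d2) d3 m)"
    using card_internal[of "layers {2}" m] card_marked_loops_place[OF pd d(3), of 0 2 3 m]
      card_marked_loops_place[OF d(1,2), of 0 1 2 m]
    unfolding p V by simp
qed

text \<open>Level 2 is contracted first here, so the upper layer plays the part of the one glued on
  last.\<close>

lemma concat_right:
  shows "(`) (place 0 3) ` fst (concat_diagram n d1 (concat_diagram n d2 d3)) =
      contract (layers {0, 1, 2, 3}) (l1 \<union> l2 \<union> l3) (layers {1, 2}) (l1 \<union> l2 \<union> l3)"
    and "(`) (place 0 3) ` snd (concat_diagram n d1 (concat_diagram n d2 d3)) =
      contract (layers {0, 1, 2, 3}) (l1 \<union> l2 \<union> l3) (layers {1, 2}) (b1 \<union> b2 \<union> b3)"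
    and "card {C \<in> components (layers {0, 1, 2, 3}) (l1 \<union> l2 \<union> l3). C \<subseteq> layers {1, 2} \<and>
        (contains_line (b1 \<union> b2 \<union> b3) C \<longleftrightarrow> m)} =
      card (marked_loops n d2 d3 m) + card (marked_loops n d1 (concat_diagram n d2 d3) m)"
proof -
  interpret contraction "layers {1, 2, 3}" "layers {0, 1}" "layers {2}" "l2 \<union> l3" l1 "b2 \<union> b3" b1
    by (rule contraction_right)
  have V: "layers {1, 2, 3} \<union> layers {0, 1} = layers {0, 1, 2, 3}"
    "layers {0, 1, 2, 3} - layers {2} = layers {0, 1, 3}"
    "layers {2} \<union> layers {1} = layers {1, 2}" "layers {2} \<inter> layers {1} = {}" by auto
  have U: "l2 \<union> l3 \<union> l1 = l1 \<union> l2 \<union> l3" "b2 \<union> b3 \<union> b1 = b1 \<union> b2 \<union> b3" by auto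
  note pd = partition_diagram_concat[OF d(2,3)]
  have p: "(`) (place 1 3) ` fst (concat_diagram n d2 d3) = contract (layers {1, 2, 3}) (l2 \<union> l3) (layers {2}) (l2 \<union> l3)"
    "(`) (place 1 3) ` snd (concat_diagram n d2 d3) = contract (layers {1, 2, 3}) (l2 \<union> l3) (layers {2}) (b2 \<union> b3)"
    by (rule place_fst_concat[OF d(2,3)] place_snd_concat[OF d(2,3)], simp)+
  show "(`) (place 0 3) ` fst (concat_diagram n d1 (concat_diagram n d2 d3)) =
      contract (layers {0, 1, 2, 3}) (l1 \<union> l2 \<union> l3) (layers {1, 2}) (l1 \<union> l2 \<union> l3)"
    using place_fst_concat[OF d(1) pd, of 0 1 3] contract_contract[of "FA' \<union> l1" "l2 \<union> l3 \<union> l1" "layers {1}"]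
    unfolding p V U Un_commute[of FA' l1] by simp
  show "(`) (place 0 3) ` snd (concat_diagram n d1 (concat_diagram n d2 d3)) =
      contract (layers {0, 1, 2, 3}) (l1 \<union> l2 \<union> l3) (layers {1, 2}) (b1 \<union> b2 \<union> b3)"
    using place_snd_concat[OF d(1) pd, of 0 1 3] contract_contract[of "DA' \<union> b1" "b2 \<union> b3 \<union> b1" "layers {1}"]
    unfolding p V U Un_commute[of FA' l1] Un_commute[of DA' b1] by simp
  show "card {C \<in> components (layers {0, 1, 2, 3}) (l1 \<union> l2 \<union> l3). C \<subseteq> layers {1, 2} \<and>
        (contains_line (b1 \<union> b2 \<union> b3) C \<longleftrightarrow> m)} =
      card (marked_loops n d2 d3 m) + card (marked_loops n d1 (concat_diagram n d2 d3) m)"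
    using card_internal[of "layers {1}" m] card_marked_loops_place[OF d(1) pd, of 0 1 3 m]
      card_marked_loops_place[OF d(2,3), of 1 2 3 m]
    unfolding p V U Un_commute[of FA' l1] Un_commute[of DA' b1] by simp
qed

lemma concat_diagram_assoc:
  "concat_diagram n (concat_diagram n d1 d2) d3 = concat_diagram n d1 (concat_diagram n d2 d3)"
proof (rule prod_eqI)
  have "inj ((`) ((`) (place 0 3)))" by (intro inj_image_set inj_place) simp
  then show "fst (concat_diagram n (concat_diagram n d1 d2) d3) = fst (concat_diagram n d1 (concat_diagram n d2 d3))"
    "snd (concat_diagram n (concat_diagram n d1 d2) d3) = snd (concat_diagram n d1 (concat_diagram n d2 d3))"
    using concat_left(1,2) concat_right(1,2) by (metis injD)+
qed

lemma concat_scalar_assoc: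
  fixes \<delta> \<gamma> \<delta>\<^sub>e :: "'c::comm_ring_1"
  shows "concat_scalar n \<delta> \<gamma> \<delta>\<^sub>e d1 d2 * concat_scalar n \<delta> \<gamma> \<delta>\<^sub>e (concat_diagram n d1 d2) d3 =
    concat_scalar n \<delta> \<gamma> \<delta>\<^sub>e d2 d3 * concat_scalar n \<delta> \<gamma> \<delta>\<^sub>e d1 (concat_diagram n d2 d3)"
proof -
  note p12 = partition_diagram_concat[OF d(1,2)] and p23 = partition_diagram_concat[OF d(2,3)]
  have loops: "card (marked_loops n d1 d2 m) + card (marked_loops n (concat_diagram n d1 d2) d3 m) =
    card (marked_loops n d2 d3 m) + card (marked_loops n d1 (concat_diagram n d2 d3) m)" for m
    using concat_left(3)[of m] concat_right(3)[of m] by simp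
  \<comment> \<open>Adding the two conservation laws of a bracketing cancels the blobs of the
    intermediate diagram. What remains are the initial blobs, the decorated lines of the result and
    the decorated loops, which agree for both bracketings.\<close>
  have "excess n d1 d2 + excess n (concat_diagram n d1 d2) d3 = excess n d2 d3 + excess n d1 (concat_diagram n d2 d3)"
    using excess_eq[OF d(1,2)] excess_eq[OF p12 d(3)] excess_eq[OF d(2,3)] excess_eq[OF d(1) p23]
      loops[of True] concat_diagram_assoc by simp
  then have "\<delta>\<^sub>e ^ (excess n d1 d2 + excess n (concat_diagram n d1 d2) d3) *
      \<delta> ^ (card (marked_loops n d1 d2 False) + card (marked_loops n (concat_diagram n d1 d2) d3 False)) *
      \<gamma> ^ (card (marked_loops n d1 d2 True) + card (marked_loops n (concat_diagram n d1 d2) d3 True)) =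
    \<delta>\<^sub>e ^ (excess n d2 d3 + excess n d1 (concat_diagram n d2 d3)) *
      \<delta> ^ (card (marked_loops n d2 d3 False) + card (marked_loops n d1 (concat_diagram n d2 d3) False)) *
      \<gamma> ^ (card (marked_loops n d2 d3 True) + card (marked_loops n d1 (concat_diagram n d2 d3) True))"
    by (simp only: loops)
  then show ?thesis
    unfolding concat_scalar_eq[OF d(1,2)] concat_scalar_eq[OF p12 d(3)] concat_scalar_eq[OF d(2,3)]
      concat_scalar_eq[OF d(1) p23] by (simp only: power_add mult_ac)
qed

end

section \<open>Left multiplication by generators\<close>

definition identity_lines :: "nat \<Rightarrow> vertex set set" where
  "identity_lines n = (\<lambda>j. {North j, South j}) ` {1..n}"

lemma identity_diagram_eq: "identity_diagram n = (identity_lines n, {})"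
  and e_diagram_eq: "e_diagram n = (identity_lines n, {{North 1, South 1}})"
  by (auto simp: identity_diagram_def e_diagram_def identity_lines_def)

lemma U_diagram_eq: "U_diagram n i =
  (insert {North i, North (Suc i)} (insert {South i, South (Suc i)}
    ((\<lambda>j. {North j, South j}) ` ({1..n} - {i, Suc i}))), {})"
  by (auto simp: U_diagram_def)

lemma partition_on_identity_lines: "partition_on (vertices n) (identity_lines n)"
proof (rule partition_onI)
  show "\<Union>(identity_lines n) = vertices n"
    by (auto simp: identity_lines_def vertices_def)
qed (auto simp: identity_lines_def disjnt_def)

lemma partition_diagram_identity: "partition_diagram n (identity_diagram n)"
  by (simp add: partition_diagram_def identity_diagram_eq partition_on_identity_lines)

lemma partition_diagram_e: "1 \<le> n \<Longrightarrow> partition_diagram n (e_diagram n)"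
  by (auto simp: partition_diagram_def e_diagram_eq partition_on_identity_lines) (auto simp: identity_lines_def)

lemma partition_diagram_U:
  assumes "1 \<le> i" "i < n"
  shows "partition_diagram n (U_diagram n i)"
  unfolding partition_diagram_def
proof (intro conjI partition_onI)
  show "\<Union>(fst (U_diagram n i)) = vertices n"
  proof -
    have "\<Union>(fst (U_diagram n i)) = {North i, North (Suc i)} \<union> {South i, South (Suc i)} \<union>
      (North ` ({1..n} - {i, Suc i}) \<union> South ` ({1..n} - {i, Suc i}))"
      by (auto simp: U_diagram_eq)
    also have "\<dots> = vertices n" using assms by (auto simp: vertices_def)
    finally show ?thesis .
  qed
qed (auto simp: U_diagram_eq disjnt_def)

text \<open>Under a generator most strands are merely lines of the lower diagram prolonged upwards.
  This map collapses the upper layer accordingly, identifying \<open>Top j\<close> with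
  \<open>Mid j\<close>.\<close>

fun base_vertex :: "point \<Rightarrow> vertex" where
  "base_vertex (Top j) = North j"
| "base_vertex (Mid j) = North j"
| "base_vertex (Bot j) = South j"

text \<open>The strand over a line of the lower diagram. \<open>Y\<close> holds the top points that
  the northern arc of a U_i cuts off from the lower diagram, and is empty for the identity and
  e.\<close>

definition lift_line :: "point set \<Rightarrow> vertex set \<Rightarrow> point set" where
  "lift_line Y l = base_vertex -` l - Y"

lemma base_vertex_lower [simp]: "base_vertex (lower v) = v"
  by (cases v) auto

lemma base_vertex_points: "base_vertex p \<in> vertices n \<longleftrightarrow> p \<in> points n"
  by (cases p) (auto simp: vertices_def points_def)

lemma lower_not_Top: "lower v \<noteq> Top j"
  by (cases v) auto

lemma lower_in_lift_line: "Y \<subseteq> range Top \<Longrightarrow> lower v \<in> lift_line Y l \<longleftrightarrow> v \<in> l"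
  using lower_not_Top by (auto simp: lift_line_def)

lemma lower_image_subset_lift_line: "Y \<subseteq> range Top \<Longrightarrow> lower ` k \<subseteq> lift_line Y l \<longleftrightarrow> k \<subseteq> l"
  using lower_in_lift_line by blast

text \<open>One computation for all generators. \<open>L\<close> is the family of lower lines after
  the generator has merged some of them; \<open>{Y} - {{}}\<close> is the strand of the northern
  arc, absent when there is no such arc.\<close>

lemma components_lift_line:
  assumes L: "partition_on (vertices n) L" and Y: "Y \<subseteq> Top ` {1..n}"
    and low: "\<And>l v w. l \<in> L \<Longrightarrow> v \<in> l \<Longrightarrow> w \<in> l \<Longrightarrow> (lower v, lower w) \<in> (linked G)\<^sup>*"
    and top: "\<And>j. j \<in> {1..n} \<Longrightarrow> Top j \<notin> Y \<Longrightarrow> (Top j, Mid j) \<in> linked G"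
    and Yc: "\<And>x y. x \<in> Y \<Longrightarrow> y \<in> Y \<Longrightarrow> (x, y) \<in> (linked G)\<^sup>*"
    and G: "\<And>g. g \<in> G \<Longrightarrow> g \<subseteq> Y \<and> Y \<noteq> {} \<or> (\<exists>l \<in> L. g \<subseteq> lift_line Y l)"
  shows "components (points n) G = ({Y} - {{}}) \<union> lift_line Y ` L"
proof (rule components_eqI)
  have Y': "Y \<subseteq> range Top" using Y by auto
  show "partition_on (points n) (({Y} - {{}}) \<union> lift_line Y ` L)"
  proof (rule partition_onI)
    have "\<Union>(lift_line Y ` L) = base_vertex -` vertices n - Y"
      unfolding partition_onD1[OF L] by (auto simp: lift_line_def)
    also have "base_vertex -` vertices n = points n" by (auto simp: base_vertex_points)
    finally show "\<Union>(({Y} - {{}}) \<union> lift_line Y ` L) = points n"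
      using Y by (auto simp: points_def)
    have "lift_line Y l \<noteq> {}" if "l \<in> L" for l
    proof -
      have "l \<noteq> {}" using partition_onD3[OF L] that by auto
      then obtain v where "v \<in> l" by blast
      then show ?thesis using lower_in_lift_line[OF Y'] by auto
    qed
    then show "{} \<notin> ({Y} - {{}}) \<union> lift_line Y ` L" by auto
    have "disjnt (lift_line Y l) (lift_line Y k)" if "l \<in> L" "k \<in> L" "l \<noteq> k" for l k
    proof -
      have "l \<inter> k = {}" using partition_onD2[OF L] that by (auto simp: disjoint_def)
      then show ?thesis by (auto simp: lift_line_def disjnt_def)
    qed
    moreover have "disjnt Y (lift_line Y l)" for l by (auto simp: lift_line_def disjnt_def)
    ultimately show "disjnt p q" if "p \<in> ({Y} - {{}}) \<union> lift_line Y ` L" "q \<in> ({Y} - {{}}) \<union> lift_line Y ` L" "p \<noteq> q" for p q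
      using that by (auto simp: disjnt_sym)
  qed
  show "\<exists>C \<in> ({Y} - {{}}) \<union> lift_line Y ` L. g \<subseteq> C" if "g \<in> G" for g
    using G[OF that] by auto
  have to_lower: "(p, lower (base_vertex p)) \<in> (linked G)\<^sup>*" if p: "p \<in> lift_line Y l" "l \<in> L" for p l
  proof -
    have "base_vertex p \<in> vertices n" using p partition_onD1[OF L] by (auto simp: lift_line_def)
    then have "p \<in> points n" by (simp add: base_vertex_points)
    then show ?thesis using top p(1) by (cases p) (auto simp: lift_line_def points_def intro: r_into_rtrancl)
  qed
  show "(x, y) \<in> (linked G)\<^sup>*" if C: "C \<in> ({Y} - {{}}) \<union> lift_line Y ` L" "x \<in> C" "y \<in> C" for C x y
  proof (cases "C = Y")
    case True
    then show ?thesis using Yc C by simp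
  next
    case False
    then obtain l where l: "l \<in> L" "C = lift_line Y l" using C(1) by auto
    have "(x, lower (base_vertex x)) \<in> (linked G)\<^sup>*" "(y, lower (base_vertex y)) \<in> (linked G)\<^sup>*"
      using to_lower l C by auto
    moreover have "(lower (base_vertex x), lower (base_vertex y)) \<in> (linked G)\<^sup>*"
      using low[OF l(1)] C(2,3) l(2) by (auto simp: lift_line_def)
    ultimately show ?thesis using linked_rtrancl_sym[of y "lower (base_vertex y)" G]
      by (meson rtrancl_trans)
  qed
qed

lemma filter_insert_image:
  "{C \<in> insert a (f ` insert b A). P C} =
    (if P a then {a} else {}) \<union> f ` {x \<in> A. P (f x)} \<union> (if P (f b) then {f b} else {})"
  by auto

lemma strand_ends_lift_line:
  assumes "Y \<subseteq> range Top"
  shows "strand_ends (lift_line Y l) = l - {North j | j. Top j \<in> Y}"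
proof (rule Set.set_eqI)
  fix v show "v \<in> strand_ends (lift_line Y l) \<longleftrightarrow> v \<in> l - {North j | j. Top j \<in> Y}"
    using assms by (cases v) (auto simp: strand_ends_def lift_line_def)
qed

context
  fixes n :: nat and d :: diagram
  assumes d: "partition_diagram n d"
begin

lemma line_ex: "v \<in> vertices n \<Longrightarrow> \<exists>l \<in> fst d. v \<in> l"
  using partition_diagramD(1)[OF d] by auto

lemma lower_linked:
  assumes "l \<in> fst d" "v \<in> l" "w \<in> l"
  shows "(lower v, lower w) \<in> linked (glue F (fst d))"
  using assms by (intro linkedI[of "lower ` l"]) (auto simp: glue_def)

lemma strands_identity:
  assumes "fst d1 = identity_lines n"
  shows "strands n d1 d = lift_line {} ` fst d"
proof -
  have "components (points n) (glue (identity_lines n) (fst d)) = ({{}} - {{}}) \<union> lift_line {} ` fst d"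
  proof (rule components_lift_line)
    show "partition_on (vertices n) (fst d)" using d by (simp add: partition_diagram_def)
    show "(lower v, lower w) \<in> (linked (glue (identity_lines n) (fst d)))\<^sup>*"
      if "l \<in> fst d" "v \<in> l" "w \<in> l" for l v w
      using lower_linked[OF that] by (rule r_into_rtrancl)
    show "(Top j, Mid j) \<in> linked (glue (identity_lines n) (fst d))" if "j \<in> {1..n}" for j
    proof -
      have "upper ` {North j, South j} \<in> glue (identity_lines n) (fst d)"
        unfolding glue_def identity_lines_def using that by blast
      then show ?thesis by (rule linkedI) simp_all
    qed
    show "g \<subseteq> {} \<and> {} \<noteq> {} \<or> (\<exists>l \<in> fst d. g \<subseteq> lift_line {} l)"
      if g: "g \<in> glue (identity_lines n) (fst d)" for g
    proof -
      consider j where "g = {Top j, Mid j}" "j \<in> {1..n}" | l where "l \<in> fst d" "g = lower ` l"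
        using g by (auto simp: glue_def identity_lines_def)
      then show ?thesis
      proof cases
        case 1
        then obtain l where "l \<in> fst d" "North j \<in> l" using line_ex[of "North j"] by (auto simp: vertices_def)
        then show ?thesis using 1 by (auto simp: lift_line_def)
      next
        case 2
        then show ?thesis by (auto simp: lift_line_def)
      qed
    qed
  qed auto
  then show ?thesis by (simp add: strands_eq assms)
qed

lemma not_loop_lift_line: "l \<in> fst d \<Longrightarrow> \<not> is_loop (lift_line {} l)"
proof -
  assume "l \<in> fst d"
  then obtain v where "v \<in> l" using partition_diagramD(2)[OF d] by (metis ex_in_conv)
  then have "(case v of North j \<Rightarrow> Top j | South j \<Rightarrow> Bot j) \<in> lift_line {} l"
    by (cases v) (auto simp: lift_line_def)
  then show ?thesis by (cases v) (auto simp: is_loop_def)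
qed

lemma inj_on_lift_line: "inj_on (lift_line {}) A"
proof (rule inj_onI)
  fix l k assume "lift_line {} l = lift_line {} k"
  then show "l = k" using lower_in_lift_line[of "{}"] by blast
qed

lemma blob_count_lift_line:
  assumes "Y \<subseteq> range Top"
  shows "blob_count d1 d (lift_line Y l) = card {k \<in> snd d1. upper ` k \<subseteq> lift_line Y l} + card {k \<in> snd d. k \<subseteq> l}"
  by (simp add: blob_count_def lower_image_subset_lift_line[OF assms])

lemma blobs_in_line:
  assumes "l \<in> fst d"
  shows "{k \<in> snd d. k \<subseteq> l} = (if l \<in> snd d then {l} else {})"
proof -
  have "k = l" if "k \<in> snd d" "k \<subseteq> l" for k
  proof -
    have "k \<in> fst d" "k \<noteq> {}" using that partition_diagramD(2,5)[OF d] by auto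
    then obtain v where "v \<in> k" by auto
    then show ?thesis using partition_diagramD(6)[OF d \<open>k \<in> fst d\<close> assms] that by auto
  qed
  then show ?thesis by auto
qed

lemma concat_identity_left: "concat_diagram n (identity_diagram n) d = d"
  and concat_scalar_identity_left: "concat_scalar n \<delta> \<gamma> \<delta>\<^sub>e (identity_diagram n) d = (1::'c::comm_ring_1)"
proof -
  let ?i = "identity_diagram n"
  have s: "strands n ?i d = lift_line {} ` fst d"
    by (rule strands_identity) (simp add: identity_diagram_eq)
  have b: "blob_count ?i d (lift_line {} l) = (if l \<in> snd d then 1 else 0)" if "l \<in> fst d" for l
    using blobs_in_line[OF that] by (simp add: blob_count_lift_line identity_diagram_eq)
  have "{C \<in> strands n ?i d. \<not> is_loop C} = lift_line {} ` fst d"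
    using not_loop_lift_line by (auto simp: s)
  moreover have "{C \<in> strands n ?i d. \<not> is_loop C \<and> blob_count ?i d C > 0} = lift_line {} ` snd d"
    using not_loop_lift_line b partition_diagramD(5)[OF d] by (fastforce simp: s split: if_splits)
  ultimately show "concat_diagram n ?i d = d"
    by (simp add: concat_diagram_def image_image strand_ends_lift_line)
  show "concat_scalar n \<delta> \<gamma> \<delta>\<^sub>e ?i d = 1"
    unfolding concat_scalar_def s using b not_loop_lift_line by (intro prod.neutral) auto
qed

lemma
  assumes n: "1 \<le> n" and l: "l \<in> fst d" "North 1 \<in> l"
  shows concat_e_left: "concat_diagram n (e_diagram n) d = (fst d, insert l (snd d))"
    and concat_scalar_e_left: "concat_scalar n \<delta> \<gamma> \<delta>\<^sub>e (e_diagram n) d = (if l \<in> snd d then \<delta>\<^sub>e else (1::'c::comm_ring_1))"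
proof -
  let ?e = "e_diagram n"
  have s: "strands n ?e d = lift_line {} ` fst d"
    by (rule strands_identity) (simp add: e_diagram_eq)
  have "{k \<in> snd ?e. upper ` k \<subseteq> lift_line {} k'} = (if k' = l then {{North 1, South 1}} else {})" if "k' \<in> fst d" for k'
  proof -
    have "upper ` {North 1, South 1} \<subseteq> lift_line {} k' \<longleftrightarrow> North 1 \<in> k'" by (auto simp: lift_line_def)
    also have "\<dots> \<longleftrightarrow> k' = l" using partition_diagramD(6)[OF d that l(1) _ l(2)] l by auto
    finally show ?thesis by (auto simp: e_diagram_eq)
  qed
  then have b: "blob_count ?e d (lift_line {} k) = (if k = l then 1 else 0) + (if k \<in> snd d then 1 else 0)" if "k \<in> fst d" for k
    using blobs_in_line[OF that] that by (simp add: blob_count_lift_line)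
  have "{C \<in> strands n ?e d. \<not> is_loop C} = lift_line {} ` fst d"
    using not_loop_lift_line by (auto simp: s)
  moreover have "{C \<in> strands n ?e d. \<not> is_loop C \<and> blob_count ?e d C > 0} = lift_line {} ` {k \<in> fst d. k = l \<or> k \<in> snd d}"
    using not_loop_lift_line b by (auto simp: s split: if_splits)
  moreover have "{k \<in> fst d. k = l \<or> k \<in> snd d} = insert l (snd d)"
    using l partition_diagramD(5)[OF d] by auto
  ultimately show "concat_diagram n ?e d = (fst d, insert l (snd d))"
    by (simp add: concat_diagram_def image_image strand_ends_lift_line)
  have "concat_scalar n \<delta> \<gamma> \<delta>\<^sub>e ?e d = (\<Prod>k \<in> fst d. if k = l \<and> l \<in> snd d then \<delta>\<^sub>e else 1)"
    unfolding concat_scalar_def s using b not_loop_lift_line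
    by (subst prod.reindex[OF inj_on_lift_line]) (auto intro!: prod.cong)
  also have "\<dots> = (if l \<in> snd d then \<delta>\<^sub>e else 1)"
    using l partition_diagramD(3)[OF d] by (simp add: prod.delta)
  finally show "concat_scalar n \<delta> \<gamma> \<delta>\<^sub>e ?e d = (if l \<in> snd d then \<delta>\<^sub>e else 1)" .
qed

section \<open>Left multiplication by U_i\<close>

context
  fixes i :: nat and l1 l2 :: "vertex set"
  assumes i: "1 \<le> i" "i < n" and l1: "l1 \<in> fst d" "North i \<in> l1" and l2: "l2 \<in> fst d" "North (Suc i) \<in> l2"
begin

private abbreviation "Y \<equiv> {Top i, Top (Suc i)}"
private abbreviation "X \<equiv> {North i, North (Suc i)}"
text \<open>The southern arc of U_i merges the lines \<open>l1\<close> and \<open>l2\<close> at the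
  northern vertices i and i + 1. For \<open>l1 = l2\<close> this is the family of lines itself, so
  the case in which a loop closes is treated together with the other one.\<close>

private abbreviation "M \<equiv> insert (l1 \<union> l2) (fst d - {l1, l2})"

lemma partition_on_merged: "partition_on (vertices n) M"
proof (rule partition_onI)
  show "\<Union>M = vertices n" using l1 l2 partition_diagramD(1)[OF d] by blast
  show "{} \<notin> M" using l1 l2 partition_diagramD(2)[OF d] by auto
  have "disjnt l k" if "l \<in> fst d" "k \<in> fst d" "l \<noteq> k" for l k
    using partition_diagramD(6)[OF d that(1,2)] that(3) by (auto simp: disjnt_def)
  note dis = this
  have 1: "disjnt (l1 \<union> l2) l" if "l \<in> fst d - {l1, l2}" for l
    using dis[of l1 l] dis[of l2 l] that l1 l2 by (auto simp: disjnt_Un1)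
  show "disjnt p q" if "p \<in> M" "q \<in> M" "p \<noteq> q" for p q
  proof (cases "p = l1 \<union> l2 \<or> q = l1 \<union> l2")
    case True
    then show ?thesis using 1[of p] 1[of q] that disjnt_sym by blast
  next
    case False
    then show ?thesis using dis[of p q] that by blast
  qed
qed

lemma strands_U: "strands n (U_diagram n i) d = insert Y (lift_line Y ` M)"
proof -
  let ?G = "glue (fst (U_diagram n i)) (fst d)"
  have mid: "(Mid i, Mid (Suc i)) \<in> (linked ?G)\<^sup>*"
  proof -
    have "upper ` {South i, South (Suc i)} \<in> ?G"
      unfolding glue_def U_diagram_eq fst_conv by blast
    then show ?thesis by (intro r_into_rtrancl, elim linkedI) simp_all
  qed
  have "components (points n) ?G = ({Y} - {{}}) \<union> lift_line Y ` M"
  proof (rule components_lift_line)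
    show "partition_on (vertices n) M" by (rule partition_on_merged)
    show "Y \<subseteq> Top ` {1..n}" using i by auto
    show "(lower v, lower w) \<in> (linked ?G)\<^sup>*" if "l \<in> M" "v \<in> l" "w \<in> l" for l v w
    proof (cases "l \<in> fst d")
      case True
      then show ?thesis using lower_linked that by blast
    next
      case False
      then have "l = l1 \<union> l2" using that by auto
      have to_mid: "(lower v, Mid i) \<in> (linked ?G)\<^sup>*" if "v \<in> l1 \<union> l2" for v
      proof (cases "v \<in> l1")
        case True
        from lower_linked[OF l1(1) this l1(2), of "fst (U_diagram n i)"] show ?thesis by simp
      next
        case False
        then have "v \<in> l2" using that by simp
        from lower_linked[OF l2(1) this l2(2), of "fst (U_diagram n i)"]
        have "(lower v, Mid (Suc i)) \<in> (linked ?G)\<^sup>*" by simp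
        then show ?thesis using linked_rtrancl_sym[OF mid] by (rule rtrancl_trans)
      qed
      have "v \<in> l1 \<union> l2" "w \<in> l1 \<union> l2" using that \<open>l = l1 \<union> l2\<close> by auto
      then show ?thesis
        by (meson to_mid linked_rtrancl_sym rtrancl_trans)
    qed
    show "(Top j, Mid j) \<in> linked ?G" if "j \<in> {1..n}" "Top j \<notin> Y" for j
    proof -
      have "j \<in> {1..n} - {i, Suc i}" using that by simp
      then have "upper ` {North j, South j} \<in> ?G"
        unfolding glue_def U_diagram_eq fst_conv by blast
      then show ?thesis by (rule linkedI) simp_all
    qed
    show "(x, y) \<in> (linked ?G)\<^sup>*" if "x \<in> Y" "y \<in> Y" for x y
    proof -
      have "upper ` {North i, North (Suc i)} \<in> ?G"
        unfolding glue_def U_diagram_eq fst_conv by blast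
      moreover have "upper ` {North i, North (Suc i)} = Y" by simp
      ultimately show ?thesis using that linkedI[of Y ?G x y] by auto
    qed
    show "g \<subseteq> Y \<and> Y \<noteq> {} \<or> (\<exists>l \<in> M. g \<subseteq> lift_line Y l)" if g: "g \<in> ?G" for g
    proof -
      have "g = Y \<or> g = {Mid i, Mid (Suc i)} \<or> (\<exists>j \<in> {1..n} - {i, Suc i}. g = {Top j, Mid j}) \<or>
        (\<exists>l \<in> fst d. g = lower ` l)"
        using g by (simp add: glue_def U_diagram_eq image_iff)
      then consider "g = Y" | "g = {Mid i, Mid (Suc i)}"
        | j where "g = {Top j, Mid j}" "j \<in> {1..n} - {i, Suc i}" | l where "l \<in> fst d" "g = lower ` l"
        by blast
      then show ?thesis
      proof cases
        case 2
        then have "g \<subseteq> lift_line Y (l1 \<union> l2)" using l1 l2 by (auto simp: lift_line_def)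
        then show ?thesis by blast
      next
        case (3 j)
        then have "North j \<in> \<Union>M" using partition_onD1[OF partition_on_merged] by (auto simp: vertices_def)
        then obtain l where "l \<in> M" "North j \<in> l" by blast
        moreover from this have "g \<subseteq> lift_line Y l" using 3 by (auto simp: lift_line_def)
        ultimately show ?thesis by blast
      next
        case (4 l)
        have "\<exists>l' \<in> M. l \<subseteq> l'" using 4(1) by (cases "l = l1 \<or> l = l2") auto
        then obtain l' where "l' \<in> M" "l \<subseteq> l'" by blast
        moreover have "g \<subseteq> lift_line Y l'"
          using 4(2) \<open>l \<subseteq> l'\<close> lower_image_subset_lift_line[of Y l l'] by auto
        ultimately show ?thesis by blast
      qed simp
    qed
  qed
  then show ?thesis by (simp add: strands_eq insert_commute)
qed

lemma blob_count_U:
  shows "blob_count (U_diagram n i) d Y = 0"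
    and "l \<in> fst d - {l1, l2} \<Longrightarrow> blob_count (U_diagram n i) d (lift_line Y l) = (if l \<in> snd d then 1 else 0)"
    and "blob_count (U_diagram n i) d (lift_line Y (l1 \<union> l2)) = card ({l1, l2} \<inter> snd d)"
proof -
  have u: "snd (U_diagram n i) = {}" by (simp add: U_diagram_eq)
  have "\<not> lower ` k \<subseteq> Y" if "k \<in> snd d" for k
  proof -
    have "k \<noteq> {}" using that partition_diagramD(2,5)[OF d] by auto
    then obtain v where "v \<in> k" by blast
    then show ?thesis using lower_not_Top[of v] by blast
  qed
  then have "{l \<in> snd d. lower ` l \<subseteq> Y} = {}" by blast
  then show "blob_count (U_diagram n i) d Y = 0" by (simp only: blob_count_def u) simp
  show "blob_count (U_diagram n i) d (lift_line Y l) = (if l \<in> snd d then 1 else 0)" if "l \<in> fst d - {l1, l2}"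
    using blobs_in_line[of l] that by (simp add: blob_count_lift_line u)
  have "{k \<in> snd d. k \<subseteq> l1 \<union> l2} = {l1, l2} \<inter> snd d"
  proof (intro equalityI subsetI)
    fix k assume k: "k \<in> {k \<in> snd d. k \<subseteq> l1 \<union> l2}"
    then have "k \<in> fst d" using partition_diagramD(5)[OF d] by auto
    then obtain v where v: "v \<in> k" using partition_diagramD(2)[OF d] by (metis ex_in_conv)
    then have "v \<in> l1 \<or> v \<in> l2" using k by auto
    then show "k \<in> {l1, l2} \<inter> snd d"
      using partition_diagramD(6)[OF d \<open>k \<in> fst d\<close> l1(1) v] partition_diagramD(6)[OF d \<open>k \<in> fst d\<close> l2(1) v] k by auto
  qed auto
  then show "blob_count (U_diagram n i) d (lift_line Y (l1 \<union> l2)) = card ({l1, l2} \<inter> snd d)"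
    by (simp add: blob_count_lift_line u)
qed

text \<open>A strand is a loop iff its line has no ends other than the two northern ones that have
  become interior points.\<close>

lemma not_loop_U:
  assumes "l \<in> M"
  shows "is_loop (lift_line Y l) \<longleftrightarrow> l = X"
proof
  assume "l = X"
  then show "is_loop (lift_line Y l)"
  proof -
    have "p \<in> range Mid" if "p \<in> lift_line Y X" for p
      using that by (cases p) (auto simp: lift_line_def)
    then show ?thesis using \<open>l = X\<close> by (auto simp: is_loop_def)
  qed
next
  assume *: "is_loop (lift_line Y l)"
  have "v \<in> X" if "v \<in> l" for v
  proof (cases v)
    case (North j)
    have "Top j \<notin> lift_line Y l" using * by (auto simp: is_loop_def)
    then have "Top j \<in> Y" using that North by (auto simp: lift_line_def)
    then show ?thesis using North by auto
  next
    case (South j)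
    then have "Bot j \<in> lift_line Y l" using that by (auto simp: lift_line_def)
    then show ?thesis using * by (auto simp: is_loop_def)
  qed
  then have lX: "l \<subseteq> X" by auto
  have "l \<noteq> {}" using assms partition_onD3[OF partition_on_merged] by auto
  then have "l \<notin> fst d - {l1, l2}"
    using lX partition_diagramD(6)[OF d _ l1(1) _ l1(2), of l] partition_diagramD(6)[OF d _ l2(1) _ l2(2), of l] by auto
  then have "l = l1 \<union> l2" using assms by auto
  then show "l = X" using lX l1 l2 by auto
qed

lemma strand_ends_U:
  shows "strand_ends Y = X" "\<not> is_loop Y" and "l \<in> fst d - {l1, l2} \<Longrightarrow> strand_ends (lift_line Y l) = l"
    and "strand_ends (lift_line Y (l1 \<union> l2)) = l1 \<union> l2 - X"
    and "l \<in> fst d - {l1, l2} \<Longrightarrow> l \<noteq> X"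
proof -
  show "strand_ends Y = X" "\<not> is_loop Y" by (auto simp: strand_ends_def is_loop_def)
  have e: "strand_ends (lift_line Y l) = l - X" for l
    by (auto simp: strand_ends_lift_line)
  then show "strand_ends (lift_line Y (l1 \<union> l2)) = l1 \<union> l2 - X" .
  have "l \<inter> X = {}" if "l \<in> fst d - {l1, l2}" for l
    using that partition_diagramD(6)[OF d _ l1(1) _ l1(2), of l] partition_diagramD(6)[OF d _ l2(1) _ l2(2), of l] by auto
  then show "strand_ends (lift_line Y l) = l" "l \<noteq> X" if "l \<in> fst d - {l1, l2}"
    using that e[of l] by auto
qed

text \<open>When the merged strand is a loop, \<open>l1 \<union> l2 - X\<close> is empty;
  subtracting \<open>{{}}\<close> makes it disappear from the lines and from the decorated
  lines.\<close>

lemma concat_U_left: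
  "concat_diagram n (U_diagram n i) d =
     (insert X (fst d - {l1, l2}) \<union> ({l1 \<union> l2 - X} - {{}}),
      (snd d - {l1, l2}) \<union> (if l1 \<in> snd d \<or> l2 \<in> snd d then {l1 \<union> l2 - X} - {{}} else {}))"
proof -
  have loop: "is_loop (lift_line Y (l1 \<union> l2)) \<longleftrightarrow> l1 \<union> l2 - X = {}"
    using not_loop_U[of "l1 \<union> l2"] l1 l2 by auto
  have other: "\<not> is_loop (lift_line Y l)" if "l \<in> fst d - {l1, l2}" for l
    using not_loop_U[of l] strand_ends_U(5)[OF that] that by auto
  have card: "card ({l1, l2} \<inter> snd d) > 0 \<longleftrightarrow> l1 \<in> snd d \<or> l2 \<in> snd d"
    by (auto simp: card_gt_0_iff)
  have "{C \<in> strands n (U_diagram n i) d. \<not> is_loop C} =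
    insert Y (lift_line Y ` (fst d - {l1, l2})) \<union> (if l1 \<union> l2 - X = {} then {} else {lift_line Y (l1 \<union> l2)})"
  proof -
    have "{l \<in> fst d - {l1, l2}. \<not> is_loop (lift_line Y l)} = fst d - {l1, l2}" using other by auto
    then show ?thesis unfolding strands_U filter_insert_image loop using strand_ends_U(2) by simp
  qed
  moreover have "strand_ends ` \<dots> = insert X (fst d - {l1, l2}) \<union> ({l1 \<union> l2 - X} - {{}})"
    using strand_ends_U by (auto simp: image_image)
  ultimately have 1: "strand_ends ` {C \<in> strands n (U_diagram n i) d. \<not> is_loop C} =
    insert X (fst d - {l1, l2}) \<union> ({l1 \<union> l2 - X} - {{}})" by simp
  have "{C \<in> strands n (U_diagram n i) d. \<not> is_loop C \<and> blob_count (U_diagram n i) d C > 0} =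
    lift_line Y ` {l \<in> fst d - {l1, l2}. l \<in> snd d} \<union>
    (if l1 \<union> l2 - X \<noteq> {} \<and> (l1 \<in> snd d \<or> l2 \<in> snd d) then {lift_line Y (l1 \<union> l2)} else {})"
  proof -
    have "{l \<in> fst d - {l1, l2}. \<not> is_loop (lift_line Y l) \<and> blob_count (U_diagram n i) d (lift_line Y l) > 0} =
      {l \<in> fst d - {l1, l2}. l \<in> snd d}"
    proof (intro Collect_cong conj_cong refl)
      fix l assume l: "l \<in> fst d - {l1, l2}"
      show "(\<not> is_loop (lift_line Y l) \<and> blob_count (U_diagram n i) d (lift_line Y l) > 0) = (l \<in> snd d)"
        using other[OF l] blob_count_U(2)[OF l] by simp
    qed
    then show ?thesis unfolding strands_U filter_insert_image loop blob_count_U(1,3) card by simp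
  qed
  moreover have "strand_ends ` \<dots> = {l \<in> fst d - {l1, l2}. l \<in> snd d} \<union>
    (if l1 \<in> snd d \<or> l2 \<in> snd d then {l1 \<union> l2 - X} - {{}} else {})"
    using strand_ends_U(3,4) by (auto simp: image_image)
  moreover have "{l \<in> fst d - {l1, l2}. l \<in> snd d} = snd d - {l1, l2}"
    using partition_diagramD(5)[OF d] by auto
  ultimately show ?thesis using 1 by (simp add: concat_diagram_def)
qed

text \<open>Only the merged strand can collect two blobs or close into a loop; all other factors are
  1.\<close>

lemma concat_scalar_U_left:
  fixes \<delta> \<gamma> \<delta>\<^sub>e :: "'c::comm_ring_1"
  shows "concat_scalar n \<delta> \<gamma> \<delta>\<^sub>e (U_diagram n i) d =
    \<delta>\<^sub>e ^ (card ({l1, l2} \<inter> snd d) - 1) *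
    (if l1 \<union> l2 = X then if l1 \<in> snd d \<or> l2 \<in> snd d then \<gamma> else \<delta> else 1)"
proof -
  let ?f = "\<lambda>C. \<delta>\<^sub>e ^ (blob_count (U_diagram n i) d C - 1) *
        (if is_loop C then if blob_count (U_diagram n i) d C = 0 then \<delta> else \<gamma> else 1)"
  let ?C = "lift_line Y (l1 \<union> l2)" and ?S = "strands n (U_diagram n i) d"
  have other: "\<not> is_loop (lift_line Y l)" if "l \<in> fst d - {l1, l2}" for l
    using not_loop_U[of l] strand_ends_U(5)[OF that] that by auto
  have card: "card ({l1, l2} \<inter> snd d) = 0 \<longleftrightarrow> \<not> (l1 \<in> snd d \<or> l2 \<in> snd d)"
    by auto
  have fin: "finite ?S" unfolding strands_U using partition_diagramD(3)[OF d] by simp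
  have "prod ?f ?S = ?f ?C * prod ?f (?S - {?C})"
    by (rule prod.remove[OF fin]) (simp add: strands_U)
  also have "prod ?f (?S - {?C}) = 1"
  proof (rule prod.neutral, rule ballI)
    fix C assume "C \<in> ?S - {?C}"
    then consider "C = Y" | l where "C = lift_line Y l" "l \<in> fst d - {l1, l2}"
      unfolding strands_U by auto
    then show "?f C = 1"
    proof cases
      case 1
      then show ?thesis using strand_ends_U(2) blob_count_U(1) by simp
    next
      case 2
      then show ?thesis using other blob_count_U(2) by simp
    qed
  qed
  also have "?f ?C = \<delta>\<^sub>e ^ (card ({l1, l2} \<inter> snd d) - 1) *
    (if l1 \<union> l2 = X then if l1 \<in> snd d \<or> l2 \<in> snd d then \<gamma> else \<delta> else 1)"
  proof -
    have "is_loop ?C \<longleftrightarrow> l1 \<union> l2 = X" by (rule not_loop_U) simp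
    then show ?thesis unfolding blob_count_U(3) card by simp
  qed
  finally show ?thesis by (simp add: concat_scalar_def)
qed

end

end

section \<open>Planarity\<close>

text \<open>Unordered in \<open>a\<close> and \<open>b\<close>, as the ends of a line are. Since
  positions start and end at the western edge, lying between the ends of a line means being cut off
  from that edge by it.\<close>

definition between :: "nat \<Rightarrow> vertex \<Rightarrow> vertex \<Rightarrow> vertex \<Rightarrow> bool" where
  "between n a b c \<longleftrightarrow> position n a < position n c \<and> position n c < position n b \<or>
     position n b < position n c \<and> position n c < position n a"

lemma position_inj: "a \<in> vertices n \<Longrightarrow> b \<in> vertices n \<Longrightarrow> position n a = position n b \<Longrightarrow> a = b"
  by (auto simp: vertices_def)

lemma between_commute: "between n a b c \<longleftrightarrow> between n b a c"
  by (auto simp: between_def)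

lemma not_between_end [simp]: "\<not> between n a b a" "\<not> between n a b b"
  by (auto simp: between_def)

text \<open>A parity count: regard the three pairs as arcs over a boundary interval; the arc from
  \<open>a\<close> to \<open>d\<close> covers \<open>c\<close> iff the path through \<open>b\<close>
  covers it an odd number of times.\<close>

lemma between_xor:
  assumes "position n c \<noteq> position n a" "position n c \<noteq> position n b" "position n c \<noteq> position n d"
  shows "between n a d c \<longleftrightarrow> (between n a b c \<noteq> between n b d c)"
  using assms unfolding between_def by linarith

text \<open>The assumption says that the chord from \<open>c\<close> to \<open>d\<close> does not
  cross the chord from \<open>a\<close> to \<open>b\<close>, and crossing is a symmetric
  relation.\<close>

lemma between_swap:
  assumes "position n c \<noteq> position n a" "position n c \<noteq> position n b"
    "position n d \<noteq> position n a" "position n d \<noteq> position n b"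
    and "between n a b c \<longleftrightarrow> between n a b d"
  shows "between n c d a \<longleftrightarrow> between n c d b"
  using assms unfolding between_def by linarith

definition is_matching :: "'a set \<Rightarrow> 'a set set \<Rightarrow> bool" where
  "is_matching V L \<longleftrightarrow> partition_on V L \<and> (\<forall>l \<in> L. card l = 2)"

lemma is_matching_line:
  assumes "is_matching V L" "l \<in> L"
  obtains a b where "l = {a, b}" "a \<noteq> b" "a \<in> V" "b \<in> V"
proof -
  have "card l = 2" "l \<subseteq> V" using assms partition_onD1[of V L] by (auto simp: is_matching_def)
  then show thesis using that by (auto simp: card_2_iff)
qed

lemma is_matching_vertices:
  assumes "is_matching V L" "{a, b} \<in> L"
  shows "a \<in> V" "b \<in> V" "a \<noteq> b"
proof -
  have "card {a, b} = 2" "{a, b} \<subseteq> V" using assms partition_onD1[of V L] by (auto simp: is_matching_def)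
  then show "a \<in> V" "b \<in> V" "a \<noteq> b" by auto
qed

lemma is_matching_eq:
  assumes "is_matching V L" "l \<in> L" "k \<in> L" "a \<in> l" "a \<in> k"
  shows "l = k"
  using assms partition_onD2[of V L] by (auto simp: is_matching_def disjoint_def)

lemma is_matching_unique:
  assumes "is_matching V L" "{a, b} \<in> L" "{a, c} \<in> L"
  shows "b = c"
proof -
  have "{a, b} = {a, c}" using is_matching_eq[OF assms, of a] by simp
  then show ?thesis by (auto simp: doubleton_eq_iff)
qed

lemma is_matching_partner:
  assumes "is_matching V L" "a \<in> V"
  obtains b where "{a, b} \<in> L"
proof -
  have "a \<in> \<Union>L" using assms partition_onD1[of V L] by (simp add: is_matching_def)
  then obtain l where l: "l \<in> L" "a \<in> l" by auto
  from is_matching_line[OF assms(1) l(1)] obtain c d where "l = {c, d}" by blast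
  with l have "l = {a, c} \<or> l = {a, d}" by auto
  then show thesis using that l by blast
qed

lemma is_matching_surgery:
  assumes m: "is_matching V L" and l: "{v, x} \<in> L" "{w, y} \<in> L" "{v, x} \<noteq> {w, y}"
  shows "is_matching V (insert {v, w} (insert {x, y} (L - {{v, x}, {w, y}})))" (is "is_matching V ?L")
    and "distinct [v, x, w, y]"
proof -
  have dis: "{v, x} \<inter> {w, y} = {}"
    using is_matching_eq[OF m l(1,2)] l(3) by blast
  then show d: "distinct [v, x, w, y]"
    using is_matching_vertices(3)[OF m l(1)] is_matching_vertices(3)[OF m l(2)] by auto
  have old: "l \<inter> {v, x, w, y} = {}" if "l \<in> L - {{v, x}, {w, y}}" for l
    using is_matching_eq[OF m l(1), of l] is_matching_eq[OF m l(2), of l] that by blast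
  have "partition_on V ?L"
  proof (rule partition_onI)
    have "\<Union>L = \<Union>(L - {{v, x}, {w, y}}) \<union> {v, x} \<union> {w, y}" using l by blast
    also have "\<dots> = \<Union>?L" by auto
    finally show "\<Union>?L = V" using partition_onD1 m unfolding is_matching_def by metis
    show "{} \<notin> ?L" using partition_onD3 m unfolding is_matching_def by auto
    show "disjnt p q" if pq: "p \<in> ?L" "q \<in> ?L" "p \<noteq> q" for p q
    proof -
      have *: "disjnt p q" if "p \<in> L - {{v, x}, {w, y}}" "q \<in> L - {{v, x}, {w, y}}"
        using is_matching_eq[OF m, of p q] that pq(3) by (auto simp: disjnt_def)
      have "disjnt {v, w} {x, y}" "disjnt {x, y} {v, w}" using d by (auto simp: disjnt_def)
      moreover have "disjnt {v, w} l \<and> disjnt {x, y} l \<and> disjnt l {v, w} \<and> disjnt l {x, y}"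
        if "l \<in> L - {{v, x}, {w, y}}" for l using old[OF that] by (auto simp: disjnt_def)
      ultimately show ?thesis using * pq by (elim insertE) auto
    qed
  qed
  moreover have "card {v, w} = 2" "card {x, y} = 2" using d by auto
  ultimately show "is_matching V ?L" using m by (auto simp: is_matching_def)
qed

text \<open>Without crossings, a line with one end between \<open>a\<close> and \<open>b\<close> has
  both ends there, so testing a single end decides crossing as well as shielding. The resulting
  conditions treat the ends of a line symmetrically and are stable under reconnecting lines.\<close>

lemma blob_diagrams_iff:
  "d \<in> blob_diagrams n \<longleftrightarrow> is_matching (vertices n) (fst d) \<and> snd d \<subseteq> fst d \<and>
    (\<forall>a b c e. {a, b} \<in> fst d \<longrightarrow> {c, e} \<in> fst d \<longrightarrow> between n a b c \<longrightarrow> between n a b e) \<and>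
    (\<forall>a b c e. {a, b} \<in> fst d \<longrightarrow> {c, e} \<in> snd d \<longrightarrow> \<not> between n a b c)"
    (is "_ \<longleftrightarrow> ?M \<and> ?D \<and> ?N \<and> ?X")
proof (cases d)
  case (Pair L D)
  have d: "d \<in> blob_diagrams n \<longleftrightarrow> is_matching (vertices n) L \<and>
     (\<forall>l \<in> L. \<forall>m \<in> L. \<not> crosses n l m) \<and> D \<subseteq> west_exposed n L"
    by (auto simp: Pair blob_diagrams_def TL_diagrams_def is_matching_def)
  show ?thesis
  proof
    assume "d \<in> blob_diagrams n"
    then have m: "is_matching (vertices n) L" and nc: "\<And>l m. l \<in> L \<Longrightarrow> m \<in> L \<Longrightarrow> \<not> crosses n l m"
      and D: "D \<subseteq> west_exposed n L" using d by auto
    have N: "between n a b e" if l: "{a, b} \<in> L" "{c, e} \<in> L" "between n a b c" for a b c e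
    proof (rule ccontr)
      assume nb: "\<not> between n a b e"
      have nx: "\<not> (position n p < position n r \<and> position n r < position n q \<and> position n q < position n s)"
        if "{p, q} \<in> L" "{r, s} \<in> L" for p q r s
        using nc[OF that] by (auto simp: crosses_def)
      have l': "{b, a} \<in> L" "{e, c} \<in> L" using l by (auto simp: insert_commute)
      have "e \<noteq> a" using is_matching_unique[OF m, of e c b] l l' by auto
      moreover have "e \<noteq> b" using is_matching_unique[OF m, of e c a] l l' by auto
      ultimately have "position n e \<noteq> position n a" "position n e \<noteq> position n b"
        using position_inj is_matching_vertices[OF m l(1)] is_matching_vertices[OF m l(2)] by metis+
      \<comment> \<open>A line with exactly one end between \<open>a\<close> and \<open>b\<close>
        crosses in one of four ways, according to the order of the ends of either line.\<close>
      then show False using nb l(3) nx[OF l(1,2)] nx[OF l'(1) l(2)] nx[OF l'(2) l(1)] nx[OF l'(2,1)]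
        unfolding between_def by linarith
    qed
    have X: "\<not> between n a b c" if l: "{a, b} \<in> L" "{c, e} \<in> D" for a b c e
    proof
      assume b: "between n a b c"
      have "{c, e} \<in> L" "\<not> shields n {a, b} {c, e}" using D l by (auto simp: west_exposed_def)
      moreover have "shields n {a, b} {c, e}"
      proof (cases "position n a < position n b")
        case True
        then show ?thesis unfolding shields_def using b N[OF l(1) \<open>{c, e} \<in> L\<close> b]
          by (intro exI[of _ a] exI[of _ b]) (auto simp: between_def)
      next
        case False
        then show ?thesis unfolding shields_def using b N[OF l(1) \<open>{c, e} \<in> L\<close> b]
          by (intro exI[of _ b] exI[of _ a]) (auto simp: between_def)
      qed
      ultimately show False by simp
    qed
    show "?M \<and> ?D \<and> ?N \<and> ?X" using m D N X by (auto simp: Pair west_exposed_def)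
  next
    assume a: "?M \<and> ?D \<and> ?N \<and> ?X"
    then have m: "is_matching (vertices n) L" and D: "D \<subseteq> L"
      and N: "\<And>a b c e. {a, b} \<in> L \<Longrightarrow> {c, e} \<in> L \<Longrightarrow> between n a b c \<Longrightarrow> between n a b e"
      and X: "\<And>a b c e. {a, b} \<in> L \<Longrightarrow> {c, e} \<in> D \<Longrightarrow> \<not> between n a b c"
      by (simp_all add: Pair) blast+
    have "\<not> crosses n l k" if "l \<in> L" "k \<in> L" for l k
    proof
      assume "crosses n l k"
      then obtain a b c e where *: "l = {a, b}" "k = {c, e}" "position n a < position n c"
        "position n c < position n b" "position n b < position n e" by (auto simp: crosses_def)
      then have "between n a b e" using N[of a b c e] that by (auto simp: between_def)
      then show False using * by (auto simp: between_def)
    qed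
    moreover have "D \<subseteq> west_exposed n L"
    proof
      fix k assume k: "k \<in> D"
      then obtain c e where ce: "k = {c, e}" using is_matching_line[OF m] D by blast
      have "\<not> shields n l k" if l: "l \<in> L" for l
      proof
        assume "shields n l k"
        then obtain a b where ab: "l = {a, b}" "position n a < position n c" "position n c < position n b"
          by (auto simp: shields_def ce)
        then have "between n a b c" by (simp add: between_def)
        then show False using X[of a b c e] l k ab(1) ce by simp
      qed
      then show "k \<in> west_exposed n L" using k D by (auto simp: west_exposed_def)
    qed
    ultimately show "d \<in> blob_diagrams n" using m d by blast
  qed
qed

lemma blob_diagramsD:
  assumes "d \<in> blob_diagrams n"
  shows "is_matching (vertices n) (fst d)" "snd d \<subseteq> fst d"
    "{a, b} \<in> fst d \<Longrightarrow> {c, e} \<in> fst d \<Longrightarrow> between n a b c \<Longrightarrow> between n a b e"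
    "{a, b} \<in> fst d \<Longrightarrow> {c, e} \<in> snd d \<Longrightarrow> \<not> between n a b c"
  using assms unfolding blob_diagrams_iff by (elim conjE, metis)+

lemma partition_diagram_blob: "d \<in> blob_diagrams n \<Longrightarrow> partition_diagram n d"
  by (simp add: blob_diagrams_iff is_matching_def partition_diagram_def)

text \<open>The effect of \<open>U\<^sub>i\<close> when the northern vertices \<open>i\<close> and \<open>i + 1\<close> belong to different lines.\<close>

definition surgery :: "vertex \<Rightarrow> vertex \<Rightarrow> vertex \<Rightarrow> vertex \<Rightarrow> diagram \<Rightarrow> diagram" where
  "surgery v x w y d =
    (insert {v, w} (insert {x, y} (fst d - {{v, x}, {w, y}})),
     (snd d - {{v, x}, {w, y}}) \<union> (if {v, x} \<in> snd d \<or> {w, y} \<in> snd d then {{x, y}} else {}))"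

text \<open>The hypotheses on \<open>between n v w\<close> say that \<open>{v, w}\<close> can be drawn as a further line.\<close>

lemma surgery_blob_diagram:
  assumes d: "d \<in> blob_diagrams n" and l: "{v, x} \<in> fst d" "{w, y} \<in> fst d" "{v, x} \<noteq> {w, y}"
    and gap: "\<And>a b. {a, b} \<in> fst d \<Longrightarrow> between n v w a \<Longrightarrow> between n v w b"
      "\<And>a b. {a, b} \<in> snd d \<Longrightarrow> \<not> between n v w a"
  shows "surgery v x w y d \<in> blob_diagrams n"
proof -
  note m = blob_diagramsD(1)[OF d] and N = blob_diagramsD(3)[OF d] and X = blob_diagramsD(4)[OF d]
  define Q where "Q = fst d - {{v, x}, {w, y}}"
  have dis: "distinct [v, x, w, y]" using is_matching_surgery(2)[OF m l] .
  have mem: "v \<in> vertices n" "x \<in> vertices n" "w \<in> vertices n" "y \<in> vertices n"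
    using is_matching_vertices[OF m] l by auto
  have pos: "position n v \<noteq> position n x" "position n v \<noteq> position n w" "position n v \<noteq> position n y"
    "position n x \<noteq> position n w" "position n x \<noteq> position n y" "position n w \<noteq> position n y"
    using position_inj mem dis by (auto dest: position_inj)
  have l': "{x, v} \<in> fst d" "{y, w} \<in> fst d" using l by (simp_all add: insert_commute)
  \<comment> \<open>Neither \<open>v\<close> nor \<open>w\<close> is between \<open>v\<close> and
    \<open>w\<close>, so by the gap condition their partners are not either.\<close>
  have out: "\<not> between n v w x" "\<not> between n v w y"
    using gap(1)[OF l'(1)] gap(1)[OF l'(2)] by auto
  have Q: "{a, b} \<in> fst d" "{b, a} \<in> fst d" "{b, a} \<in> Q"
    "position n a \<noteq> position n v" "position n a \<noteq> position n x" "position n a \<noteq> position n w" "position n a \<noteq> position n y"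
    if "{a, b} \<in> Q" for a b
  proof -
    show ab: "{a, b} \<in> fst d" "{b, a} \<in> fst d" "{b, a} \<in> Q" using that by (auto simp: Q_def insert_commute)
    have "a \<notin> {v, x, w, y}"
      using is_matching_eq[OF m ab(1) l(1), of a] is_matching_eq[OF m ab(1) l(2), of a] that by (auto simp: Q_def)
    then show "position n a \<noteq> position n v" "position n a \<noteq> position n x" "position n a \<noteq> position n w" "position n a \<noteq> position n y"
      using position_inj[OF is_matching_vertices(1)[OF m ab(1)]] mem by auto
  qed
  have N_iff: "between n p q a \<longleftrightarrow> between n p q b" if "{p, q} \<in> fst d" "{a, b} \<in> fst d" for p q a b
    using N[OF that(1), of a b] N[OF that(1), of b a] that by (auto simp: insert_commute)
  have gap_iff: "between n v w a \<longleftrightarrow> between n v w b" if "{a, b} \<in> fst d" for a b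
    using gap(1)[of a b] gap(1)[of b a] that by (auto simp: insert_commute)
  \<comment> \<open>The new line from \<open>x\<close> to \<open>y\<close> is compared with the path
    x, v, w, y: two old lines and the gap. Parity reduces statements about it to known ones.\<close>
  have xor: "between n x y a \<longleftrightarrow> ((between n v x a \<noteq> between n v w a) \<noteq> between n w y a)" if "{a, b} \<in> Q" for a b
    using between_xor[of n a x w y] between_xor[of n a x v w] Q(4-7)[OF that] between_commute[of n x v a] by auto
  \<comment> \<open>The gap condition says that an old line does not cross the chord from
    \<open>v\<close> to \<open>w\<close>; read symmetrically, the old line does not separate
    \<open>v\<close> from \<open>w\<close>.\<close>
  have old_vw: "between n a b v \<longleftrightarrow> between n a b w" if "{a, b} \<in> Q" for a b
    by (rule between_swap) (use Q(4,6)[OF that] Q(4,6)[OF Q(3)[OF that]] gap_iff[OF Q(1)[OF that]] in auto)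
  have old_xy: "between n a b x \<longleftrightarrow> between n a b v" "between n a b y \<longleftrightarrow> between n a b v" if "{a, b} \<in> Q" for a b
    using N_iff[OF Q(1)[OF that] l(1)] N_iff[OF Q(1)[OF that] l(2)] old_vw[OF that] by auto
  have vwxy: "between n x y v \<longleftrightarrow> between n x y w"
    using out pos unfolding between_def by linarith
  have fst: "fst (surgery v x w y d) = insert {v, w} (insert {x, y} Q)"
    by (simp add: surgery_def Q_def)
  have cases: "{a, b} = {v, w} \<or> {a, b} = {x, y} \<or> {a, b} \<in> Q" if "{a, b} \<in> fst (surgery v x w y d)" for a b
    using that unfolding fst by blast
  have "between n a b e"
    if ab: "{a, b} \<in> fst (surgery v x w y d)" and ce: "{c, e} \<in> fst (surgery v x w y d)" and b: "between n a b c" for a b c e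
  proof -
    have 1: "(a = v \<and> b = w \<or> a = w \<and> b = v) \<or> (a = x \<and> b = y \<or> a = y \<and> b = x) \<or> {a, b} \<in> Q"
      using cases[OF ab] by (auto simp: doubleton_eq_iff)
    have 2: "(c = v \<and> e = w \<or> c = w \<and> e = v) \<or> (c = x \<and> e = y \<or> c = y \<and> e = x) \<or> {c, e} \<in> Q"
      using cases[OF ce] by (auto simp: doubleton_eq_iff)
    have vw: "between n v w c \<longrightarrow> between n v w e"
      using 2 out gap_iff Q(1) by (elim disjE conjE) auto
    have xy: "between n x y c \<longrightarrow> between n x y e"
      using 2 vwxy xor[of c e] xor[of e c] Q(1,3) gap_iff[of c e] N_iff[OF l(1), of c e] N_iff[OF l(2), of c e]
      by (elim disjE conjE) auto
    have Q': "between n a b c \<longrightarrow> between n a b e" if "{a, b} \<in> Q"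
      using 2 old_vw[OF that] old_xy[OF that] N_iff[OF Q(1)[OF that], of c e] Q(1)[of c e]
      by (elim disjE conjE) auto
    show ?thesis using 1 b vw xy Q' between_commute by (elim disjE conjE) metis+
  qed
  moreover have "\<not> between n a b c"
    if ab: "{a, b} \<in> fst (surgery v x w y d)" and ce: "{c, e} \<in> snd (surgery v x w y d)" for a b c e
  proof -
    have 1: "(a = v \<and> b = w \<or> a = w \<and> b = v) \<or> (a = x \<and> b = y \<or> a = y \<and> b = x) \<or> {a, b} \<in> Q"
      using cases[OF ab] by (auto simp: doubleton_eq_iff)
    have "{c, e} \<in> snd d \<and> {c, e} \<in> Q \<or> ({v, x} \<in> snd d \<or> {w, y} \<in> snd d) \<and> {c, e} = {x, y}"
      using ce blob_diagramsD(2)[OF d] by (auto simp: surgery_def Q_def split: if_splits)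
    then consider "{c, e} \<in> snd d" "{c, e} \<in> Q" | "{v, x} \<in> snd d \<or> {w, y} \<in> snd d" "c = x \<or> c = y"
      by (auto simp: doubleton_eq_iff)
    then show ?thesis
    proof cases
      case 1: 1
      then have "\<not> between n v w c" "\<not> between n x y c" "{a, b} \<in> Q \<longrightarrow> \<not> between n a b c"
        using gap(2)[OF 1(1)] xor[OF 1(2)] X[OF l(1) 1(1)] X[OF l(2) 1(1)] X[OF Q(1) 1(1)] by auto
      then show ?thesis
        using \<open>(a = v \<and> b = w \<or> a = w \<and> b = v) \<or> (a = x \<and> b = y \<or> a = y \<and> b = x) \<or> {a, b} \<in> Q\<close>
          between_commute by (elim disjE conjE) metis+
    next
      case 2
      have "\<not> between n v w c" using 2(2) out by auto
      moreover have "\<not> between n x y c" using 2(2) by auto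
      \<comment> \<open>No remaining line separates the four ends, so the exposure of whichever line
        was decorated passes to \<open>{x, y}\<close>.\<close>
      moreover have "\<not> between n a b c" if "{a, b} \<in> Q"
        using 2 X[OF Q(1)[OF that], of v x] X[OF Q(1)[OF that], of w y] old_xy[OF that] old_vw[OF that] by auto
      ultimately show ?thesis using 1 between_commute by (elim disjE conjE) metis+
    qed
  qed
  moreover have "is_matching (vertices n) (fst (surgery v x w y d))"
    using is_matching_surgery(1)[OF m l] by (simp add: surgery_def)
  moreover have "snd (surgery v x w y d) \<subseteq> fst (surgery v x w y d)"
    using blob_diagramsD(2)[OF d] by (auto simp: surgery_def)
  ultimately show ?thesis unfolding blob_diagrams_iff by blast
qed

lemma surgery_lines:
  assumes "is_matching V (fst d)" "{v, x} \<in> fst d" "{w, y} \<in> fst d" "{v, x} \<noteq> {w, y}" "{p, q} \<in> fst d"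
    "p \<notin> {v, x, w, y}"
  shows "{p, q} \<in> fst (surgery v x w y d)"
    and "{p, q} \<in> snd (surgery v x w y d) \<longleftrightarrow> {p, q} \<in> snd d"
  using assms(6) is_matching_vertices(3)[OF assms(1,5)] assms(5) by (auto simp: surgery_def doubleton_eq_iff)

text \<open>The blob of \<open>{w, y}\<close>, if any, travels to \<open>{x, y}\<close> and back.
  Had \<open>{v, x}\<close> been decorated, its blob would return on \<open>{w, y}\<close> instead,
  whence the last hypothesis.\<close>

lemma surgery_surgery:
  assumes m: "is_matching V (fst d)" "snd d \<subseteq> fst d"
    and l: "{v, x} \<in> fst d" "{w, y} \<in> fst d" "{v, x} \<noteq> {w, y}" "{v, x} \<notin> snd d"
  shows "surgery v w x y (surgery v x w y d) = d"
proof -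
  have "distinct [v, x, w, y]" by (rule is_matching_surgery(2)[OF m(1) l(1-3)])
  moreover have "{v, w} \<notin> fst d"
    using is_matching_unique[OF m(1) l(1), of w] \<open>distinct [v, x, w, y]\<close> by auto
  moreover have "{x, y} \<notin> fst d"
    using is_matching_unique[OF m(1), of x v y] l(1) \<open>distinct [v, x, w, y]\<close> by (auto simp: insert_commute)
  ultimately show ?thesis
    using m(2) l by (intro prod_eqI) (auto simp: surgery_def doubleton_eq_iff)
qed

section \<open>Words and diagrams\<close>

lemma surgery_commute: "surgery v x w y d = surgery w y v x d"
  by (auto simp: surgery_def insert_commute)

lemma identity_blob_diagram: "identity_diagram n \<in> blob_diagrams n"
  unfolding blob_diagrams_iff
proof (intro conjI allI impI)
  show "is_matching (vertices n) (fst (identity_diagram n))"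
    using partition_on_identity_lines[of n] by (auto simp: is_matching_def identity_diagram_eq identity_lines_def)
  show "between n a b e"
    if l: "{a, b} \<in> fst (identity_diagram n)" "{c, e} \<in> fst (identity_diagram n)" and b: "between n a b c" for a b c e
  proof -
    obtain i j where i: "i \<in> {1..n}" "{a, b} = {North i, South i}" and j: "j \<in> {1..n}" "{c, e} = {North j, South j}"
      using l by (auto simp: identity_diagram_eq identity_lines_def)
    have "a = North i \<and> b = South i \<or> a = South i \<and> b = North i"
      "c = North j \<and> e = South j \<or> c = South j \<and> e = North j"
      using i j by (auto simp: doubleton_eq_iff)
    then show ?thesis using b i j by (elim disjE conjE) (auto simp: between_def)
  qed
qed (auto simp: identity_diagram_eq)

definition generator_diagram :: "nat \<Rightarrow> nat \<Rightarrow> diagram" where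
  "generator_diagram n i = (if i = 0 then e_diagram n else U_diagram n i)"

lemma partition_diagram_generator: "i < n \<Longrightarrow> partition_diagram n (generator_diagram n i)"
  using partition_diagram_e[of n] partition_diagram_U[of i n] by (auto simp: generator_diagram_def)

fun word_diagram :: "nat \<Rightarrow> nat list \<Rightarrow> diagram" where
  "word_diagram n [] = identity_diagram n"
| "word_diagram n (i # w) = concat_diagram n (generator_diagram n i) (word_diagram n w)"

fun word_scalar :: "nat \<Rightarrow> 'c \<Rightarrow> 'c \<Rightarrow> 'c \<Rightarrow> nat list \<Rightarrow> 'c::comm_ring_1" where
  "word_scalar n \<delta> \<gamma> \<delta>\<^sub>e [] = 1"
| "word_scalar n \<delta> \<gamma> \<delta>\<^sub>e (i # w) =
    concat_scalar n \<delta> \<gamma> \<delta>\<^sub>e (generator_diagram n i) (word_diagram n w) * word_scalar n \<delta> \<gamma> \<delta>\<^sub>e w"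

lemma partition_word_diagram: "set w \<subseteq> {..<n} \<Longrightarrow> partition_diagram n (word_diagram n w)"
  by (induction w) (auto intro: partition_diagram_identity partition_diagram_concat partition_diagram_generator)

lemma
  assumes "set u \<subseteq> {..<n}" "set v \<subseteq> {..<n}"
  shows word_diagram_append: "word_diagram n (u @ v) = concat_diagram n (word_diagram n u) (word_diagram n v)"
    and word_scalar_append: "word_scalar n \<delta> \<gamma> \<delta>\<^sub>e (u @ v) = word_scalar n \<delta> \<gamma> \<delta>\<^sub>e u * word_scalar n \<delta> \<gamma> \<delta>\<^sub>e v *
      concat_scalar n \<delta> \<gamma> \<delta>\<^sub>e (word_diagram n u) (word_diagram n v)"
proof -
  have "word_diagram n (u @ v) = concat_diagram n (word_diagram n u) (word_diagram n v) \<and>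
    word_scalar n \<delta> \<gamma> \<delta>\<^sub>e (u @ v) = word_scalar n \<delta> \<gamma> \<delta>\<^sub>e u * word_scalar n \<delta> \<gamma> \<delta>\<^sub>e v *
      concat_scalar n \<delta> \<gamma> \<delta>\<^sub>e (word_diagram n u) (word_diagram n v)"
    using assms(1)
  proof (induction u)
    case Nil
    then show ?case
      using concat_identity_left concat_scalar_identity_left[of n _ \<delta> \<gamma> \<delta>\<^sub>e]
        partition_word_diagram[OF assms(2)] by simp
  next
    case (Cons i u)
    then have p: "partition_diagram n (generator_diagram n i)" "partition_diagram n (word_diagram n u)"
      using partition_diagram_generator partition_word_diagram by auto
    note q = partition_word_diagram[OF assms(2)]
    from Cons concat_diagram_assoc[OF p q] concat_scalar_assoc[OF p q, of \<delta> \<gamma> \<delta>\<^sub>e] show ?case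
      by (simp add: mult_ac)
  qed
  then show "word_diagram n (u @ v) = concat_diagram n (word_diagram n u) (word_diagram n v)"
    "word_scalar n \<delta> \<gamma> \<delta>\<^sub>e (u @ v) = word_scalar n \<delta> \<gamma> \<delta>\<^sub>e u * word_scalar n \<delta> \<gamma> \<delta>\<^sub>e v *
      concat_scalar n \<delta> \<gamma> \<delta>\<^sub>e (word_diagram n u) (word_diagram n v)" by auto
qed

lemma North_vertex: "1 \<le> j \<Longrightarrow> j \<le> n \<Longrightarrow> North j \<in> vertices n"
  and South_vertex: "1 \<le> j \<Longrightarrow> j \<le> n \<Longrightarrow> South j \<in> vertices n"
  by (simp_all add: vertices_def)

context
  fixes n :: nat and d :: diagram
  assumes d: "d \<in> blob_diagrams n"
begin

lemma e_action:
  assumes "1 \<le> n" "{North 1, x} \<in> fst d"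
  shows "concat_diagram n (e_diagram n) d = (fst d, insert {North 1, x} (snd d))"
    and "concat_scalar n \<delta> \<gamma> \<delta>\<^sub>e (e_diagram n) d = (if {North 1, x} \<in> snd d then \<delta>\<^sub>e else (1::'c::comm_ring_1))"
    and "(fst d, insert {North 1, x} (snd d)) \<in> blob_diagrams n"
proof -
  show "concat_diagram n (e_diagram n) d = (fst d, insert {North 1, x} (snd d))"
    "concat_scalar n \<delta> \<gamma> \<delta>\<^sub>e (e_diagram n) d = (if {North 1, x} \<in> snd d then \<delta>\<^sub>e else 1)"
    by (rule concat_e_left[OF partition_diagram_blob[OF d] assms] concat_scalar_e_left[OF partition_diagram_blob[OF d] assms], simp)+
  have pos: "1 \<le> position n v" if "v \<in> vertices n" for v
    using that by (auto simp: vertices_def)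
  \<comment> \<open>North 1 has the smallest position, so no line cuts it off from the western edge;
    by planarity none cuts off its partner.\<close>
  have 1: "\<not> between n a b (North 1)" if "{a, b} \<in> fst d" for a b
    using pos is_matching_vertices[OF blob_diagramsD(1)[OF d] that] by (fastforce simp: between_def)
  have 2: "\<not> between n a b x" if "{a, b} \<in> fst d" for a b
    using blob_diagramsD(3)[OF d that, of x "North 1"] assms(2) 1[OF that] by (auto simp: insert_commute)
  have "\<not> between n a b c" if "{a, b} \<in> fst d" "{c, e} \<in> insert {North 1, x} (snd d)" for a b c e
  proof -
    have "{c, e} \<in> snd d \<or> c = North 1 \<or> c = x" using that(2) by (auto simp: doubleton_eq_iff)
    then show ?thesis using 1 2 that(1) blob_diagramsD(4)[OF d that(1)] by blast
  qed
  then show "(fst d, insert {North 1, x} (snd d)) \<in> blob_diagrams n"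
    using d assms(2) unfolding blob_diagrams_iff by simp
qed

lemma remove_blob: "(fst d, snd d - B) \<in> blob_diagrams n"
proof -
  have "\<not> between n a b c" if "{a, b} \<in> fst d" "{c, e} \<in> snd d - B" for a b c e
    using blob_diagramsD(4)[OF d that(1), of c e] that(2) by simp
  moreover have "snd d - B \<subseteq> fst d" using blob_diagramsD(2)[OF d] by blast
  ultimately show ?thesis using d unfolding blob_diagrams_iff by simp
qed

lemma U_action_loop:
  assumes i: "1 \<le> i" "i < n" and l: "{North i, North (Suc i)} \<in> fst d"
  shows "concat_diagram n (U_diagram n i) d = (fst d, snd d - {{North i, North (Suc i)}})"
    and "concat_scalar n \<delta> \<gamma> \<delta>\<^sub>e (U_diagram n i) d =
      (if {North i, North (Suc i)} \<in> snd d then \<gamma> else (\<delta>::'c::comm_ring_1))"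
proof -
  have "North i \<in> {North i, North (Suc i)}" "North (Suc i) \<in> {North i, North (Suc i)}" by auto
  note * = i l this(1) l this(2)
  show "concat_diagram n (U_diagram n i) d = (fst d, snd d - {{North i, North (Suc i)}})"
    using concat_U_left[OF partition_diagram_blob[OF d] *] l by (auto simp: insert_absorb)
  show "concat_scalar n \<delta> \<gamma> \<delta>\<^sub>e (U_diagram n i) d =
      (if {North i, North (Suc i)} \<in> snd d then \<gamma> else \<delta>)"
    using concat_scalar_U_left[OF partition_diagram_blob[OF d] *, of \<delta> \<gamma> \<delta>\<^sub>e] by simp
qed

lemma U_action:
  assumes i: "1 \<le> i" "i < n" and l: "{North i, x} \<in> fst d" "{North (Suc i), y} \<in> fst d" "x \<noteq> North (Suc i)"
  shows "concat_diagram n (U_diagram n i) d = surgery (North i) x (North (Suc i)) y d"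
    and "\<not> ({North i, x} \<in> snd d \<and> {North (Suc i), y} \<in> snd d) \<Longrightarrow>
      concat_scalar n \<delta> \<gamma> \<delta>\<^sub>e (U_diagram n i) d = (1::'c::comm_ring_1)"
    and "surgery (North i) x (North (Suc i)) y d \<in> blob_diagrams n"
    and "{North i, x} \<noteq> {North (Suc i), y}"
proof -
  note m = blob_diagramsD(1)[OF d]
  show neq: "{North i, x} \<noteq> {North (Suc i), y}"
    using l by (auto simp: doubleton_eq_iff)
  have dis: "distinct [North i, x, North (Suc i), y]"
    by (rule is_matching_surgery(2)[OF m l(1,2) neq])
  have "North i \<in> {North i, x}" "North (Suc i) \<in> {North (Suc i), y}" by auto
  note * = partition_diagram_blob[OF d] i l(1) this(1) l(2) this(2)
  have r: "{North i, x} \<union> {North (Suc i), y} - {North i, North (Suc i)} = {x, y}"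
    using dis by auto
  show "concat_diagram n (U_diagram n i) d = surgery (North i) x (North (Suc i)) y d"
    unfolding concat_U_left[OF *] r surgery_def by auto
  have "{North i, x} \<union> {North (Suc i), y} \<noteq> {North i, North (Suc i)}" using r by auto
  moreover have "card ({{North i, x}, {North (Suc i), y}} \<inter> snd d) - 1 = 0"
    if "\<not> ({North i, x} \<in> snd d \<and> {North (Suc i), y} \<in> snd d)"
    using that by (cases "{North i, x} \<in> snd d"; cases "{North (Suc i), y} \<in> snd d") (simp_all add: Int_insert_left)
  ultimately show "concat_scalar n \<delta> \<gamma> \<delta>\<^sub>e (U_diagram n i) d = (1::'c::comm_ring_1)"
    if "\<not> ({North i, x} \<in> snd d \<and> {North (Suc i), y} \<in> snd d)"
    unfolding concat_scalar_U_left[OF *] using that by simp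
  \<comment> \<open>The two positions are consecutive, so both gap conditions hold
    vacuously.\<close>
  have "\<not> between n (North i) (North (Suc i)) a" for a by (auto simp: between_def)
  then show "surgery (North i) x (North (Suc i)) y d \<in> blob_diagrams n"
    using surgery_blob_diagram[OF d l(1,2) neq] by blast
qed

lemma generator_action_closed:
  assumes "i < n"
  shows "concat_diagram n (generator_diagram n i) d \<in> blob_diagrams n"
proof (cases "i = 0")
  case True
  have "1 \<le> n" using assms by simp
  then have "North 1 \<in> vertices n" by (simp add: North_vertex)
  then obtain x where "{North 1, x} \<in> fst d"
    by (rule is_matching_partner[OF blob_diagramsD(1)[OF d]])
  then show ?thesis using e_action[OF \<open>1 \<le> n\<close>] True by (simp add: generator_diagram_def)
next
  case False
  then have i: "1 \<le> i" "i < n" using assms by auto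
  then have "North i \<in> vertices n" "North (Suc i) \<in> vertices n" by (simp_all add: North_vertex)
  then obtain x y where l: "{North i, x} \<in> fst d" "{North (Suc i), y} \<in> fst d"
    by (meson is_matching_partner[OF blob_diagramsD(1)[OF d]])
  show ?thesis
  proof (cases "x = North (Suc i)")
    case True
    then show ?thesis using U_action_loop(1)[OF i] l remove_blob False by (simp add: generator_diagram_def)
  next
    case False
    then show ?thesis using U_action[OF i l] i by (simp add: generator_diagram_def)
  qed
qed

end

text \<open>Let \<open>v\<close> be the vertex common to the two northern arcs and \<open>x\<close>,
  \<open>w\<close> their other ends. U_j trades the arc \<open>{v, x}\<close> for
  \<open>{v, w}\<close> by a surgery which U_i inverts, and scalars are 1 because one of the two
  lines involved is undecorated each time. For \<open>d\<close> the diagram of U_i this is the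
  relation U_i U_j U_i = U_i; for general \<open>d\<close> it slides an arc along the northern
  edge.\<close>

lemma U_U_action:
  assumes d: "d \<in> blob_diagrams n" and i: "1 \<le> i" "i < n" and j: "1 \<le> j" "j < n" and ij: "i = Suc j \<or> j = Suc i"
    and l: "{North i, North (Suc i)} \<in> fst d" "{North i, North (Suc i)} \<notin> snd d"
  shows "concat_diagram n (U_diagram n i) (concat_diagram n (U_diagram n j) d) = d"
    and "concat_scalar n \<delta> \<gamma> \<delta>\<^sub>e (U_diagram n j) d = (1::'c::comm_ring_1)"
    and "concat_scalar n \<delta> \<gamma> \<delta>\<^sub>e (U_diagram n i) (concat_diagram n (U_diagram n j) d) = (1::'c)"
    and "{North j, North (Suc j)} \<in> fst (concat_diagram n (U_diagram n j) d)"
    and "{North j, North (Suc j)} \<notin> snd (concat_diagram n (U_diagram n j) d)"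
proof -
  note m = blob_diagramsD(1,2)[OF d]
  define v x w where "v = (if i = Suc j then North i else North j)"
    and "x = (if i = Suc j then North (Suc i) else North i)"
    and "w = (if i = Suc j then North j else North (Suc j))"
  have vx: "{North i, North (Suc i)} = {v, x}" and vw: "{North j, North (Suc j)} = {v, w}"
    using ij by (auto simp: v_def x_def w_def)
  have wx: "w \<noteq> x" "w \<noteq> v" using ij by (auto simp: v_def x_def w_def)
  have "w \<in> vertices n" using j by (auto simp: w_def intro: North_vertex)
  then obtain y where y: "{w, y} \<in> fst d" using is_matching_partner[OF m(1)] by blast
  have l': "{v, x} \<in> fst d" "{v, x} \<notin> snd d" using l vx by auto
  have neq: "{v, x} \<noteq> {w, y}" using wx by (auto simp: doubleton_eq_iff)
  have dis: "distinct [v, x, w, y]" by (rule is_matching_surgery(2)[OF m(1) l'(1) y neq])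
  define d1 where "d1 = surgery v x w y d"
  have j': "concat_diagram n (U_diagram n j) d = d1 \<and> concat_scalar n \<delta> \<gamma> \<delta>\<^sub>e (U_diagram n j) d = (1::'c) \<and> d1 \<in> blob_diagrams n"
  proof (cases "i = Suc j")
    case True
    then have e: "North j = w" "North (Suc j) = v" by (simp_all add: v_def w_def)
    then have "{North j, y} \<in> fst d" "{North (Suc j), x} \<in> fst d" "y \<noteq> North (Suc j)"
      using y l' dis by auto
    from U_action(1,3)[OF d j this] U_action(2)[OF d j this, of \<delta> \<gamma> \<delta>\<^sub>e] show ?thesis
      using l' by (simp add: d1_def e surgery_commute[of w y v x])
  next
    case False
    then have e: "North j = v" "North (Suc j) = w" by (simp_all add: v_def w_def)
    then have "{North j, x} \<in> fst d" "{North (Suc j), y} \<in> fst d" "x \<noteq> North (Suc j)"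
      using y l' dis by auto
    from U_action(1,3)[OF d j this] U_action(2)[OF d j this, of \<delta> \<gamma> \<delta>\<^sub>e] show ?thesis
      using l' by (simp add: d1_def e)
  qed
  then have d1_blob: "d1 \<in> blob_diagrams n" by simp
  have d1: "{v, w} \<in> fst d1" "{x, y} \<in> fst d1" by (simp_all add: d1_def surgery_def)
  have "{v, w} \<notin> fst d" using is_matching_unique[OF m(1) l'(1)] wx by blast
  then have vw1: "{v, w} \<notin> snd d1"
    using m(2) dis by (auto simp: d1_def surgery_def doubleton_eq_iff)
  show "{North j, North (Suc j)} \<in> fst (concat_diagram n (U_diagram n j) d)"
    "{North j, North (Suc j)} \<notin> snd (concat_diagram n (U_diagram n j) d)"
    using j' d1 vw1 vw by simp_all
  show "concat_scalar n \<delta> \<gamma> \<delta>\<^sub>e (U_diagram n j) d = (1::'c)" using j' by simp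
  have inverse: "surgery v w x y d1 = d"
    unfolding d1_def by (rule surgery_surgery[OF m l'(1) y neq l'(2)])
  have "concat_diagram n (U_diagram n i) d1 = d \<and> concat_scalar n \<delta> \<gamma> \<delta>\<^sub>e (U_diagram n i) d1 = (1::'c)"
  proof (cases "i = Suc j")
    case True
    then have e: "North i = v" "North (Suc i) = x" by (simp_all add: v_def x_def)
    then have "{North i, w} \<in> fst d1" "{North (Suc i), y} \<in> fst d1" "w \<noteq> North (Suc i)"
      using d1 dis by auto
    from U_action(1)[OF d1_blob i this] U_action(2)[OF d1_blob i this, of \<delta> \<gamma> \<delta>\<^sub>e] show ?thesis
      using vw1 by (simp add: e inverse)
  next
    case False
    then have e: "North i = x" "North (Suc i) = v" using ij by (simp_all add: v_def x_def)
    then have "{North i, y} \<in> fst d1" "{North (Suc i), w} \<in> fst d1" "y \<noteq> North (Suc i)"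
      using d1 dis by auto
    from U_action(1)[OF d1_blob i this] U_action(2)[OF d1_blob i this, of \<delta> \<gamma> \<delta>\<^sub>e] show ?thesis
      using vw1 by (simp add: e inverse surgery_commute[of x y v w])
  qed
  then show "concat_diagram n (U_diagram n i) (concat_diagram n (U_diagram n j) d) = d"
    "concat_scalar n \<delta> \<gamma> \<delta>\<^sub>e (U_diagram n i) (concat_diagram n (U_diagram n j) d) = (1::'c)"
    using j' by simp_all
qed

lemma word_blob_diagram: "set w \<subseteq> {..<n} \<Longrightarrow> word_diagram n w \<in> blob_diagrams n"
  by (induction w) (auto intro: identity_blob_diagram generator_action_closed)

lemma identity_lines_mem: "1 \<le> j \<Longrightarrow> j \<le> n \<Longrightarrow> {North j, South j} \<in> fst (identity_diagram n)"
  by (simp add: identity_diagram_eq identity_lines_def)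

lemma U_identity:
  assumes i: "1 \<le> i" "i < n"
  shows "concat_diagram n (U_diagram n i) (identity_diagram n) = U_diagram n i"
    and "concat_scalar n \<delta> \<gamma> \<delta>\<^sub>e (U_diagram n i) (identity_diagram n) = (1::'c::comm_ring_1)"
proof -
  have l: "{North i, South i} \<in> fst (identity_diagram n)" "{North (Suc i), South (Suc i)} \<in> fst (identity_diagram n)"
    using i by (auto intro: identity_lines_mem)
  have "identity_lines n - {{North i, South i}, {North (Suc i), South (Suc i)}} =
    (\<lambda>j. {North j, South j}) ` ({1..n} - {i, Suc i})"
    by (auto simp: identity_lines_def doubleton_eq_iff)
  then show "concat_diagram n (U_diagram n i) (identity_diagram n) = U_diagram n i"
    unfolding U_action(1)[OF identity_blob_diagram i l vertex.distinct(2)]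
    by (simp add: surgery_def U_diagram_eq identity_diagram_eq)
  show "concat_scalar n \<delta> \<gamma> \<delta>\<^sub>e (U_diagram n i) (identity_diagram n) = (1::'c)"
    by (rule U_action(2)[OF identity_blob_diagram i l vertex.distinct(2)]) (simp add: identity_diagram_eq)
qed

lemma e_identity:
  assumes "1 \<le> n"
  shows "concat_diagram n (e_diagram n) (identity_diagram n) = e_diagram n"
    and "concat_scalar n \<delta> \<gamma> \<delta>\<^sub>e (e_diagram n) (identity_diagram n) = (1::'c::comm_ring_1)"
  using e_action[OF identity_blob_diagram assms identity_lines_mem] assms
  by (simp_all add: identity_diagram_eq e_diagram_eq)

lemma
  assumes "i < n"
  shows word_diagram_single: "word_diagram n [i] = generator_diagram n i"
    and word_scalar_single: "word_scalar n \<delta> \<gamma> \<delta>\<^sub>e [i] = (1::'c::comm_ring_1)"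
proof -
  have "concat_diagram n (generator_diagram n i) (identity_diagram n) = generator_diagram n i \<and>
    concat_scalar n \<delta> \<gamma> \<delta>\<^sub>e (generator_diagram n i) (identity_diagram n) = (1::'c)"
  proof (cases "i = 0")
    case True
    then have "1 \<le> n" using assms by simp
    from e_identity(1)[OF this] e_identity(2)[OF this, of \<delta> \<gamma> \<delta>\<^sub>e] True show ?thesis
      by (simp add: generator_diagram_def)
  next
    case False
    then have "1 \<le> i" by simp
    from U_identity(1)[OF this assms] U_identity(2)[OF this assms, of \<delta> \<gamma> \<delta>\<^sub>e] False show ?thesis
      by (simp add: generator_diagram_def)
  qed
  then show "word_diagram n [i] = generator_diagram n i" "word_scalar n \<delta> \<gamma> \<delta>\<^sub>e [i] = (1::'c)" by simp_all
qed

lemma U_diagram_cup: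
  shows "{North i, North (Suc i)} \<in> fst (U_diagram n i)" "snd (U_diagram n i) = {}"
  by (simp_all add: U_diagram_eq)

lemma generator_blob_diagram: "i < n \<Longrightarrow> generator_diagram n i \<in> blob_diagrams n"
  using word_blob_diagram[of "[i]" n] word_diagram_single[of i n] by simp

section \<open>The defining relations on diagrams\<close>

context
  fixes n :: nat and \<delta> \<gamma> \<delta>\<^sub>e :: "'c::comm_ring_1"
begin

lemma square_relation:
  assumes "i < n"
  shows "word_diagram n [i, i] = word_diagram n [i]"
    and "word_scalar n \<delta> \<gamma> \<delta>\<^sub>e [i, i] = (if i = 0 then \<delta>\<^sub>e else \<delta>)"
proof -
  have "word_diagram n [i, i] = word_diagram n [i] \<and> word_scalar n \<delta> \<gamma> \<delta>\<^sub>e [i, i] = (if i = 0 then \<delta>\<^sub>e else \<delta>)"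
  proof (cases "i = 0")
    case True
    then have n: "1 \<le> n" using assms by simp
    have "{North 1, South 1} \<in> fst (e_diagram n)" "{North 1, South 1} \<in> snd (e_diagram n)"
      using n by (auto simp: e_diagram_eq identity_lines_def)
    moreover have "e_diagram n \<in> blob_diagrams n"
      using generator_blob_diagram[of 0 n] n by (simp add: generator_diagram_def)
    ultimately show ?thesis
      using e_action(1)[of "e_diagram n" n "South 1"] e_action(2)[of "e_diagram n" n "South 1" \<delta> \<gamma> \<delta>\<^sub>e]
        e_identity(1)[OF n] e_identity(2)[OF n, of \<delta> \<gamma> \<delta>\<^sub>e] n True
      by (simp add: generator_diagram_def insert_absorb)
  next
    case False
    then have i: "1 \<le> i" "i < n" using assms by auto
    have "U_diagram n i \<in> blob_diagrams n"
      using generator_blob_diagram[OF i(2)] i by (simp add: generator_diagram_def)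
    note U = U_action_loop(1)[OF this i U_diagram_cup(1)] U_action_loop(2)[OF this i U_diagram_cup(1), of \<delta> \<gamma> \<delta>\<^sub>e]
      U_identity(1)[OF i] U_identity(2)[OF i, of \<delta> \<gamma> \<delta>\<^sub>e]
    have "(fst (U_diagram n i), snd (U_diagram n i) - B) = U_diagram n i" for B by (simp add: U_diagram_eq)
    then show ?thesis using i U by (simp add: generator_diagram_def U_diagram_cup(2))
  qed
  then show "word_diagram n [i, i] = word_diagram n [i]"
    "word_scalar n \<delta> \<gamma> \<delta>\<^sub>e [i, i] = (if i = 0 then \<delta>\<^sub>e else \<delta>)" by auto
qed

lemma cancel_relation:
  assumes "0 < i" "0 < j" "i < n" "j < n" "i = Suc j \<or> j = Suc i"
  shows "word_diagram n [i, j, i] = word_diagram n [i]"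
    and "word_scalar n \<delta> \<gamma> \<delta>\<^sub>e [i, j, i] = 1"
proof -
  have i: "1 \<le> i" "i < n" and j: "1 \<le> j" "j < n" using assms by auto
  have "U_diagram n i \<in> blob_diagrams n"
    using generator_blob_diagram[OF i(2)] i by (simp add: generator_diagram_def)
  note * = U_U_action(1)[OF this i j assms(5) U_diagram_cup(1)]
    U_U_action(2,3)[OF this i j assms(5) U_diagram_cup(1), of \<delta> \<gamma> \<delta>\<^sub>e]
  show "word_diagram n [i, j, i] = word_diagram n [i]" "word_scalar n \<delta> \<gamma> \<delta>\<^sub>e [i, j, i] = 1"
    using * U_identity(1)[OF i] U_identity(2)[OF i, of \<delta> \<gamma> \<delta>\<^sub>e] i j
    by (simp_all add: generator_diagram_def U_diagram_cup(2))
qed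

text \<open>The letter e decorates the northern arc of the lower U_1, which the upper U_1 closes
  into a decorated loop.\<close>

lemma blob_relation:
  assumes "1 < n"
  shows "word_diagram n [1, 0, 1] = word_diagram n [1]"
    and "word_scalar n \<delta> \<gamma> \<delta>\<^sub>e [1, 0, 1] = \<gamma>"
proof -
  have n: "1 \<le> n" "(1::nat) \<le> 1" using assms by auto
  let ?u = "U_diagram n 1" and ?c = "{North 1, North (Suc 1)}"
  have u: "?u \<in> blob_diagrams n"
    using generator_blob_diagram[OF assms] by (simp add: generator_diagram_def)
  have c: "?c \<in> fst ?u" "?c \<notin> snd ?u" using U_diagram_cup(1)[of 1 n] by (simp_all add: U_diagram_cup(2))
  note 1 = e_action(1)[OF u n(1) c(1)] e_action(2)[OF u n(1) c(1), of \<delta> \<gamma> \<delta>\<^sub>e] e_action(3)[OF u n(1) c(1)]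
  have "?c \<in> fst (fst ?u, insert ?c (snd ?u))" using c by simp
  from U_action_loop(1)[OF 1(3) n(2) assms this] U_action_loop(2)[OF 1(3) n(2) assms this, of \<delta> \<gamma> \<delta>\<^sub>e]
  moreover have "(fst ?u, insert ?c (snd ?u) - {?c}) = ?u" using c by simp
  ultimately have 2: "concat_diagram n ?u (fst ?u, insert ?c (snd ?u)) = ?u"
    "concat_scalar n \<delta> \<gamma> \<delta>\<^sub>e ?u (fst ?u, insert ?c (snd ?u)) = \<gamma>"
    by (simp_all only: fst_conv snd_conv insertI1 if_True)
  have gens: "generator_diagram n 1 = ?u" "generator_diagram n 0 = e_diagram n"
    by (simp_all add: generator_diagram_def)
  note U1 = U_identity(1)[OF n(2) assms] U_identity(2)[OF n(2) assms, of \<delta> \<gamma> \<delta>\<^sub>e]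
  show "word_diagram n [1, 0, 1] = word_diagram n [1]"
    by (simp only: word_diagram.simps gens U1 1(1) 2)
  show "word_scalar n \<delta> \<gamma> \<delta>\<^sub>e [1, 0, 1] = \<gamma>"
    using c(2) by (simp only: word_diagram.simps word_scalar.simps gens U1 1(1,2) 2 if_False mult_1_right)
qed

lemma image_straight_diff:
  "(\<lambda>k. {North k, South k}) ` A - {{North i, South i}, {North j, South j}} =
    (\<lambda>k. {North k, South k}) ` (A - {i, j})"
proof -
  have "inj (\<lambda>k. {North k, South k})" by (auto simp: inj_def doubleton_eq_iff)
  from image_set_diff[OF this, of A "{i, j}"] show ?thesis by simp
qed

lemma commute_relation_less:
  assumes "Suc i < j" "j < n"
  shows "word_diagram n [i, j] = word_diagram n [j, i]"
    and "word_scalar n \<delta> \<gamma> \<delta>\<^sub>e [i, j] = 1" "word_scalar n \<delta> \<gamma> \<delta>\<^sub>e [j, i] = 1"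
proof -
  have n: "1 \<le> n" and j: "1 \<le> j" "j < n" using assms by auto
  have uj: "U_diagram n j \<in> blob_diagrams n" and gj: "generator_diagram n j = U_diagram n j"
    using generator_blob_diagram[OF j(2)] j by (simp_all add: generator_diagram_def)
  have line: "{North k, South k} \<in> fst (U_diagram n m)" if "1 \<le> k" "k \<le> n" "k \<noteq> m" "k \<noteq> Suc m" for k m
    using that by (auto simp: U_diagram_eq)
  have "word_diagram n [i, j] = word_diagram n [j, i] \<and>
    word_scalar n \<delta> \<gamma> \<delta>\<^sub>e [i, j] = 1 \<and> word_scalar n \<delta> \<gamma> \<delta>\<^sub>e [j, i] = 1"
  proof (cases "i = 0")
    case True
    have g0: "generator_diagram n i = e_diagram n" using True by (simp add: generator_diagram_def)
    have ue: "e_diagram n \<in> blob_diagrams n"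
      using generator_blob_diagram[of i n] assms g0 by simp
    have le: "{North k, South k} \<in> fst (e_diagram n)" if "1 \<le> k" "k \<le> n" for k
      using that by (auto simp: e_diagram_eq identity_lines_def)
    have sn: "snd (e_diagram n) = {{North 1, South 1}}" by (simp add: e_diagram_eq)
    have lj: "{North j, South j} \<in> fst (e_diagram n)" "{North (Suc j), South (Suc j)} \<in> fst (e_diagram n)"
      using le j by auto
    have l1: "{North 1, South 1} \<in> fst (U_diagram n j)" using assms by (intro line) auto
    have "surgery (North j) (South j) (North (Suc j)) (South (Suc j)) (e_diagram n) =
      (fst (U_diagram n j), insert {North 1, South 1} (snd (U_diagram n j)))"
      using assms by (simp add: surgery_def U_diagram_eq e_diagram_eq identity_lines_def doubleton_eq_iff image_straight_diff)
    then show ?thesis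
      using U_action(1)[OF ue j lj vertex.distinct(2)] U_action(2)[OF ue j lj vertex.distinct(2), of \<delta> \<gamma> \<delta>\<^sub>e]
        e_action(1)[OF uj n l1] e_action(2)[OF uj n l1, of \<delta> \<gamma> \<delta>\<^sub>e] U_identity(1)[OF j]
        U_identity(2)[OF j, of \<delta> \<gamma> \<delta>\<^sub>e] e_identity(1)[OF n] e_identity(2)[OF n, of \<delta> \<gamma> \<delta>\<^sub>e] gj g0 sn assms
      by (simp add: U_diagram_cup doubleton_eq_iff)
  next
    case False
    then have i: "1 \<le> i" "i < n" using assms by auto
    have ui: "U_diagram n i \<in> blob_diagrams n" and gi: "generator_diagram n i = U_diagram n i"
      using generator_blob_diagram[OF i(2)] i by (simp_all add: generator_diagram_def)
    have lj: "{North j, South j} \<in> fst (U_diagram n i)" "{North (Suc j), South (Suc j)} \<in> fst (U_diagram n i)"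
      using assms j by (auto intro!: line)
    have li: "{North i, South i} \<in> fst (U_diagram n j)" "{North (Suc i), South (Suc i)} \<in> fst (U_diagram n j)"
      using assms i by (auto intro!: line)
    let ?R = "insert {North i, North (Suc i)} (insert {South i, South (Suc i)}
      (insert {North j, North (Suc j)} (insert {South j, South (Suc j)}
        ((\<lambda>k. {North k, South k}) ` ({1..n} - {i, Suc i} - {j, Suc j})))))"
    have "{1..n} - {j, Suc j} - {i, Suc i} = {1..n} - {i, Suc i} - {j, Suc j}" by auto
    then have "surgery (North i) (South i) (North (Suc i)) (South (Suc i)) (U_diagram n j) = (?R, {})"
      by (simp add: surgery_def U_diagram_eq insert_Diff_if doubleton_eq_iff image_straight_diff)
    moreover have "surgery (North j) (South j) (North (Suc j)) (South (Suc j)) (U_diagram n i) = (?R, {})"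
      by (simp add: surgery_def U_diagram_eq insert_Diff_if doubleton_eq_iff image_straight_diff insert_commute)
    ultimately have "surgery (North j) (South j) (North (Suc j)) (South (Suc j)) (U_diagram n i) =
      surgery (North i) (South i) (North (Suc i)) (South (Suc i)) (U_diagram n j)" by simp
    then show ?thesis
      using U_action(1)[OF ui j lj vertex.distinct(2)] U_action(2)[OF ui j lj vertex.distinct(2), of \<delta> \<gamma> \<delta>\<^sub>e]
        U_action(1)[OF uj i li vertex.distinct(2)] U_action(2)[OF uj i li vertex.distinct(2), of \<delta> \<gamma> \<delta>\<^sub>e]
        U_identity(1)[OF i] U_identity(2)[OF i, of \<delta> \<gamma> \<delta>\<^sub>e] U_identity(1)[OF j] U_identity(2)[OF j, of \<delta> \<gamma> \<delta>\<^sub>e] gi gj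
      by (simp add: U_diagram_cup)
  qed
  then show "word_diagram n [i, j] = word_diagram n [j, i]"
    and "word_scalar n \<delta> \<gamma> \<delta>\<^sub>e [i, j] = 1" "word_scalar n \<delta> \<gamma> \<delta>\<^sub>e [j, i] = 1" by auto
qed

lemma commute_relation:
  assumes "i < n" "j < n" "Suc i < j \<or> Suc j < i"
  shows "word_diagram n [i, j] = word_diagram n [j, i]"
    and "word_scalar n \<delta> \<gamma> \<delta>\<^sub>e [i, j] = word_scalar n \<delta> \<gamma> \<delta>\<^sub>e [j, i]"
  using assms commute_relation_less[of i j] commute_relation_less[of j i] by auto

end

text \<open>The scalars are left out on purpose: a reduction over any coefficient ring then yields
  information on diagrams.\<close>

lemma word_diagram_reduces:
  "reduces \<delta> \<gamma> \<delta>\<^sub>e n u c v \<Longrightarrow> set u \<subseteq> {..<n} \<Longrightarrow> word_diagram n u = word_diagram n v"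
proof (induction rule: reduces.induct)
  case (compose u c v d w)
  then show ?case using red_letters[OF compose.hyps(1)] by simp
next
  case (in_context u c v x y)
  then have "set v \<subseteq> {..<n}" using red_letters[OF in_context.hyps] by simp
  then show ?case using in_context by (simp add: word_diagram_append)
next
  case (square i)
  then show ?case using square_relation(1)[of i n] by simp
next
  case (cancel i j)
  then show ?case using cancel_relation(1)[of i j n] by simp
next
  case (uncancel i j)
  then show ?case using cancel_relation(1)[of i j n] by simp
next
  case blob
  then show ?case using blob_relation(1)[of n] by simp
next
  case (commute i j)
  then show ?case using commute_relation(1)[of i n j] by simp
qed simp

section \<open>Every blob diagram is a product of generators\<close>

text \<open>The parameter of the induction that strips generators: apart from undecorated vertical
  lines, such a diagram lives on its first \<open>m\<close> positions.\<close>

definition straight_beyond :: "nat \<Rightarrow> nat \<Rightarrow> diagram \<Rightarrow> bool" where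
  "straight_beyond n m d \<longleftrightarrow> (\<forall>j. m < j \<longrightarrow> j \<le> n \<longrightarrow> {North j, South j} \<in> fst d - snd d)"

lemma straight_beyond_0:
  assumes d: "d \<in> blob_diagrams n" and s: "straight_beyond n 0 d"
  shows "d = identity_diagram n"
proof -
  note m = blob_diagramsD(1,2)[OF d]
  have "l \<in> identity_lines n \<and> l \<notin> snd d" if l: "l \<in> fst d" for l
  proof -
    obtain a b where ab: "l = {a, b}" "a \<in> vertices n" using is_matching_line[OF m(1) l] by metis
    then obtain j where j: "1 \<le> j" "j \<le> n" "a \<in> {North j, South j}" by (auto simp: vertices_def)
    then have "{North j, South j} \<in> fst d - snd d" using s by (simp add: straight_beyond_def)
    moreover from this have "l = {North j, South j}"
      using is_matching_eq[OF m(1) l, of "{North j, South j}" a] j ab by auto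
    ultimately show ?thesis using j by (auto simp: identity_lines_def)
  qed
  moreover have "identity_lines n \<subseteq> fst d"
    using s by (auto simp: identity_lines_def straight_beyond_def)
  ultimately have "fst d = identity_lines n" "snd d = {}" using m(2) by blast+
  then show ?thesis by (simp add: identity_diagram_eq prod_eq_iff)
qed

text \<open>Take the line starting at one of the first \<open>m\<close> northern vertices whose right end comes first.
  It is a cup of neighbours, or all these lines run from north to south.\<close>

lemma reducible_line:
  assumes d: "d \<in> blob_diagrams n" and s: "straight_beyond n m d" and m: "1 \<le> m" "m \<le> n"
  obtains "{North m, South m} \<in> fst d" "{North m, South m} \<notin> snd d"
  | "m = 1" "{North m, South m} \<in> snd d"
  | i where "1 \<le> i" "i < m" "{North i, North (Suc i)} \<in> fst d" "{North i, North (Suc i)} \<in> snd d \<Longrightarrow> i = 1"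
proof -
  note M = blob_diagramsD(1,2)[OF d] and N = blob_diagramsD(3)[OF d] and X = blob_diagramsD(4)[OF d]
  \<comment> \<open>Positions up to \<open>m\<close> are those of the first \<open>m\<close>
    northern vertices; \<open>r\<close> runs over the right ends of lines that start there.\<close>
  define P where "P r \<longleftrightarrow> (\<exists>a b. {a, b} \<in> fst d \<and> position n a \<le> m \<and> position n a < position n b \<and> r = position n b)" for r
  have partner: "\<exists>z. {North j, z} \<in> fst d \<and> z \<in> vertices n \<and> position n z \<noteq> j" if "1 \<le> j" "j \<le> n" for j
  proof -
    have "North j \<in> vertices n" using that by (rule North_vertex)
    then obtain z where z: "{North j, z} \<in> fst d" by (rule is_matching_partner[OF M(1)])
    then have "z \<in> vertices n" "North j \<noteq> z" using is_matching_vertices[OF M(1) z] by auto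
    then show ?thesis using z position_inj[OF North_vertex[OF that], of z] by auto
  qed
  have pos1: "1 \<le> position n z" if "z \<in> vertices n" for z using that by (auto simp: vertices_def)
  obtain z where z: "{North 1, z} \<in> fst d" "z \<in> vertices n" "position n z \<noteq> 1" using partner[of 1] m by auto
  then have "P (position n z)"
    unfolding P_def using pos1[OF z(2)] m by (intro exI[of _ "North 1"] exI[of _ z]) simp
  then have r: "P (LEAST r. P r)" "\<And>r'. P r' \<Longrightarrow> (LEAST r. P r) \<le> r'"
    by (rule LeastI) (rule Least_le)
  define r where "r = (LEAST r. P r)"
  note r = r[folded r_def]
  have least: "r \<le> position n b" if "{a, b} \<in> fst d" "position n a \<le> m" "position n a < position n b" for a b
    using r(2) that unfolding P_def by blast
  from r(1) obtain a b where ab: "{a, b} \<in> fst d" "position n a \<le> m" "position n a < position n b" "r = position n b"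
    unfolding P_def by blast
  have vab: "a \<in> vertices n" "b \<in> vertices n" using is_matching_vertices[OF M(1) ab(1)] by auto
  show thesis
  proof (cases "r \<le> m")
    case True
    obtain i where i: "a = North i" "1 \<le> i" "i \<le> n"
      using vab(1) ab(2) m by (auto simp: vertices_def)
    obtain j where j: "b = North j" "1 \<le> j" "j \<le> n"
      using vab(2) True ab(4) m by (auto simp: vertices_def)
    have ij: "i < j" "j \<le> m" using ab i j True by auto
    have "j = Suc i"
    \<comment> \<open>Otherwise the line at i + 1 would be nested inside this one and have an
      earlier right end.\<close>
    proof (rule ccontr)
      assume "j \<noteq> Suc i"
      then have lt: "Suc i < j" using ij by simp
      then obtain z where z: "{North (Suc i), z} \<in> fst d" "position n z \<noteq> Suc i" using partner[of "Suc i"] j by auto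
      have "between n a b (North (Suc i))" using lt i j by (simp add: between_def)
      then have "between n a b z" by (rule N[OF ab(1) z(1)])
      then have zr: "i < position n z" "position n z < j" using i j ij by (auto simp: between_def)
      then have "r \<le> position n z" using least[OF z(1)] z(2) lt ij by simp
      then show False using zr ab(4) j by simp
    qed
    moreover have "i = 1" if "{North i, North (Suc i)} \<in> snd d"
    \<comment> \<open>A decorated arc further east is exposed, so the line at i - 1 must end west of
      i - 1, and its right end i - 1 would come before \<open>r\<close>.\<close>
    proof (rule ccontr)
      assume "i \<noteq> 1"
      then have i1: "1 \<le> i - 1" "i - 1 \<le> n" "Suc (i - 1) = i" using i by auto
      then obtain z where z: "{North (i - 1), z} \<in> fst d" "z \<in> vertices n" "position n z \<noteq> i - 1"
        using partner by blast
      have "\<not> between n (North (i - 1)) z (North i)" by (rule X[OF z(1) that])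
      moreover have "position n z \<noteq> i"
      proof
        assume "position n z = i"
        then have "z = North i" using position_inj[OF z(2) North_vertex[OF i(2,3)]] by simp
        then have "{North i, North (i - 1)} \<in> fst d" using z(1) by (simp add: insert_commute)
        then show False using is_matching_unique[OF M(1), of "North i" "North (i - 1)" b] ab(1) i j ij by auto
      qed
      ultimately have "position n z < i - 1" using i1 z(3) by (auto simp: between_def)
      then have "r \<le> i - 1" using least[of z "North (i - 1)"] z(1) ij i1 by (simp add: insert_commute)
      then show False using ab(4) j ij by simp
    qed
    ultimately show thesis using that(3)[of i] ab(1) i j ij by simp
  next
    case False
    \<comment> \<open>No right end is at most \<open>m\<close>, so no two of the first
      \<open>m\<close> northern vertices are joined, and the vertices beyond are taken by vertical
      lines.\<close>
    have through: "\<exists>k. 1 \<le> k \<and> k \<le> m \<and> {North j, South k} \<in> fst d" if j: "1 \<le> j" "j \<le> m" for j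
    proof -
      have jn: "j \<le> n" using j m by simp
      then obtain z where z: "{North j, z} \<in> fst d" "z \<in> vertices n" "position n z \<noteq> j" using partner j by blast
      have zm: "m < position n z"
      proof (rule ccontr)
        assume "\<not> m < position n z"
        then show False
          using least[OF z(1)] least[of z "North j"] z(1,3) j False by (cases "position n z < j") (auto simp: insert_commute)
      qed
      consider k where "z = North k" "1 \<le> k" "k \<le> n" | k where "z = South k" "1 \<le> k" "k \<le> n"
        using z(2) by (auto simp: vertices_def)
      then show ?thesis
      proof cases
        case (1 k)
        then have "{North k, South k} \<in> fst d" "{North k, North j} \<in> fst d"
          using s zm z(1) by (auto simp: straight_beyond_def insert_commute)
        from is_matching_unique[OF M(1) this] show ?thesis by simp
      next
        case (2 k)
        have "k \<le> m"
        proof (rule ccontr)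
          assume "\<not> k \<le> m"
          then have "{South k, North k} \<in> fst d" "{South k, North j} \<in> fst d"
            using s 2 z(1) by (auto simp: straight_beyond_def insert_commute)
          from is_matching_unique[OF M(1) this] show False using \<open>\<not> k \<le> m\<close> j by simp
        qed
        then show ?thesis using 2 z(1) by blast
      qed
    qed
    then obtain f where f: "\<And>j. 1 \<le> j \<Longrightarrow> j \<le> m \<Longrightarrow> 1 \<le> f j \<and> f j \<le> m \<and> {North j, South (f j)} \<in> fst d"
      by metis
    have "inj_on f {1..m}"
    proof (rule inj_onI)
      fix j k assume jk: "j \<in> {1..m}" "k \<in> {1..m}" "f j = f k"
      then have "{South (f j), North j} \<in> fst d" "{South (f j), North k} \<in> fst d"
        using f[of j] f[of k] by (auto simp: insert_commute)
      from is_matching_unique[OF M(1) this] show "j = k" by simp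
    qed
    moreover have "f ` {1..m} \<subseteq> {1..m}" using f by auto
    ultimately have "f ` {1..m} = {1..m}" by (simp add: endo_inj_surj)
    then have "m \<in> f ` {1..m}" using m by simp
    then obtain j where j: "1 \<le> j" "j \<le> m" "f j = m" by auto
    \<comment> \<open>The southern vertex \<open>m\<close> is reached by some line, and any line
      further east would have to cross it.\<close>
    have "j = m"
    proof (rule ccontr)
      assume "j \<noteq> m"
      then have jm: "j < m" using j by simp
      have l: "{North j, South m} \<in> fst d" "{North m, South (f m)} \<in> fst d" "f m \<le> m" using f j m by metis+
      have "between n (North j) (South m) (North m)" using jm m by (simp add: between_def)
      then have "between n (North j) (South m) (South (f m))" by (rule N[OF l(1,2)])
      then show False using l(3) m jm by (auto simp: between_def)
    qed
    then have mm: "{North m, South m} \<in> fst d" using f j m by metis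
    show thesis
    proof (cases "{North m, South m} \<in> snd d")
      case True
      have "m = 1"
      proof (rule ccontr)
        assume "m \<noteq> 1"
        have l: "{North 1, South (f 1)} \<in> fst d" "f 1 \<le> m" "1 \<le> f 1" using f[of 1] m by auto
        have "\<not> between n (North 1) (South (f 1)) (North m)" by (rule X[OF l(1) True])
        then show False using l m \<open>m \<noteq> 1\<close> by (auto simp: between_def)
      qed
      then show thesis using that(2) True by simp
    next
      case False
      then show thesis using that(1) mm by simp
    qed
  qed
qed

lemma straight_beyond_surgery:
  assumes d: "d \<in> blob_diagrams n" and l: "{v, x} \<in> fst d" "{w, y} \<in> fst d" "{v, x} \<noteq> {w, y}"
    and s: "straight_beyond n m d" and out: "\<And>j. m < j \<Longrightarrow> j \<le> n \<Longrightarrow> North j \<notin> {v, x, w, y}"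
  shows "straight_beyond n m (surgery v x w y d)"
  unfolding straight_beyond_def
proof (intro allI impI)
  fix j assume j: "m < j" "j \<le> n"
  then have "{North j, South j} \<in> fst d" "{North j, South j} \<notin> snd d" using s by (auto simp: straight_beyond_def)
  then show "{North j, South j} \<in> fst (surgery v x w y d) - snd (surgery v x w y d)"
    using surgery_lines[OF blob_diagramsD(1)[OF d] l _ out[OF j]] by simp
qed

lemma partner_not_straight:
  assumes d: "d \<in> blob_diagrams n" and s: "straight_beyond n m d" and j: "m < j" "j \<le> n"
    and l: "{v, x} \<in> fst d" "v \<noteq> North j" "v \<noteq> South j"
  shows "x \<noteq> North j" "x \<noteq> South j"
proof -
  have "{North j, South j} \<in> fst d" "{South j, North j} \<in> fst d"
    using s j by (auto simp: straight_beyond_def insert_commute)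
  moreover have "{x, v} \<in> fst d" using l by (simp add: insert_commute)
  ultimately show "x \<noteq> North j" "x \<noteq> South j"
    using is_matching_unique[OF blob_diagramsD(1)[OF d]] l by metis+
qed

lemma straight_beyond_remove_blob: "straight_beyond n m d \<Longrightarrow> straight_beyond n m (fst d, snd d - B)"
  by (simp add: straight_beyond_def)

text \<open>Induction on the number of positions in use. A vertical last line is dropped and a blob
  at the western end is split off as e. An undecorated arc is slid east to the last two positions,
  where stripping one generator trades it for a vertical last line.\<close>

lemma word_of_blob_diagram:
  assumes "d \<in> blob_diagrams n" "straight_beyond n m d" "m \<le> n"
  shows "\<exists>w. set w \<subseteq> {..<m} \<and> word_diagram n w = d"
  using assms
proof (induction m arbitrary: d)
  case 0
  then show ?case using straight_beyond_0 by (intro exI[of _ "[]"]) simp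
next
  case (Suc k)
  note IH = Suc.IH
  have cup: "\<exists>w. set w \<subseteq> {..<Suc k} \<and> word_diagram n w = d"
    if "d \<in> blob_diagrams n" "straight_beyond n (Suc k) d" "1 \<le> i" "i \<le> k"
      "{North i, North (Suc i)} \<in> fst d" "{North i, North (Suc i)} \<notin> snd d" for i d
    using that
  proof (induction "k - i" arbitrary: i d)
    case 0
    note d = 0(2) and s = 0(3) and l = 0(6,7)
    have i: "i = k" "1 \<le> k" "Suc k \<le> n" using 0 Suc.prems by auto
    note M = blob_diagramsD(1,2)[OF d]
    let ?v = "North (Suc k)" and ?x = "North k" and ?w = "South (Suc k)"
    have "?w \<in> vertices n" using i by (simp add: South_vertex)
    then obtain y where y: "{?w, y} \<in> fst d" by (rule is_matching_partner[OF M(1)])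
    have vx: "{?v, ?x} \<in> fst d" "{?v, ?x} \<notin> snd d" using l i by (auto simp: insert_commute)
    have neq: "{?v, ?x} \<noteq> {?w, y}" by (auto simp: doubleton_eq_iff)
    have dis: "distinct [?v, ?x, ?w, y]" by (rule is_matching_surgery(2)[OF M(1) vx(1) y neq])
    \<comment> \<open>The inverse of the action of U_k: reconnecting the arc with the line at
      \<open>South (Suc k)\<close> makes position k + 1 vertical and returns \<open>d\<close> when
      U_k is applied.\<close>
    define d' where "d' = surgery ?v ?x ?w y d"
    \<comment> \<open>Round the eastern side, only ends of vertical lines lie between the two
      vertices, so the new line can be drawn without crossings and hides no blob.\<close>
    have btw: "\<exists>j. Suc k < j \<and> j \<le> n \<and> a \<in> {North j, South j}" if "a \<in> vertices n" "between n ?v ?w a" for a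
      using that i by (auto simp: vertices_def between_def)
    have gap: "between n ?v ?w b \<and> {a, b} \<notin> snd d" if ab: "{a, b} \<in> fst d" "between n ?v ?w a" for a b
    proof -
      obtain j where j: "Suc k < j" "j \<le> n" "a \<in> {North j, South j}"
        using btw[OF is_matching_vertices(1)[OF M(1) ab(1)] ab(2)] by blast
      then have jl: "{North j, South j} \<in> fst d" "{North j, South j} \<notin> snd d" using s by (auto simp: straight_beyond_def)
      have "{a, b} = {North j, South j}"
        using is_matching_eq[OF M(1) ab(1) jl(1), of a] j(3) by simp
      moreover have "between n ?v ?w (North j)" using j i by (simp add: between_def)
      moreover have "between n ?v ?w (South j)" using j i by (simp add: between_def) arith
      ultimately show ?thesis using jl by (auto simp: doubleton_eq_iff insert_commute)
    qed
    have d': "d' \<in> blob_diagrams n"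
      unfolding d'_def using gap M(2) by (intro surgery_blob_diagram[OF d vx(1) y neq]) blast+
    have "{?v, ?w} \<notin> fst d" using is_matching_unique[OF M(1) vx(1)] by blast
    then have vw: "{?v, ?w} \<in> fst d'" "{?v, ?w} \<notin> snd d'"
      using M(2) dis by (auto simp: d'_def surgery_def doubleton_eq_iff)
    have xy: "{?x, y} \<in> fst d'" by (simp add: d'_def surgery_def)
    have "straight_beyond n (Suc k) d'"
      unfolding d'_def
    proof (rule straight_beyond_surgery[OF d vx(1) y neq s])
      fix j assume j: "Suc k < j" "j \<le> n"
      have "y \<noteq> North j" by (rule partner_not_straight(1)[OF d s j y]) (use j in auto)
      then show "North j \<notin> {?v, ?x, ?w, y}" using j by auto
    qed
    then have "straight_beyond n k d'"
      using vw unfolding straight_beyond_def by (metis DiffI not_less_eq linorder_neqE_nat)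
    then obtain w where w: "set w \<subseteq> {..<k}" "word_diagram n w = d'" using IH[OF d'] i by auto
    have "concat_diagram n (U_diagram n k) d' = surgery ?x y ?v ?w d'"
    proof (rule U_action(1)[OF d' _ _ xy vw(1)])
      show "y \<noteq> ?v" using dis by auto
    qed (use i in auto)
    also have "\<dots> = surgery ?v ?w ?x y d'" by (rule surgery_commute)
    also have "\<dots> = d" unfolding d'_def by (rule surgery_surgery[OF M vx(1) y neq vx(2)])
    finally have "word_diagram n (k # w) = d" using w i by (simp add: generator_diagram_def)
    then show ?case using w by (intro exI[of _ "k # w"]) auto
  next
    case (Suc p)
    note d = Suc.prems(1) and s = Suc.prems(2) and l = Suc.prems(5,6)
    have i: "1 \<le> i" "i < n" "1 \<le> Suc i" "Suc i < n" "Suc i \<le> k" using Suc.prems Suc.hyps(2) \<open>Suc k \<le> n\<close> by auto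
    let ?d' = "concat_diagram n (U_diagram n (Suc i)) d"
    \<comment> \<open>U_{i+1} slides the arc one place east, and U_i slides it back, so
      \<open>d\<close> is U_i times a diagram with its arc closer to the last position.\<close>
    note UU = U_U_action(1,4,5)[OF d i(1-4) disjI2[OF refl] l]
    have g: "generator_diagram n (Suc i) = U_diagram n (Suc i)" by (simp add: generator_diagram_def)
    have d': "?d' \<in> blob_diagrams n" using generator_action_closed[OF d i(4)] by (simp add: g)
    have "North (Suc (Suc i)) \<in> vertices n" using i by (simp add: North_vertex)
    then obtain y where y: "{North (Suc (Suc i)), y} \<in> fst d"
      by (rule is_matching_partner[OF blob_diagramsD(1)[OF d]])
    have l': "{North (Suc i), North i} \<in> fst d" using l by (simp add: insert_commute)
    note act = U_action(1,4)[OF d i(3,4) l' y]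
    have "straight_beyond n (Suc k) ?d'"
      unfolding act(1)[simplified]
    proof (rule straight_beyond_surgery[OF d l' y _ s])
      show "{North (Suc i), North i} \<noteq> {North (Suc (Suc i)), y}" using act(2) by simp
      fix j assume j: "Suc k < j" "j \<le> n"
      have "y \<noteq> North j" by (rule partner_not_straight(1)[OF d s j y]) (use j i in auto)
      then show "North j \<notin> {North (Suc i), North i, North (Suc (Suc i)), y}" using j i by auto
    qed
    moreover have "p = k - Suc i" using Suc.hyps(2) by simp
    ultimately obtain w where w: "set w \<subseteq> {..<Suc k}" "word_diagram n w = ?d'"
      using Suc.hyps(1)[OF _ d' _ i(3,5) UU(2,3)] by blast
    then have "word_diagram n (i # w) = d" using UU(1) i by (simp add: generator_diagram_def)
    then show ?case using w i by (intro exI[of _ "i # w"]) auto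
  qed
  have n: "1 \<le> n" "Suc k \<le> n" using Suc.prems by auto
  have prepend_e: "\<exists>w. set w \<subseteq> {..<Suc k} \<and> word_diagram n w = d"
    if e: "{North 1, x} \<in> snd d" "\<exists>w. set w \<subseteq> {..<Suc k} \<and> word_diagram n w = (fst d, snd d - {{North 1, x}})" for x
  proof -
    obtain w where w: "set w \<subseteq> {..<Suc k}" "word_diagram n w = (fst d, snd d - {{North 1, x}})" using e(2) by blast
    have "{North 1, x} \<in> fst (fst d, snd d - {{North 1, x}})" using e(1) blob_diagramsD(2)[OF Suc.prems(1)] by auto
    from e_action(1)[OF remove_blob[OF Suc.prems(1)] n(1) this]
    have "word_diagram n (0 # w) = d" using w e(1) by (simp add: generator_diagram_def insert_absorb)
    then show ?thesis using w by (intro exI[of _ "0 # w"]) auto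
  qed
  have "1 \<le> Suc k" by simp
  from Suc.prems(1,2) this n(2) show ?case
  proof (cases rule: reducible_line)
    case 1
    then have "straight_beyond n k d"
      using Suc.prems(2) unfolding straight_beyond_def by (metis DiffI not_less_eq linorder_neqE_nat)
    then show ?thesis using IH[OF Suc.prems(1)] n by fastforce
  next
    case 2
    \<comment> \<open>All lines beyond the first are vertical and undecorated, so without the blob
      the diagram is the identity.\<close>
    let ?d = "(fst d, snd d - {{North 1, South 1}})"
    have l: "{North 1, South 1} \<in> fst d" using 2 blob_diagramsD(2)[OF Suc.prems(1)] by auto
    have "straight_beyond n 0 ?d"
      unfolding straight_beyond_def
    proof (intro allI impI)
      fix j assume j: "0 < j" "j \<le> n"
      show "{North j, South j} \<in> fst ?d - snd ?d"
      proof (cases "j = 1")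
        case False
        then have "{North j, South j} \<in> fst d - snd d"
          using Suc.prems(2) 2(1) j by (simp add: straight_beyond_def)
        then show ?thesis by simp
      qed (use l in simp)
    qed
    then have "\<exists>w. set w \<subseteq> {..<Suc k} \<and> word_diagram n w = ?d"
      using straight_beyond_0[OF remove_blob[OF Suc.prems(1)]] by (intro exI[of _ "[]"]) simp
    then show ?thesis using prepend_e 2 by simp
  next
    case (3 i)
    show ?thesis
    proof (cases "{North i, North (Suc i)} \<in> snd d")
      case False
      then show ?thesis using cup[OF Suc.prems(1,2)] 3 by simp
    next
      case True
      then have "i = 1" using 3 by simp
      have "\<exists>w. set w \<subseteq> {..<Suc k} \<and> word_diagram n w = (fst d, snd d - {{North i, North (Suc i)}})"
        by (rule cup[OF remove_blob[OF Suc.prems(1)] straight_beyond_remove_blob[OF Suc.prems(2)], of i]) (use 3 in auto)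
      then show ?thesis using prepend_e[of "North (Suc i)"] True \<open>i = 1\<close> by simp
    qed
  qed
qed

lemma blob_diagram_word:
  assumes "d \<in> blob_diagrams n"
  obtains w where "set w \<subseteq> {..<n}" "word_diagram n w = d"
  using word_of_blob_diagram[of d n n] assms by (auto simp: straight_beyond_def)

text \<open>Both factors are words in the generators, and for left multiplication by a generator
  planarity has been checked; so a planarity argument for general juxtapositions is avoided.\<close>

lemma concat_blob_diagram:
  assumes "d1 \<in> blob_diagrams n" "d2 \<in> blob_diagrams n"
  shows "concat_diagram n d1 d2 \<in> blob_diagrams n"
proof -
  obtain u v where uv: "set u \<subseteq> {..<n}" "word_diagram n u = d1" "set v \<subseteq> {..<n}" "word_diagram n v = d2"
    using blob_diagram_word assms by metis
  then have "concat_diagram n d1 d2 = word_diagram n (u @ v)" by (simp add: word_diagram_append)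
  then show ?thesis using word_blob_diagram[of "u @ v" n] uv by simp
qed

section \<open>Normal words and diagrams\<close>

lemma upt_append_Cons: "j < m \<Longrightarrow> [j..<m] @ v = j # ([Suc j..<m] @ v)"
  by (simp add: upt_conv_Cons)

lemma surgery_undecorated:
  assumes m: "is_matching V (fst d)" "snd d \<subseteq> fst d"
    and l: "{v, x} \<in> fst d" "{w, y} \<in> fst d" "{v, x} \<noteq> {w, y}"
  shows "{v, w} \<in> fst (surgery v x w y d)" "{v, w} \<notin> snd (surgery v x w y d)"
proof -
  have dis: "distinct [v, x, w, y]" by (rule is_matching_surgery(2)[OF m(1) l])
  then have "{v, w} \<notin> fst d" using is_matching_unique[OF m(1) l(1), of w] by auto
  then show "{v, w} \<in> fst (surgery v x w y d)" "{v, w} \<notin> snd (surgery v x w y d)"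
    using m(2) dis by (auto simp: surgery_def doubleton_eq_iff)
qed

text \<open>The other end of the line at the northern vertex \<open>j\<close> after applying the letters from \<open>j\<close> up to
  \<open>m - 1\<close> to a diagram that is straight from \<open>m\<close> on.\<close>

definition cup_end :: "nat \<Rightarrow> nat \<Rightarrow> vertex" where
  "cup_end m j = (if j = m then South m else North (Suc j))"

context
  fixes n m :: nat and v :: "nat list"
  assumes v: "set v \<subseteq> {..<m}" and mn: "m < n" and straight: "straight_beyond n m (word_diagram n v)"
begin

text \<open>The intermediate products while the letters of the leading block are applied from
  \<open>m\<close> down to \<open>j\<close>; \<open>tail (Suc m)\<close> is the diagram of
  \<open>v\<close> alone.\<close>

abbreviation tail where "tail j \<equiv> word_diagram n ([j..<Suc m] @ v)"

lemma tail_blob_diagram: "tail j \<in> blob_diagrams n"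
  using v mn by (intro word_blob_diagram) auto

lemma tail_step_args:
  assumes j: "1 \<le> j" "j \<le> m" and l: "{North (Suc j), cup_end (Suc m) (Suc j)} \<in> fst (tail (Suc j))"
  obtains x where "{North j, x} \<in> fst (tail (Suc j))" "x \<noteq> North (Suc j)"
    "{North j, x} \<noteq> {North (Suc j), cup_end (Suc m) (Suc j)}"
    "tail j = surgery (North (Suc j)) (cup_end (Suc m) (Suc j)) (North j) x (tail (Suc j))"
proof -
  note M = blob_diagramsD(1)[OF tail_blob_diagram[of "Suc j"]]
  have "North j \<in> vertices n" using j mn by (simp add: North_vertex)
  then obtain x where x: "{North j, x} \<in> fst (tail (Suc j))" by (rule is_matching_partner[OF M])
  have "x \<noteq> North (Suc j)"
  proof
    assume "x = North (Suc j)"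
    then have "{North (Suc j), North j} \<in> fst (tail (Suc j))" using x by (simp add: insert_commute)
    from is_matching_unique[OF M l this] show False by (auto simp: cup_end_def split: if_splits)
  qed
  have "1 \<le> j" "j < n" using j mn by auto
  note act = U_action(1,4)[OF tail_blob_diagram this x l \<open>x \<noteq> North (Suc j)\<close>]
  have "tail j = concat_diagram n (U_diagram n j) (tail (Suc j))"
    using j by (simp add: upt_append_Cons generator_diagram_def)
  then show thesis using that[OF x \<open>x \<noteq> North (Suc j)\<close>] act by (simp add: surgery_commute[of "North j"])
qed

text \<open>U_j creates an undecorated northern arc at j and destroys the one at j + 1. After a
  block only the arc at its start is left of all that were created, and arcs strictly west of it
  stem from \<open>v\<close>.\<close>

lemma tail_invariants:
  assumes j: "1 \<le> j" "j \<le> Suc m"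
  shows "straight_beyond n (Suc m) (tail j)"
    and "{North j, cup_end (Suc m) j} \<in> fst (tail j)"
    and "{North j, cup_end (Suc m) j} \<notin> snd (tail j)"
    and "Suc i < j \<Longrightarrow> {North i, North (Suc i)} \<in> fst (tail j) \<Longrightarrow> {North i, North (Suc i)} \<in> fst (word_diagram n v)"
proof -
  have "straight_beyond n (Suc m) (tail j) \<and> {North j, cup_end (Suc m) j} \<in> fst (tail j) \<and>
    {North j, cup_end (Suc m) j} \<notin> snd (tail j) \<and>
    (\<forall>i. Suc i < j \<longrightarrow> {North i, North (Suc i)} \<in> fst (tail j) \<longrightarrow> {North i, North (Suc i)} \<in> fst (word_diagram n v))"
    using j(2,1)
  proof (induction rule: inc_induct)
    case base
    then show ?case using straight mn by (simp add: straight_beyond_def cup_end_def)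
  next
    case (step j)
    have j: "1 \<le> j" "j \<le> m" using step by auto
    note IH = step.IH[OF le_SucI[OF j(1)]]
    note d = tail_blob_diagram[of "Suc j"] note M = blob_diagramsD(1,2)[OF d]
    let ?v = "North (Suc j)" and ?x = "cup_end (Suc m) (Suc j)"
    have vx: "{?v, ?x} \<in> fst (tail (Suc j))" using IH by blast
    then obtain x where x: "{North j, x} \<in> fst (tail (Suc j))"
        "{North j, x} \<noteq> {?v, ?x}" "tail j = surgery ?v ?x (North j) x (tail (Suc j))"
      by (rule tail_step_args[OF j])
    note neq = x(2)[symmetric]
    have dis: "distinct [?v, ?x, North j, x]" by (rule is_matching_surgery(2)[OF M(1) vx x(1) neq])
    have "straight_beyond n (Suc m) (tail j)"
      unfolding x(3)
    proof (rule straight_beyond_surgery[OF d vx x(1) neq])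
      show "straight_beyond n (Suc m) (tail (Suc j))" using IH by blast
      fix k assume k: "Suc m < k" "k \<le> n"
      have "x \<noteq> North k"
        by (rule partner_not_straight(1)[OF d _ k x(1)]) (use IH j k in auto)
      then show "North k \<notin> {?v, ?x, North j, x}" using j k by (auto simp: cup_end_def)
    qed
    moreover have "{North j, ?v} \<in> fst (tail j)" "{North j, ?v} \<notin> snd (tail j)"
      using surgery_undecorated[OF M vx x(1) neq] x(3) by (simp_all add: insert_commute)
    moreover have "cup_end (Suc m) j = ?v" using j by (simp add: cup_end_def)
    moreover have "{North i, North (Suc i)} \<in> fst (word_diagram n v)"
      if i: "Suc i < j" "{North i, North (Suc i)} \<in> fst (tail j)" for i
    proof -
      have "{North i, North (Suc i)} \<noteq> {?v, North j}" using i by (auto simp: doubleton_eq_iff)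
      \<comment> \<open>\<open>?x\<close> is a southern vertex or the northern vertex j + 2, hence
        not an end of an arc west of j.\<close>
      moreover have "{North i, North (Suc i)} \<noteq> {?x, x}"
        using i j by (auto simp: doubleton_eq_iff cup_end_def split: if_splits)
      ultimately have "{North i, North (Suc i)} \<in> fst (tail (Suc j))"
        using i(2) unfolding x(3) by (simp add: surgery_def)
      then show ?thesis using IH i(1) by auto
    qed
    ultimately show ?case by simp
  qed
  then show "straight_beyond n (Suc m) (tail j)"
    "{North j, cup_end (Suc m) j} \<in> fst (tail j)" "{North j, cup_end (Suc m) j} \<notin> snd (tail j)"
    "Suc i < j \<Longrightarrow> {North i, North (Suc i)} \<in> fst (tail j) \<Longrightarrow> {North i, North (Suc i)} \<in> fst (word_diagram n v)"
    by blast+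
qed

lemma tail_0:
  shows "tail 0 = (fst (tail 1), insert {North 1, cup_end (Suc m) 1} (snd (tail 1)))"
    and "concat_scalar n \<delta> \<gamma> \<delta>\<^sub>e (generator_diagram n 0) (tail 1) = (1::'c::comm_ring_1)"
proof -
  have n: "1 \<le> n" using mn by simp
  have l: "{North 1, cup_end (Suc m) 1} \<in> fst (tail 1)" "{North 1, cup_end (Suc m) 1} \<notin> snd (tail 1)"
    by (rule tail_invariants; simp)+
  show "tail 0 = (fst (tail 1), insert {North 1, cup_end (Suc m) 1} (snd (tail 1)))"
    using e_action(1)[OF tail_blob_diagram n l(1)] by (simp add: upt_append_Cons generator_diagram_def)
  show "concat_scalar n \<delta> \<gamma> \<delta>\<^sub>e (generator_diagram n 0) (tail 1) = (1::'c)"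
    using e_action(2)[OF tail_blob_diagram n l(1), of \<delta> \<gamma> \<delta>\<^sub>e] l(2) by (simp add: generator_diagram_def)
qed

text \<open>The line at j + 1 is undecorated and does not return to j, so neither a double blob nor
  a loop can arise.\<close>

lemma tail_scalar:
  assumes "j \<le> m"
  shows "concat_scalar n \<delta> \<gamma> \<delta>\<^sub>e (generator_diagram n j) (tail (Suc j)) = (1::'c::comm_ring_1)"
proof (cases "j = 0")
  case True
  then show ?thesis using tail_0(2)[of \<delta> \<gamma> \<delta>\<^sub>e] by simp
next
  case False
  then have j: "1 \<le> j" "j \<le> m" "j < n" "1 \<le> Suc j" "Suc j \<le> Suc m" using assms mn by auto
  note l = tail_invariants(2,3)[OF j(4,5)]
  obtain x where "{North j, x} \<in> fst (tail (Suc j))" "x \<noteq> North (Suc j)"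
    by (rule tail_step_args[OF j(1,2) l(1)])
  from U_action(2)[OF tail_blob_diagram j(1,3) this(1) l(1) this(2), of \<delta> \<gamma> \<delta>\<^sub>e] l(2) j(1)
  show ?thesis by (simp add: generator_diagram_def)
qed

end

text \<open>Each letter acts by a surgery that can be undone. The only datum needed for this is
  \<open>x\<close>, and it is the partner of \<open>cup_end\<close> in the result, hence determined
  by the common diagram.\<close>

lemma tail_inj:
  assumes v: "set v \<subseteq> {..<m}" "straight_beyond n m (word_diagram n v)"
    and v': "set v' \<subseteq> {..<m}" "straight_beyond n m (word_diagram n v')" and mn: "m < n"
    and eq: "word_diagram n ([j..<Suc m] @ v) = word_diagram n ([j..<Suc m] @ v')" and j: "j \<le> Suc m"
  shows "word_diagram n v = word_diagram n v'"
  using j eq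
proof (induction rule: inc_induct)
  case base
  then show ?case by simp
next
  case (step j)
  let ?d = "\<lambda>v j. word_diagram n ([j..<Suc m] @ v)"
  have "?d v (Suc j) = ?d v' (Suc j)"
  proof (cases "j = 0")
    case True
    \<comment> \<open>The letter e puts a blob on a line that had none, so deleting this blob
      recovers the previous diagram.\<close>
    note * = tail_0(1)[OF v(1) mn v(2)] tail_0(1)[OF v'(1) mn v'(2)]
    have "{North 1, cup_end (Suc m) 1} \<notin> snd (?d v 1)" "{North 1, cup_end (Suc m) 1} \<notin> snd (?d v' 1)"
      using tail_invariants(3)[OF v(1) mn v(2), of 1] tail_invariants(3)[OF v'(1) mn v'(2), of 1] by simp_all
    moreover have "fst (?d v 1) = fst (?d v' 1) \<and>
      insert {North 1, cup_end (Suc m) 1} (snd (?d v 1)) = insert {North 1, cup_end (Suc m) 1} (snd (?d v' 1))"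
      using step.prems unfolding True * by simp
    ultimately have "?d v 1 = ?d v' 1"
      by (intro prod_eqI) (auto dest: insert_ident)
    then show ?thesis by (simp add: True)
  next
    case False
    then have j: "1 \<le> j" "j \<le> m" "1 \<le> Suc j" "Suc j \<le> Suc m" using step.hyps by auto
    let ?v = "North (Suc j)" and ?x = "cup_end (Suc m) (Suc j)"
    have inverse: "\<exists>x. {?x, x} \<in> fst (?d u j) \<and> surgery ?v (North j) ?x x (?d u j) = ?d u (Suc j)"
      if u: "set u \<subseteq> {..<m}" "straight_beyond n m (word_diagram n u)" for u
    proof -
      note d = tail_blob_diagram[OF u(1) mn u(2), of "Suc j"] note M = blob_diagramsD(1,2)[OF d]
      note l = tail_invariants(2,3)[OF u(1) mn u(2) j(3,4)]
      obtain x where x: "{North j, x} \<in> fst (?d u (Suc j))"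
        "{North j, x} \<noteq> {?v, ?x}" "?d u j = surgery ?v ?x (North j) x (?d u (Suc j))"
        by (rule tail_step_args[OF u(1) mn u(2) j(1,2) l(1)])
      have "surgery ?v (North j) ?x x (?d u j) = ?d u (Suc j)"
        unfolding x(3) by (rule surgery_surgery[OF M l(1) x(1) x(2)[symmetric] l(2)])
      moreover have "{?x, x} \<in> fst (?d u j)" unfolding x(3) by (simp add: surgery_def)
      ultimately show ?thesis by blast
    qed
    obtain x x' where "{?x, x} \<in> fst (?d v j)" "surgery ?v (North j) ?x x (?d v j) = ?d v (Suc j)"
      "{?x, x'} \<in> fst (?d v j)" "surgery ?v (North j) ?x x' (?d v j) = ?d v' (Suc j)"
      using inverse[OF v] inverse[OF v'] step.prems by auto
    moreover from this have "x = x'"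
      using is_matching_unique[OF blob_diagramsD(1)[OF tail_blob_diagram[OF v(1) mn v(2)]]] by blast
    ultimately show ?thesis by simp
  qed
  then show ?case by (rule step.IH)
qed

text \<open>The second to fourth claims recognise \<open>a\<close> in the diagram: it is the
  position of the westernmost arc between northern neighbours, or \<open>m\<close> if there is none
  among the first \<open>m\<close>, while 0 stands for a decorated line at 1. The last two are the
  right unit law, proved here because along a word it follows from associativity.\<close>

lemma normal_word_invariants:
  assumes "normal_word m a w" "m \<le> n"
  shows "straight_beyond n m (word_diagram n w)"
    and "1 \<le> i \<Longrightarrow> i < a \<Longrightarrow> {North i, North (Suc i)} \<notin> fst (word_diagram n w)"
    and "1 \<le> a \<Longrightarrow> {North a, cup_end m a} \<in> fst (word_diagram n w) - snd (word_diagram n w)"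
    and "a = 0 \<Longrightarrow> 1 \<le> m \<Longrightarrow> {North 1, cup_end m 1} \<in> fst (word_diagram n w) \<inter> snd (word_diagram n w)"
    and "word_scalar n \<delta> \<gamma> \<delta>\<^sub>e w = (1::'c::comm_ring_1)"
    and "concat_diagram n (word_diagram n w) (identity_diagram n) = word_diagram n w"
    and "concat_scalar n \<delta> \<gamma> \<delta>\<^sub>e (word_diagram n w) (identity_diagram n) = (1::'c)"
proof -
  let ?d = "word_diagram n" and ?s = "word_scalar n \<delta> \<gamma> \<delta>\<^sub>e" and ?c = "concat_scalar n \<delta> \<gamma> \<delta>\<^sub>e"
  let ?P = "\<lambda>w. ?s w = (1::'c) \<and> concat_diagram n (?d w) (identity_diagram n) = ?d w \<and> ?c (?d w) (identity_diagram n) = 1"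
  have "straight_beyond n m (?d w) \<and> (\<forall>i. 1 \<le> i \<longrightarrow> i < a \<longrightarrow> {North i, North (Suc i)} \<notin> fst (?d w)) \<and>
    (1 \<le> a \<longrightarrow> {North a, cup_end m a} \<in> fst (?d w) - snd (?d w)) \<and>
    (a = 0 \<longrightarrow> 1 \<le> m \<longrightarrow> {North 1, cup_end m 1} \<in> fst (?d w) \<inter> snd (?d w)) \<and> ?P w"
    using assms
  proof (induction rule: normal_word.induct)
    case empty
    then show ?case
      using identity_lines_mem concat_identity_left[OF partition_diagram_identity]
        concat_scalar_identity_left[OF partition_diagram_identity, of n \<delta> \<gamma> \<delta>\<^sub>e]
      by (simp add: straight_beyond_def identity_diagram_eq)
  next
    case (block m a v b)
    have mn: "m < n" using block.prems by simp
    have v: "set v \<subseteq> {..<m}" by (rule normal_word_letters[OF block.hyps(1)])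
    have IH: "straight_beyond n m (?d v)" "\<And>i. 1 \<le> i \<Longrightarrow> i < a \<Longrightarrow> {North i, North (Suc i)} \<notin> fst (?d v)" "?P v"
      using block.IH mn by auto
    let ?t = "\<lambda>j. [j..<Suc m] @ v"
    note inv = tail_invariants[OF v mn IH(1)] and t0 = tail_0(1)[OF v mn IH(1)]
    have P: "?P (?t b)"
      using block.hyps(2)
    proof (induction rule: inc_induct)
      case base
      then show ?case using IH(3) by simp
    next
      case (step j)
      then have j: "j \<le> m" "j < n" using mn by auto
      note s = tail_scalar[OF v mn IH(1) j(1), of \<delta> \<gamma> \<delta>\<^sub>e]
      have p: "partition_diagram n (?d (?t (Suc j)))"
        using v mn by (intro partition_word_diagram) auto
      note as = concat_diagram_assoc[OF partition_diagram_generator[OF j(2)] p partition_diagram_identity]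
        concat_scalar_assoc[OF partition_diagram_generator[OF j(2)] p partition_diagram_identity, of \<delta> \<gamma> \<delta>\<^sub>e]
      have "?t j = j # ?t (Suc j)" using j by (simp add: upt_append_Cons)
      then show ?case using step.IH s as by simp
    qed
    have "straight_beyond n (Suc m) (?d (?t b))"
    proof (cases "b = 0")
      case True
      have "straight_beyond n (Suc m) (?d (?t 1))" by (rule inv(1)) auto
      moreover have "{North j, South j} \<noteq> {North 1, cup_end (Suc m) 1}" if "Suc m < j" for j
        using that by (auto simp: doubleton_eq_iff)
      ultimately show ?thesis unfolding True t0 by (auto simp: straight_beyond_def)
    next
      case False
      then show ?thesis using inv(1)[of b] block.hyps(2) by simp
    qed
    moreover have "{North i, North (Suc i)} \<notin> fst (?d (?t b))" if i: "1 \<le> i" "i < b" for i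
    proof
      assume l: "{North i, North (Suc i)} \<in> fst (?d (?t b))"
      show False
      proof (cases "Suc i = b")
        case True
        have "{North b, North i} \<in> fst (?d (?t b))" using l True by (simp add: insert_commute)
        moreover have "{North b, cup_end (Suc m) b} \<in> fst (?d (?t b))" using i block.hyps(2) by (intro inv(2)) auto
        ultimately have "North i = cup_end (Suc m) b"
          using is_matching_unique[OF blob_diagramsD(1)[OF tail_blob_diagram[OF v mn IH(1)]]] by blast
        then show False using True by (auto simp: cup_end_def split: if_splits)
      next
        case False
        then have "{North i, North (Suc i)} \<in> fst (?d v)"
          using inv(4)[of b i] l i block.hyps(2) by simp
        \<comment> \<open>Here the admissibility of \<open>b\<close> enters: i < b - 1 and i >= 1
          force i < a, where the diagram of \<open>v\<close> has no arc.\<close>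
        moreover have "i < a" using i False block.hyps(3) by (auto simp: max_def split: if_splits)
        ultimately show False using IH(2) i by blast
      qed
    qed
    moreover have "{North b, cup_end (Suc m) b} \<in> fst (?d (?t b)) - snd (?d (?t b))" if "1 \<le> b"
      using inv(2,3)[of b] that block.hyps(2) by simp
    moreover have "{North 1, cup_end (Suc m) 1} \<in> fst (?d (?t b)) \<inter> snd (?d (?t b))" if "b = 0"
      unfolding that t0 using inv(2)[of 1] by simp
    ultimately show ?case using P by blast
  qed
  then show "straight_beyond n m (word_diagram n w)"
    "1 \<le> i \<Longrightarrow> i < a \<Longrightarrow> {North i, North (Suc i)} \<notin> fst (word_diagram n w)"
    "1 \<le> a \<Longrightarrow> {North a, cup_end m a} \<in> fst (word_diagram n w) - snd (word_diagram n w)"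
    "a = 0 \<Longrightarrow> 1 \<le> m \<Longrightarrow> {North 1, cup_end m 1} \<in> fst (word_diagram n w) \<inter> snd (word_diagram n w)"
    "word_scalar n \<delta> \<gamma> \<delta>\<^sub>e w = (1::'c)"
    "concat_diagram n (word_diagram n w) (identity_diagram n) = word_diagram n w"
    "concat_scalar n \<delta> \<gamma> \<delta>\<^sub>e (word_diagram n w) (identity_diagram n) = (1::'c)"
    by blast+
qed

text \<open>If a < a', the arc at \<open>a\<close> of the first diagram is ruled out for the second
  one; for a = 0 and a' = 1 the lines agree but the blob tells them apart.\<close>

lemma normal_word_index_le:
  assumes "normal_word m a w" "normal_word m a' w'" "m \<le> n" "word_diagram n w = word_diagram n w'"
  shows "a' \<le> a"
proof (rule ccontr)
  assume "\<not> a' \<le> a"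
  then have lt: "a < a'" "a' \<le> m" "1 \<le> a'" "1 \<le> m" using normal_word_le[OF assms(2)] by auto
  note i = normal_word_invariants(2-4)[OF assms(1,3)] and i' = normal_word_invariants(2-4)[OF assms(2,3)]
  show False
  proof (cases "a = 0")
    case True
    have "{North 1, cup_end m 1} \<in> fst (word_diagram n w') \<inter> snd (word_diagram n w')"
      using i(3)[OF True lt(4)] assms(4) by simp
    then show False
      using i'(1)[of 1] i'(2)[OF lt(3)] lt by (cases "a' = 1") (auto simp: cup_end_def)
  next
    case False
    then show False using i(2) i'(1)[of a] lt assms(4) by (auto simp: cup_end_def)
  qed
qed

lemma normal_word_diagram_inj:
  assumes "normal_word m a w" "normal_word m a' w'" "m \<le> n" "word_diagram n w = word_diagram n w'"
  shows "w = w'"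
  using assms
proof (induction arbitrary: a' w' rule: normal_word.induct)
  case empty
  then show ?case by (auto elim: normal_word.cases)
next
  case (block m a v b)
  have w: "normal_word (Suc m) b ([b..<Suc m] @ v)" by (rule normal_word.block) (use block.hyps in auto)
  have "a' = b"
    using normal_word_index_le[OF w block.prems(1-3)] normal_word_index_le[OF block.prems(1) w block.prems(2) block.prems(3)[symmetric]]
    by simp
  with block.prems(1) obtain c v' where v': "normal_word m c v'" "w' = [b..<Suc m] @ v'"
    by (auto elim: normal_word_Suc)
  have m: "m \<le> n" "m < n" using block.prems(2) by auto
  have "word_diagram n v = word_diagram n v'"
    using block.prems(3) unfolding v'(2)
    by (rule tail_inj[OF normal_word_letters normal_word_invariants(1) normal_word_letters normal_word_invariants(1), rotated -2])
      (use block.hyps v' m in auto)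
  then show ?case using block.IH[OF v'(1) m(1)] v'(2) by simp
qed

lemma blob_diagram_normal_word:
  assumes "d \<in> blob_diagrams n"
  obtains a w where "normal_word n a w" "word_diagram n w = d"
proof -
  obtain u where u: "set u \<subseteq> {..<n}" "word_diagram n u = d" using blob_diagram_word[OF assms] .
  \<comment> \<open>Only the diagram matters, so the parameters of the reduction may be chosen
    freely.\<close>
  obtain c a v where v: "normal_word n a v" "reduces 1 1 (1::int) n u c v"
    using red_normal_word[OF u(1)] by blast
  then show thesis using that word_diagram_reduces[OF v(2) u(1)] u(2) by metis
qed

section \<open>Algebras given by structure constants\<close>

definition linear_extension :: "('b \<Rightarrow> 'c \<Rightarrow> 'm) \<Rightarrow> ('b \<Rightarrow>\<^sub>0 'c::zero) \<Rightarrow> 'm::comm_monoid_add" where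
  "linear_extension t f = (\<Sum>b \<in> Poly_Mapping.keys f. t b (Poly_Mapping.lookup f b))"

lemma linear_extension_zero [simp]: "linear_extension t 0 = 0"
  by (simp add: linear_extension_def)

lemma linear_extension_add:
  assumes "\<And>b. t b 0 = 0" "\<And>b x y. t b (x + y) = t b x + t b y"
  shows "linear_extension t (f + g) = linear_extension t f + linear_extension t g"
  unfolding linear_extension_def by (rule setsum_keys_plus_distrib) (simp_all add: assms)

lemma linear_extension_single:
  assumes "\<And>b. t b 0 = 0"
  shows "linear_extension t (Poly_Mapping.single b x) = t b x"
  by (cases "x = 0") (simp_all add: linear_extension_def assms)

lemma linear_extension_add_fun:
  "linear_extension (\<lambda>b x. s b x + t b x) f = linear_extension s f + linear_extension t f"
  by (simp add: linear_extension_def sum.distrib)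

lemma linear_extension_zero_fun: "linear_extension (\<lambda>b x. 0) f = 0"
  by (simp add: linear_extension_def)

lemma linear_extension_diff:
  fixes t :: "'b \<Rightarrow> 'c::ab_group_add \<Rightarrow> 'm::ab_group_add"
  assumes "\<And>b. t b 0 = 0" "\<And>b x y. t b (x + y) = t b x + t b y"
  shows "linear_extension t (f - g) = linear_extension t f - linear_extension t g"
  using linear_extension_add[of t "f - g" g] assms by (simp add: algebra_simps)

lemma poly_mapping_expand: "f = (\<Sum>b \<in> Poly_Mapping.keys f. Poly_Mapping.single b (Poly_Mapping.lookup f b))"
  by (rule poly_mapping_eqI) (simp add: lookup_sum lookup_single when_def in_keys_iff)

lemma poly_mapping_induct [consumes 1, case_names zero single add]:
  fixes f :: "'b \<Rightarrow>\<^sub>0 'c::comm_monoid_add"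
  assumes "Poly_Mapping.keys f \<subseteq> B" and "P 0" and "\<And>b x. b \<in> B \<Longrightarrow> P (Poly_Mapping.single b x)"
    and "\<And>f g. Poly_Mapping.keys f \<subseteq> B \<Longrightarrow> Poly_Mapping.keys g \<subseteq> B \<Longrightarrow> P f \<Longrightarrow> P g \<Longrightarrow> P (f + g)"
  shows "P f"
proof -
  let ?s = "\<lambda>b. Poly_Mapping.single b (Poly_Mapping.lookup f b)"
  have "Poly_Mapping.keys (\<Sum>b \<in> A. ?s b) \<subseteq> B \<and> P (\<Sum>b \<in> A. ?s b)" if "finite A" "A \<subseteq> B" for A
    using that
  proof (induction A rule: finite_induct)
    case (insert a A)
    then have *: "Poly_Mapping.keys (?s a) \<subseteq> B" "P (?s a)" "Poly_Mapping.keys (\<Sum>b \<in> A. ?s b) \<subseteq> B" "P (\<Sum>b \<in> A. ?s b)"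
      using assms(3)[of a] by auto
    then have "Poly_Mapping.keys (?s a + (\<Sum>b \<in> A. ?s b)) \<subseteq> B"
      using keys_add[of "?s a" "\<Sum>b \<in> A. ?s b"] by blast
    then show ?case using assms(4)[OF *(1,3,2,4)] insert.hyps by simp
  qed (simp add: assms(2))
  from this[of "Poly_Mapping.keys f"] assms(1) show ?thesis by (simp add: poly_mapping_expand[symmetric])
qed

lemma lookup_scale [simp]: "Poly_Mapping.lookup (Poly_Mapping.map ((*) c) f) b = c * (Poly_Mapping.lookup f b :: 'c::comm_ring_1)"
  by (simp add: Poly_Mapping.map.rep_eq when_def)

lemma scale_single: "Poly_Mapping.map ((*) c) (Poly_Mapping.single b (x::'c::comm_ring_1)) = Poly_Mapping.single b (c * x)"
  by (rule poly_mapping_eqI) (simp add: lookup_single when_def)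

lemma scale_add: "Poly_Mapping.map ((*) c) (f + g) = Poly_Mapping.map ((*) (c::'c::comm_ring_1)) f + Poly_Mapping.map ((*) c) g"
  by (rule poly_mapping_eqI) (simp add: lookup_add distrib_left)

lemma scale_zero [simp]: "Poly_Mapping.map ((*) (c::'c::comm_ring_1)) 0 = 0" "Poly_Mapping.map ((*) (0::'c)) f = 0"
  by (rule poly_mapping_eqI; simp)+

lemma scale_add_left: "Poly_Mapping.map ((*) (c + d)) f = Poly_Mapping.map ((*) (c::'c::comm_ring_1)) f + Poly_Mapping.map ((*) d) f"
  by (rule poly_mapping_eqI) (simp add: lookup_add distrib_right)

lemma scale_scale: "Poly_Mapping.map ((*) c) (Poly_Mapping.map ((*) d) f) = Poly_Mapping.map ((*) (c * d :: 'c::comm_ring_1)) f"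
  by (rule poly_mapping_eqI) (simp add: mult.assoc)

lemma scale_one: "Poly_Mapping.map ((*) (1::'c::comm_ring_1)) f = f"
  by (rule poly_mapping_eqI) simp

lemma keys_scale: "Poly_Mapping.keys (Poly_Mapping.map ((*) (c::'c::comm_ring_1)) f) \<subseteq> Poly_Mapping.keys f"
  by (auto simp: in_keys_iff)

lemma keys_uminus [simp]: "Poly_Mapping.keys (- f) = Poly_Mapping.keys (f :: 'b \<Rightarrow>\<^sub>0 'c::ab_group_add)"
  by (auto simp: in_keys_iff)

lemma scalar_ring_simps [simp]:
  "carrier scalar_ring = UNIV" "mult scalar_ring = (*)" "one scalar_ring = 1" "zero scalar_ring = 0" "add scalar_ring = (+)"
  by (simp_all add: scalar_ring_def)

lemma cring_scalar_ring: "cring (scalar_ring :: 'c::comm_ring_1 ring)"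
proof (rule cringI)
  show "abelian_group (scalar_ring :: 'c ring)"
    by (rule abelian_groupI) (auto simp: algebra_simps intro: exI[of _ "- _"])
  show "comm_monoid (scalar_ring :: 'c ring)"
    by (rule comm_monoidI) (auto simp: algebra_simps)
qed (auto simp: algebra_simps)

lemma based_algebra_simps [simp]:
  "carrier (based_algebra B coef prd u) = {f. Poly_Mapping.keys f \<subseteq> B}"
  "one (based_algebra B coef prd u) = Poly_Mapping.single u 1"
  "zero (based_algebra B coef prd u) = 0"
  "add (based_algebra B coef prd u) = (+)"
  "smult (based_algebra B coef prd u) c f = Poly_Mapping.map ((*) c) f"
  by (simp_all add: based_algebra_def)

lemma based_mult_eq:
  "f \<otimes>\<^bsub>based_algebra B coef prd u\<^esub> g =
    linear_extension (\<lambda>b x. linear_extension (\<lambda>b' y. Poly_Mapping.single (prd b b') (x * y * coef b b')) g) f"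
  by (simp add: based_algebra_def linear_extension_def)

lemma based_mult_single:
  "Poly_Mapping.single b x \<otimes>\<^bsub>based_algebra B coef prd u\<^esub> Poly_Mapping.single b' y =
    Poly_Mapping.single (prd b b') (x * y * coef b b')"
  unfolding based_mult_eq
  by (subst linear_extension_single; (subst linear_extension_single)?; simp add: linear_extension_zero_fun)

lemma based_mult_add_left:
  "(f + g) \<otimes>\<^bsub>based_algebra B coef prd u\<^esub> k =
    f \<otimes>\<^bsub>based_algebra B coef prd u\<^esub> k + g \<otimes>\<^bsub>based_algebra B coef prd u\<^esub> k"
  unfolding based_mult_eq
  by (rule linear_extension_add)
    (simp_all add: linear_extension_zero_fun distrib_right single_add linear_extension_add_fun)

lemma based_mult_add_right:
  "k \<otimes>\<^bsub>based_algebra B coef prd u\<^esub> (f + g) =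
    k \<otimes>\<^bsub>based_algebra B coef prd u\<^esub> f + k \<otimes>\<^bsub>based_algebra B coef prd u\<^esub> g"
  unfolding based_mult_eq
  by (subst linear_extension_add) (simp_all add: distrib_left distrib_right single_add linear_extension_add_fun)

lemma based_mult_zero [simp]:
  "0 \<otimes>\<^bsub>based_algebra B coef prd u\<^esub> k = 0" "k \<otimes>\<^bsub>based_algebra B coef prd u\<^esub> 0 = 0"
  by (simp_all add: based_mult_eq linear_extension_zero_fun)

lemma based_algebra_induct [consumes 1, case_names zero single add]:
  assumes "f \<in> carrier (based_algebra B coef prd u)" and "P 0" and "\<And>b x. b \<in> B \<Longrightarrow> P (Poly_Mapping.single b x)"
    and "\<And>f g. P f \<Longrightarrow> P g \<Longrightarrow> P (f + g)"
  shows "P f"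
  using assms(1) by (intro poly_mapping_induct[of f B P] assms) auto

text \<open>A monoid algebra twisted by a cocycle: \<open>coef_assoc\<close> is the 2-cocycle
  identity for values that need not be invertible. The free algebra and the pair ring have the
  constant cocycle 1.\<close>

locale structure_constants =
  fixes B :: "'b set" and coef :: "'b \<Rightarrow> 'b \<Rightarrow> 'c::comm_ring_1" and prd :: "'b \<Rightarrow> 'b \<Rightarrow> 'b" and u :: 'b
  assumes prd_closed: "\<And>b b'. b \<in> B \<Longrightarrow> b' \<in> B \<Longrightarrow> prd b b' \<in> B"
    and unit_closed: "u \<in> B"
    and prd_assoc: "\<And>a b c. a \<in> B \<Longrightarrow> b \<in> B \<Longrightarrow> c \<in> B \<Longrightarrow> prd (prd a b) c = prd a (prd b c)"
    and coef_assoc: "\<And>a b c. a \<in> B \<Longrightarrow> b \<in> B \<Longrightarrow> c \<in> B \<Longrightarrow>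
      coef a b * coef (prd a b) c = coef b c * coef a (prd b c)"
    and unit_left: "\<And>b. b \<in> B \<Longrightarrow> prd u b = b" "\<And>b. b \<in> B \<Longrightarrow> coef u b = 1"
    and unit_right: "\<And>b. b \<in> B \<Longrightarrow> prd b u = b" "\<And>b. b \<in> B \<Longrightarrow> coef b u = 1"
begin

abbreviation "A \<equiv> based_algebra B coef prd u"

lemma mult_closed: "f \<in> carrier A \<Longrightarrow> g \<in> carrier A \<Longrightarrow> f \<otimes>\<^bsub>A\<^esub> g \<in> carrier A"
proof (induction f rule: based_algebra_induct)
  case (single b x)
  from single(2,1) show ?case
  proof (induction g rule: based_algebra_induct)
    case (single b' y)
    then show ?case using prd_closed by (simp add: based_mult_single)
  next
    case (add f g)
    then show ?case using keys_add by (fastforce simp: based_mult_add_right)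
  qed simp
next
  case (add f g)
  then show ?case using keys_add by (fastforce simp: based_mult_add_left)
qed simp

lemma mult_assoc:
  assumes "f \<in> carrier A" "g \<in> carrier A" "k \<in> carrier A"
  shows "f \<otimes>\<^bsub>A\<^esub> g \<otimes>\<^bsub>A\<^esub> k = f \<otimes>\<^bsub>A\<^esub> (g \<otimes>\<^bsub>A\<^esub> k)"
  using assms(1)
proof (induction f rule: based_algebra_induct)
  case (single a x)
  show ?case using assms(2)
  proof (induction g rule: based_algebra_induct)
    case (single b y)
    show ?case using assms(3)
    proof (induction k rule: based_algebra_induct)
      case (single c z)
      have "x * y * coef a b * z * coef (prd a b) c = x * y * z * (coef a b * coef (prd a b) c)"
        by (simp add: mult_ac)
      also have "\<dots> = x * (y * z * coef b c) * coef a (prd b c)"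
        using coef_assoc[OF \<open>a \<in> B\<close> \<open>b \<in> B\<close> \<open>c \<in> B\<close>] by (simp add: mult_ac)
      finally show ?case
        using prd_assoc[OF \<open>a \<in> B\<close> \<open>b \<in> B\<close> \<open>c \<in> B\<close>] by (simp add: based_mult_single)
    qed (simp_all add: based_mult_add_left based_mult_add_right)
  qed (simp_all add: based_mult_add_left based_mult_add_right)
qed (simp_all add: based_mult_add_left based_mult_add_right)

lemma mult_one:
  assumes "f \<in> carrier A"
  shows "\<one>\<^bsub>A\<^esub> \<otimes>\<^bsub>A\<^esub> f = f" "f \<otimes>\<^bsub>A\<^esub> \<one>\<^bsub>A\<^esub> = f"
proof -
  have "\<one>\<^bsub>A\<^esub> \<otimes>\<^bsub>A\<^esub> f = f \<and> f \<otimes>\<^bsub>A\<^esub> \<one>\<^bsub>A\<^esub> = f"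
    using assms
    by (induction f rule: based_algebra_induct)
      (simp_all add: based_mult_single based_mult_add_left based_mult_add_right unit_left unit_right)
  then show "\<one>\<^bsub>A\<^esub> \<otimes>\<^bsub>A\<^esub> f = f" "f \<otimes>\<^bsub>A\<^esub> \<one>\<^bsub>A\<^esub> = f" by auto
qed

lemma smult_mult:
  assumes "f \<in> carrier A" "g \<in> carrier A"
  shows "(c \<odot>\<^bsub>A\<^esub> f) \<otimes>\<^bsub>A\<^esub> g = c \<odot>\<^bsub>A\<^esub> (f \<otimes>\<^bsub>A\<^esub> g)" "f \<otimes>\<^bsub>A\<^esub> (c \<odot>\<^bsub>A\<^esub> g) = c \<odot>\<^bsub>A\<^esub> (f \<otimes>\<^bsub>A\<^esub> g)"
proof -
  have "(c \<odot>\<^bsub>A\<^esub> f) \<otimes>\<^bsub>A\<^esub> g = c \<odot>\<^bsub>A\<^esub> (f \<otimes>\<^bsub>A\<^esub> g) \<and> f \<otimes>\<^bsub>A\<^esub> (c \<odot>\<^bsub>A\<^esub> g) = c \<odot>\<^bsub>A\<^esub> (f \<otimes>\<^bsub>A\<^esub> g)"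
    using assms(1)
  proof (induction f rule: based_algebra_induct)
    case (single b x)
    show ?case using assms(2)
      by (induction g rule: based_algebra_induct)
        (simp_all add: based_mult_single scale_single scale_add based_mult_add_right mult_ac)
  qed (simp_all add: scale_add based_mult_add_left)
  then show "(c \<odot>\<^bsub>A\<^esub> f) \<otimes>\<^bsub>A\<^esub> g = c \<odot>\<^bsub>A\<^esub> (f \<otimes>\<^bsub>A\<^esub> g)" "f \<otimes>\<^bsub>A\<^esub> (c \<odot>\<^bsub>A\<^esub> g) = c \<odot>\<^bsub>A\<^esub> (f \<otimes>\<^bsub>A\<^esub> g)" by auto
qed

lemma abelian_group: "abelian_group A"
proof (rule abelian_groupI)
  show "x \<oplus>\<^bsub>A\<^esub> y \<in> carrier A" if "x \<in> carrier A" "y \<in> carrier A" for x y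
    using that keys_add[of x y] by auto
  show "\<exists>y \<in> carrier A. y \<oplus>\<^bsub>A\<^esub> x = \<zero>\<^bsub>A\<^esub>" if "x \<in> carrier A" for x
    using that by (intro bexI[of _ "- x"]) auto
qed (auto simp: add_ac)

lemma ring: "ring A"
proof (rule ringI)
  show "monoid A"
    by (rule monoidI) (use mult_closed mult_assoc mult_one unit_closed in auto)
qed (use abelian_group in \<open>auto simp: based_mult_add_left based_mult_add_right\<close>)

lemma unital_algebra: "unital_algebra scalar_ring A"
proof -
  have "Module.module scalar_ring A"
  proof (rule moduleI)
    show "c \<odot>\<^bsub>A\<^esub> f \<in> carrier A" if "f \<in> carrier A" for c f
      using that keys_scale[of c f] by auto
  qed (auto simp: cring_scalar_ring abelian_group scale_add scale_add_left scale_scale scale_one)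
  then show ?thesis
    using ring smult_mult by (auto simp: unital_algebra_def unital_algebra_axioms_def)
qed

end

text \<open>Rings whose addition is that of the ambient type, so that cosets can be handled with \<open>-\<close>.\<close>

locale ambient_ring = ring A for A :: "('m::ab_group_add, 'z) ring_scheme" (structure) +
  assumes ambient_add: "add A = (+)" and ambient_zero: "zero A = 0"
begin

lemma ambient_uminus:
  assumes "x \<in> carrier A"
  shows "\<ominus> x = - x"
proof -
  have "\<ominus> x + x = 0" using l_neg[OF assms] by (simp add: ambient_add ambient_zero)
  then show ?thesis by (simp add: eq_neg_iff_add_eq_0)
qed

lemma ambient_closed:
  assumes "x \<in> carrier A" "y \<in> carrier A"
  shows "x + y \<in> carrier A" "- x \<in> carrier A" "x - y \<in> carrier A" "0 \<in> carrier A"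
  using a_closed[OF assms] a_inv_closed[OF assms(1)] minus_closed[OF assms] ambient_uminus assms zero_closed
  by (simp_all add: ambient_add ambient_zero a_minus_def)

end

locale ambient_quotient = ambient_ring A + ideal I A for A :: "('m::ab_group_add, 'z) ring_scheme" (structure) and I
begin

abbreviation "coset x \<equiv> I +> x"

lemma ideal_closed: "0 \<in> I" "x \<in> I \<Longrightarrow> y \<in> I \<Longrightarrow> x + y \<in> I" "x \<in> I \<Longrightarrow> - x \<in> I" "x \<in> I \<Longrightarrow> y \<in> I \<Longrightarrow> x - y \<in> I"
proof -
  show 0: "0 \<in> I" using additive_subgroup.zero_closed[OF is_additive_subgroup] by (simp add: ambient_zero)
  show 1: "x + y \<in> I" if "x \<in> I" "y \<in> I" for x y
    using additive_subgroup.a_closed[OF is_additive_subgroup that] by (simp add: ambient_add)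
  show 2: "- x \<in> I" if "x \<in> I" for x
    using additive_subgroup.a_inv_closed[OF is_additive_subgroup that] ambient_uminus[OF Icarr[OF that]] by simp
  show "x - y \<in> I" if "x \<in> I" "y \<in> I" using 1[OF that(1) 2[OF that(2)]] by simp
qed

lemma coset_def: "coset x = (\<lambda>i. i + x) ` I"
  by (auto simp: a_r_coset_def' ambient_add)

lemma coset_eq_iff: "coset x = coset y \<longleftrightarrow> x - y \<in> I"
proof
  assume "coset x = coset y"
  then have "0 + x \<in> coset y" unfolding coset_def using ideal_closed(1) by blast
  then show "x - y \<in> I" by (auto simp: coset_def)
next
  assume *: "x - y \<in> I"
  have "i + x \<in> coset y" if "i \<in> I" for i
    unfolding coset_def using ideal_closed(2)[OF that *] by (intro image_eqI[of _ _ "i + (x - y)"]) auto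
  moreover have "i + y \<in> coset x" if "i \<in> I" for i
    unfolding coset_def using ideal_closed(4)[OF that *] by (intro image_eqI[of _ _ "i - (x - y)"]) auto
  ultimately show "coset x = coset y" by (auto simp: coset_def)
qed

lemma quotient_carrier: "carrier (A Quot I) = coset ` carrier A"
  by (auto simp: FactRing_def A_RCOSETS_def')

lemma quotient_one: "one (A Quot I) = coset \<one>"
  by (simp add: FactRing_def)

lemma quotient_zero: "zero (A Quot I) = coset 0"
  by (simp add: FactRing_def coset_def)

lemma quotient_mult: "x \<in> carrier A \<Longrightarrow> y \<in> carrier A \<Longrightarrow> coset x \<otimes>\<^bsub>A Quot I\<^esub> coset y = coset (x \<otimes> y)"
  by (simp add: FactRing_def rcoset_mult_add)

lemma quotient_add: "x \<in> carrier A \<Longrightarrow> y \<in> carrier A \<Longrightarrow> coset x \<oplus>\<^bsub>A Quot I\<^esub> coset y = coset (x + y)"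
  using a_rcos_sum by (simp add: FactRing_def ambient_add)

text \<open>An additive map vanishing on \<open>I\<close> is constant on cosets, so \<open>the_elem\<close> below is meaningful.\<close>

lemma the_elem_coset:
  fixes F :: "'m \<Rightarrow> 'n::ab_group_add"
  assumes "\<And>x y. x \<in> carrier A \<Longrightarrow> y \<in> carrier A \<Longrightarrow> F (x + y) = F x + F y"
    and "\<And>x. x \<in> I \<Longrightarrow> F x = 0" and "x \<in> carrier A"
  shows "the_elem (F ` coset x) = F x"
proof -
  have "F ` coset x = {F x}"
  proof (intro equalityI subsetI)
    fix y assume "y \<in> F ` coset x"
    then obtain i where "i \<in> I" "y = F (i + x)" by (auto simp: coset_def)
    then show "y \<in> {F x}" using assms(1)[OF Icarr assms(3)] assms(2) by simp
  next
    fix y assume "y \<in> {F x}"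
    moreover have "x \<in> coset x" unfolding coset_def using ideal_closed(1) by (intro image_eqI[of _ _ 0]) auto
    ultimately show "y \<in> F ` coset x" by blast
  qed
  then show ?thesis by simp
qed

end

text \<open>Algebras with a scalar action are records of another type than quotient rings; the ring
  laws are carried over along equal operations.\<close>

lemma ring_transfer:
  assumes "ring R" "carrier S = carrier R" "mult S = mult R" "one S = one R" "zero S = zero R" "add S = add R"
  shows "ring S"
proof -
  interpret ring R by (rule assms(1))
  show ?thesis
  proof (rule ringI)
    show "abelian_group S"
      by (rule abelian_groupI) (use assms a_assoc a_comm l_neg in \<open>auto intro: a_inv_closed\<close>)
    show "monoid S"
      by (rule monoidI) (use assms m_assoc in auto)
  qed (use assms l_distr r_distr in auto)
qed

text \<open>Used to make evaluation vanish on generated ideals: these are minimal, so it is enough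
  that the null set is an ideal containing the relations. The target needs only its
  addition.\<close>

lemma ideal_null_set:
  fixes F :: "'m::ab_group_add \<Rightarrow> 'n::ab_group_add"
  assumes "ambient_ring A"
    and add: "\<And>x y. x \<in> carrier A \<Longrightarrow> y \<in> carrier A \<Longrightarrow> F (x + y) = F x + F y"
    and mult: "\<And>x y. x \<in> carrier A \<Longrightarrow> y \<in> carrier A \<Longrightarrow> F x = 0 \<Longrightarrow> F (x \<otimes>\<^bsub>A\<^esub> y) = 0 \<and> F (y \<otimes>\<^bsub>A\<^esub> x) = 0"
  shows "ideal {x \<in> carrier A. F x = 0} A"
proof -
  interpret ambient_ring A by (rule assms(1))
  have F0: "F 0 = 0" using add[of 0 0] zero_closed by (simp add: ambient_zero)
  show ?thesis
  proof (rule idealI)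
    show "ring A" by (rule ring_axioms)
    show "subgroup {x \<in> carrier A. F x = 0} (add_monoid A)"
    proof (rule group.subgroupI[OF add.is_group])
      show "inv\<^bsub>add_monoid A\<^esub> x \<in> {x \<in> carrier A. F x = 0}" if "x \<in> {x \<in> carrier A. F x = 0}" for x
      proof -
        have x: "x \<in> carrier A" "F x = 0" using that by auto
        have "F (x + - x) = F x + F (- x)" using x ambient_closed(2)[of x x] by (intro add) auto
        then have "F (- x) = 0" using F0 x by simp
        then have "\<ominus>\<^bsub>A\<^esub> x \<in> {x \<in> carrier A. F x = 0}"
          using x ambient_closed(2)[of x x] ambient_uminus[of x] by auto
        then show ?thesis by (simp add: a_inv_def)
      qed
    qed (use F0 add zero_closed ambient_closed(1) in \<open>auto simp: ambient_add ambient_zero\<close>)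
  qed (use mult in auto)
qed

section \<open>Quotients and extension of scalars\<close>

lemma (in structure_constants) ambient_ring: "ambient_ring A"
  by (simp add: ambient_ring_def ambient_ring_axioms_def ring)

text \<open>The right unit laws, in contrast to the left ones, are inherited from the normal word of
  the diagram.\<close>

lemma diagram_structure_constants:
  "structure_constants (blob_diagrams n) (concat_scalar n \<delta> \<gamma> (\<delta>\<^sub>e::'c::comm_ring_1)) (concat_diagram n) (identity_diagram n)"
proof unfold_locales
  fix d assume d: "d \<in> blob_diagrams n"
  then obtain a w where w: "normal_word n a w" "word_diagram n w = d" by (rule blob_diagram_normal_word)
  from normal_word_invariants(6)[OF w(1) order.refl] normal_word_invariants(7)[OF w(1) order.refl, of \<delta> \<gamma> \<delta>\<^sub>e]
  show "concat_diagram n d (identity_diagram n) = d" "concat_scalar n \<delta> \<gamma> \<delta>\<^sub>e d (identity_diagram n) = 1"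
    by (simp_all add: w(2))
  show "concat_diagram n (identity_diagram n) d = d" "concat_scalar n \<delta> \<gamma> \<delta>\<^sub>e (identity_diagram n) d = 1"
    by (rule concat_identity_left concat_scalar_identity_left, rule partition_diagram_blob, rule d)+
qed (simp_all add: concat_blob_diagram identity_blob_diagram concat_diagram_assoc concat_scalar_assoc partition_diagram_blob)

lemma free_structure_constants: "structure_constants (lists X) (\<lambda>_ _. 1) (@) []"
  by unfold_locales auto

lemma pair_structure_constants:
  assumes "monoid A"
  shows "structure_constants (UNIV \<times> carrier A) (\<lambda>_ _. 1)
    (\<lambda>(s, a) (t, b). (s * t :: 'd::comm_ring_1, a \<otimes>\<^bsub>A\<^esub> b)) (1, \<one>\<^bsub>A\<^esub>)"
proof -
  interpret monoid A by (rule assms)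
  show ?thesis by unfold_locales (auto simp: m_assoc mult_ac)
qed

locale algebra_quotient = structure_constants B coef prd u + ideal I "based_algebra B coef prd u"
  for B :: "'b set" and coef :: "'b \<Rightarrow> 'b \<Rightarrow> 'c::comm_ring_1" and prd u I
begin

sublocale ambient_quotient "based_algebra B coef prd u" I
  using ambient_ring ideal_axioms by (simp add: ambient_quotient_def)

lemma quotient_algebra_simps:
  "carrier (quotient_algebra A I) = coset ` carrier A"
  "one (quotient_algebra A I) = coset \<one>\<^bsub>A\<^esub>"
  "zero (quotient_algebra A I) = coset 0"
  "x \<in> carrier A \<Longrightarrow> y \<in> carrier A \<Longrightarrow> coset x \<otimes>\<^bsub>quotient_algebra A I\<^esub> coset y = coset (x \<otimes>\<^bsub>A\<^esub> y)"
  "x \<in> carrier A \<Longrightarrow> y \<in> carrier A \<Longrightarrow> coset x \<oplus>\<^bsub>quotient_algebra A I\<^esub> coset y = coset (x + y)"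
  by (simp_all add: quotient_algebra_def quotient_carrier quotient_one quotient_zero quotient_mult quotient_add del: based_algebra_simps)

lemma ring_quotient_algebra: "ring (quotient_algebra A I)"
  by (rule ring_transfer[OF quotient_is_ring]) (simp_all add: quotient_algebra_def)

text \<open>A scalar acts as multiplication by its multiple of the unit, which an ideal
  absorbs.\<close>

lemma smult_in_ideal:
  assumes "i \<in> I"
  shows "c \<odot>\<^bsub>A\<^esub> i \<in> I"
proof -
  have i: "i \<in> carrier A" using Icarr[OF assms] .
  have one: "\<one>\<^bsub>A\<^esub> \<in> carrier A" using unit_closed by auto
  have "c \<odot>\<^bsub>A\<^esub> \<one>\<^bsub>A\<^esub> \<in> carrier A" using unit_closed keys_scale[of c "\<one>\<^bsub>A\<^esub>"] by auto
  then have "(c \<odot>\<^bsub>A\<^esub> \<one>\<^bsub>A\<^esub>) \<otimes>\<^bsub>A\<^esub> i \<in> I" by (rule I_l_closed[OF assms])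
  then show ?thesis using smult_mult(1)[OF one i, of c] mult_one(1)[OF i] by simp
qed

text \<open>All members of the union that defines the scalar action are the same coset, and
  \<open>I\<close> is non-empty.\<close>

lemma quotient_smult:
  assumes "x \<in> carrier A"
  shows "c \<odot>\<^bsub>quotient_algebra A I\<^esub> coset x = coset (c \<odot>\<^bsub>A\<^esub> x)"
proof -
  have "coset (c \<odot>\<^bsub>A\<^esub> (i + x)) = coset (c \<odot>\<^bsub>A\<^esub> x)" if "i \<in> I" for i
    using smult_in_ideal[OF that, of c] by (simp add: coset_eq_iff scale_add)
  then have "(\<Union>a \<in> coset x. coset (c \<odot>\<^bsub>A\<^esub> a)) = (\<Union>i \<in> I. coset (c \<odot>\<^bsub>A\<^esub> x))"
    unfolding coset_def[of x] by simp
  also have "\<dots> = coset (c \<odot>\<^bsub>A\<^esub> x)" using ideal_closed(1) by auto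
  finally show ?thesis by (simp add: quotient_algebra_def)
qed

end

locale scalar_extension = ring A for h :: "'c \<Rightarrow> 'd::comm_ring_1" and A :: "('c, 'a) module" +
  assumes scale_closed: "a \<in> carrier A \<Longrightarrow> c \<odot>\<^bsub>A\<^esub> a \<in> carrier A"
begin

sublocale P: structure_constants "UNIV \<times> carrier A" "\<lambda>_ _. 1 :: int"
  "\<lambda>(s, a) (t, b). (s * t :: 'd, a \<otimes>\<^bsub>A\<^esub> b)" "(1, \<one>\<^bsub>A\<^esub>)"
  by (rule pair_structure_constants) (rule monoid_axioms)

lemma pair_ring_eq: "pair_ring A = P.A"
  by (simp add: pair_ring_def)

lemma pair_closed: "a \<in> carrier A \<Longrightarrow> pair s a \<in> carrier P.A"
  by simp

lemma pair_mult: "pair s a \<otimes>\<^bsub>P.A\<^esub> pair t b = pair (s * t) (a \<otimes>\<^bsub>A\<^esub> b)"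
  by (simp add: based_mult_single)

lemma relations_closed: "bilinearity_relations h A \<subseteq> carrier P.A"
proof -
  interpret ambient_ring P.A by (rule P.ambient_ring)
  show ?thesis
    unfolding bilinearity_relations_def
    by (auto simp del: based_algebra_simps intro!: ambient_closed(3) pair_closed scale_closed)
qed

sublocale ambient_quotient P.A "tensor_ideal h A"
proof -
  interpret ambient_ring P.A by (rule P.ambient_ring)
  show "ambient_quotient P.A (tensor_ideal h A)"
    unfolding ambient_quotient_def tensor_ideal_def pair_ring_eq
    using genideal_ideal[OF relations_closed] ambient_ring_axioms by simp
qed

lemma relation_in_ideal: "r \<in> bilinearity_relations h A \<Longrightarrow> r \<in> tensor_ideal h A"
  using genideal_self[OF relations_closed] by (auto simp: tensor_ideal_def pair_ring_eq)

lemma coset_pair_add_left: "a \<in> carrier A \<Longrightarrow> coset (pair (s + t) a) = coset (pair s a + pair t a)"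
  unfolding coset_eq_iff diff_diff_eq[symmetric] by (rule relation_in_ideal) (auto simp: bilinearity_relations_def)

lemma coset_pair_add_right:
  "a \<in> carrier A \<Longrightarrow> b \<in> carrier A \<Longrightarrow> coset (pair s (a \<oplus>\<^bsub>A\<^esub> b)) = coset (pair s a + pair s b)"
  unfolding coset_eq_iff diff_diff_eq[symmetric] by (rule relation_in_ideal) (auto simp: bilinearity_relations_def)

lemma coset_pair_scale: "a \<in> carrier A \<Longrightarrow> coset (pair (s * h c) a) = coset (pair s (c \<odot>\<^bsub>A\<^esub> a))"
  unfolding coset_eq_iff by (rule relation_in_ideal) (auto simp: bilinearity_relations_def)

text \<open>Apply the additivity relations to 0 + 0 = 0 in either argument.\<close>

lemma coset_pair_zero: "coset (pair s \<zero>\<^bsub>A\<^esub>) = coset 0" "a \<in> carrier A \<Longrightarrow> coset (pair 0 a) = coset 0"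
  using coset_pair_add_right[of "\<zero>\<^bsub>A\<^esub>" "\<zero>\<^bsub>A\<^esub>" s] coset_pair_add_left[of a 0 0] ideal_closed(3)
  by (force simp: coset_eq_iff)+

lemma base_change_simps:
  "carrier (base_change h A) = coset ` carrier P.A"
  "one (base_change h A) = coset (pair 1 \<one>\<^bsub>A\<^esub>)"
  "zero (base_change h A) = coset 0"
  "p \<in> carrier P.A \<Longrightarrow> q \<in> carrier P.A \<Longrightarrow> coset p \<otimes>\<^bsub>base_change h A\<^esub> coset q = coset (p \<otimes>\<^bsub>P.A\<^esub> q)"
  "p \<in> carrier P.A \<Longrightarrow> q \<in> carrier P.A \<Longrightarrow> coset p \<oplus>\<^bsub>base_change h A\<^esub> coset q = coset (p + q)"
  "p \<in> carrier P.A \<Longrightarrow> s \<odot>\<^bsub>base_change h A\<^esub> coset p = coset (pair s \<one>\<^bsub>A\<^esub> \<otimes>\<^bsub>P.A\<^esub> p)"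
proof -
  have one: "\<one>\<^bsub>P.A\<^esub> = pair 1 \<one>\<^bsub>A\<^esub>" by simp
  show "carrier (base_change h A) = coset ` carrier P.A" "zero (base_change h A) = coset 0"
    "one (base_change h A) = coset (pair 1 \<one>\<^bsub>A\<^esub>)"
    unfolding base_change_def Let_def pair_ring_eq one[symmetric]
    by (simp_all only: partial_object.simps monoid.simps ring.simps quotient_carrier quotient_zero quotient_one)
  have pt: "pure_tensor h A s \<one>\<^bsub>A\<^esub> = coset (pair s \<one>\<^bsub>A\<^esub>)" for s
    by (simp only: pure_tensor_def pair_ring_eq)
  show "coset p \<otimes>\<^bsub>base_change h A\<^esub> coset q = coset (p \<otimes>\<^bsub>P.A\<^esub> q)"
    "coset p \<oplus>\<^bsub>base_change h A\<^esub> coset q = coset (p + q)" if "p \<in> carrier P.A" "q \<in> carrier P.A"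
    unfolding base_change_def Let_def pair_ring_eq using quotient_mult[OF that] quotient_add[OF that] by simp_all
  show "s \<odot>\<^bsub>base_change h A\<^esub> coset p = coset (pair s \<one>\<^bsub>A\<^esub> \<otimes>\<^bsub>P.A\<^esub> p)" if "p \<in> carrier P.A"
    unfolding base_change_def Let_def pair_ring_eq using quotient_mult[OF pair_closed that, of "\<one>\<^bsub>A\<^esub>" s] pt by simp
qed

lemma ring_base_change: "ring (base_change h A)"
  by (rule ring_transfer[OF quotient_is_ring]) (simp_all add: base_change_def Let_def pair_ring_eq)

text \<open>Centrality of s \<otimes> 1 is what makes the scalar action compatible with products in
  the right factor.\<close>

lemma pair_one_central:
  assumes "p \<in> carrier P.A"
  shows "pair s \<one>\<^bsub>A\<^esub> \<otimes>\<^bsub>P.A\<^esub> p = p \<otimes>\<^bsub>P.A\<^esub> pair s \<one>\<^bsub>A\<^esub>"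
  using assms
proof (induction p rule: based_algebra_induct)
  case (single b x)
  then show ?case by (cases b) (simp add: based_mult_single mult.commute)
qed (simp_all add: based_mult_add_left based_mult_add_right)

lemma unital_algebra_base_change: "unital_algebra scalar_ring (base_change h A)" (is "unital_algebra _ ?b")
proof -
  note [simp del] = based_algebra_simps(1,4)
  interpret b: ring ?b by (rule ring_base_change)
  note S = base_change_simps
  have cl: "pair s \<one>\<^bsub>A\<^esub> \<in> carrier P.A" for s by (rule pair_closed) simp
  have mcl: "p \<otimes>\<^bsub>P.A\<^esub> q \<in> carrier P.A" if "p \<in> carrier P.A" "q \<in> carrier P.A" for p q
    using P.mult_closed that by blast
  have sm: "s \<odot>\<^bsub>?b\<^esub> x = coset (pair s \<one>\<^bsub>A\<^esub>) \<otimes>\<^bsub>?b\<^esub> x" if "x \<in> carrier ?b" for s x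
    using that S(4)[OF cl] by (auto simp: S(1,6))
  have tcl: "coset (pair s \<one>\<^bsub>A\<^esub>) \<in> carrier ?b" for s using cl by (simp add: S(1))
  have tadd: "coset (pair (s + t) \<one>\<^bsub>A\<^esub>) = coset (pair s \<one>\<^bsub>A\<^esub>) \<oplus>\<^bsub>?b\<^esub> coset (pair t \<one>\<^bsub>A\<^esub>)" for s t
    using coset_pair_add_left[of "\<one>\<^bsub>A\<^esub>" s t] S(5)[OF cl cl] by simp
  have tmult: "coset (pair (s * t) \<one>\<^bsub>A\<^esub>) = coset (pair s \<one>\<^bsub>A\<^esub>) \<otimes>\<^bsub>?b\<^esub> coset (pair t \<one>\<^bsub>A\<^esub>)" for s t
    by (simp add: S(4)[OF cl cl] based_mult_single)
  have central: "x \<otimes>\<^bsub>?b\<^esub> coset (pair s \<one>\<^bsub>A\<^esub>) = coset (pair s \<one>\<^bsub>A\<^esub>) \<otimes>\<^bsub>?b\<^esub> x" if "x \<in> carrier ?b" for s x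
    using that pair_one_central[of _ s] by (auto simp: S(1,4) cl)
  have "Module.module scalar_ring ?b"
  proof (rule moduleI)
    show "abelian_group ?b" by (rule b.abelian_group_axioms)
    show "s \<odot>\<^bsub>?b\<^esub> x \<in> carrier ?b" if "x \<in> carrier ?b" for s x using sm tcl that by simp
    show "(s \<oplus>\<^bsub>scalar_ring\<^esub> t) \<odot>\<^bsub>?b\<^esub> x = s \<odot>\<^bsub>?b\<^esub> x \<oplus>\<^bsub>?b\<^esub> t \<odot>\<^bsub>?b\<^esub> x" if "x \<in> carrier ?b" for s t x
      using that tcl by (simp add: sm tadd b.l_distr)
    show "s \<odot>\<^bsub>?b\<^esub> (x \<oplus>\<^bsub>?b\<^esub> y) = s \<odot>\<^bsub>?b\<^esub> x \<oplus>\<^bsub>?b\<^esub> s \<odot>\<^bsub>?b\<^esub> y" if "x \<in> carrier ?b" "y \<in> carrier ?b" for s x y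
      using that tcl by (simp add: sm b.r_distr)
    show "(s \<otimes>\<^bsub>scalar_ring\<^esub> t) \<odot>\<^bsub>?b\<^esub> x = s \<odot>\<^bsub>?b\<^esub> (t \<odot>\<^bsub>?b\<^esub> x)" if "x \<in> carrier ?b" for s t x
      using that tcl by (simp add: sm tmult b.m_assoc)
    show "\<one>\<^bsub>scalar_ring\<^esub> \<odot>\<^bsub>?b\<^esub> x = x" if "x \<in> carrier ?b" for x
      using that S(2) b.l_one by (simp add: sm)
  qed (rule cring_scalar_ring)
  moreover have "(s \<odot>\<^bsub>?b\<^esub> x) \<otimes>\<^bsub>?b\<^esub> y = s \<odot>\<^bsub>?b\<^esub> (x \<otimes>\<^bsub>?b\<^esub> y)" if "x \<in> carrier ?b" "y \<in> carrier ?b" for s x y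
    using that tcl by (simp add: sm b.m_assoc)
  moreover have "x \<otimes>\<^bsub>?b\<^esub> (s \<odot>\<^bsub>?b\<^esub> y) = s \<odot>\<^bsub>?b\<^esub> (x \<otimes>\<^bsub>?b\<^esub> y)" if "x \<in> carrier ?b" "y \<in> carrier ?b" for s x y
    using that tcl central[OF that(1), of s] by (simp add: sm b.m_assoc[symmetric])
  ultimately show ?thesis
    by (simp add: unital_algebra_def unital_algebra_axioms_def b.ring_axioms)
qed

end

section \<open>Dictionary between generators and letters\<close>

fun letter :: "nat \<Rightarrow> blob_gen" where
  "letter 0 = E"
| "letter (Suc i) = U (Suc i)"

fun letter_index :: "blob_gen \<Rightarrow> nat" where
  "letter_index E = 0"
| "letter_index (U i) = i"

lemma letter_pos: "0 < i \<Longrightarrow> letter i = U i"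
  by (cases i) auto

lemma letter_index_letter [simp]: "letter_index (letter i) = i"
  by (cases i) auto

lemma map_letter_index [simp]: "map letter_index (map letter w) = w"
  by (simp add: comp_def)

lemma letter_closed: "1 \<le> n \<Longrightarrow> i < n \<Longrightarrow> letter i \<in> blob_gens n"
  by (cases i) (auto simp: blob_gens_def)

lemma letter_letter_index: "g \<in> blob_gens n \<Longrightarrow> letter (letter_index g) = g"
  by (auto simp: blob_gens_def letter_pos)

lemma letter_index_less: "1 \<le> n \<Longrightarrow> g \<in> blob_gens n \<Longrightarrow> letter_index g < n"
  by (auto simp: blob_gens_def)

lemma map_letter_closed: "1 \<le> n \<Longrightarrow> set w \<subseteq> {..<n} \<Longrightarrow> map letter w \<in> lists (blob_gens n)"
  using letter_closed by fastforce

lemma letter_index_word_closed: "1 \<le> n \<Longrightarrow> w \<in> lists (blob_gens n) \<Longrightarrow> set (map letter_index w) \<subseteq> {..<n}"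
  using letter_index_less by fastforce

lemma map_letter_letter_index: "w \<in> lists (blob_gens n) \<Longrightarrow> map letter (map letter_index w) = w"
  using letter_letter_index by (induction w) auto

section \<open>The isomorphism\<close>

locale blob_presentation =
  fixes h :: "'K::comm_ring_1 \<Rightarrow> 'k::field" and n :: nat and \<delta> \<gamma> \<delta>\<^sub>e :: 'K
  assumes hom: "h \<in> ring_hom scalar_ring scalar_ring" and n: "1 \<le> n"
begin

lemma h_simps [simp]: "h (x * y) = h x * h y" "h (x + y) = h x + h y" "h 1 = 1" "h 0 = 0"
proof -
  show *: "h (x + y) = h x + h y" "h (x * y) = h x * h y" "h 1 = 1" for x y
    using ring_hom_add[OF hom, of x y] ring_hom_mult[OF hom, of x y] ring_hom_one[OF hom] by simp_all
  have "h 0 + 0 = h 0 + h 0" using *(1)[of 0 0] by (simp only: add_0_right)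
  then show "h 0 = 0" by (simp only: add_left_cancel)
qed

sublocale F: structure_constants "lists (blob_gens n)" "\<lambda>_ _. 1 :: 'K" "(@)" "[]"
  by (rule free_structure_constants)

sublocale D: structure_constants "blob_diagrams n" "concat_scalar n (h \<delta>) (h \<gamma>) (h \<delta>\<^sub>e)" "concat_diagram n" "identity_diagram n"
  by (rule diagram_structure_constants)

abbreviation "relations \<equiv> blob_relations n \<delta> \<gamma> \<delta>\<^sub>e"
abbreviation "I \<equiv> Idl\<^bsub>F.A\<^esub> relations"

lemma relations_closed: "relations \<subseteq> carrier F.A"
proof -
  interpret ambient_ring F.A by (rule F.ambient_ring)
  have w: "scaled_word c v \<in> carrier F.A" if "v \<in> lists (blob_gens n)" for c :: 'K and v
    using that by simp
  show ?thesis
    unfolding blob_relations_def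
    by (auto simp del: based_algebra_simps intro!: ambient_closed(3) w) (auto simp: blob_gens_def)
qed

sublocale Q: algebra_quotient "lists (blob_gens n)" "\<lambda>_ _. 1 :: 'K" "(@)" "[]" I
proof -
  interpret ambient_ring F.A by (rule F.ambient_ring)
  show "algebra_quotient (lists (blob_gens n)) (\<lambda>_ _. 1 :: 'K) (@) [] I"
    unfolding algebra_quotient_def using genideal_ideal[OF relations_closed] F.structure_constants_axioms by simp
qed

abbreviation "bK \<equiv> quotient_algebra F.A I"

lemma presented_blob_algebra_eq: "presented_blob_algebra n \<delta> \<gamma> \<delta>\<^sub>e = bK"
  by (simp add: presented_blob_algebra_def presented_algebra_def free_algebra_def)

lemma presented_blob_gen_eq: "presented_blob_gen n \<delta> \<gamma> \<delta>\<^sub>e g = Q.coset (word [g])"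
  by (simp add: presented_blob_gen_def presented_gen_def free_algebra_def)

sublocale X: scalar_extension h bK
proof -
  interpret b: ring bK by (rule Q.ring_quotient_algebra)
  have "c \<odot>\<^bsub>bK\<^esub> a \<in> carrier bK" if "a \<in> carrier bK" for c a
  proof -
    obtain x where x: "x \<in> carrier F.A" "a = Q.coset x" using \<open>a \<in> carrier bK\<close> unfolding Q.quotient_algebra_simps(1) by blast
    have "c \<odot>\<^bsub>F.A\<^esub> x \<in> carrier F.A" using x(1) keys_scale[of c x] by auto
    then show ?thesis unfolding x(2) Q.quotient_smult[OF x(1)] Q.quotient_algebra_simps(1) by (rule imageI)
  qed
  then show "scalar_extension bK"
    by (simp add: scalar_extension_def scalar_extension_axioms_def b.ring_axioms)
qed

lemma word_closed: "w \<in> lists (blob_gens n) \<Longrightarrow> scaled_word c w \<in> carrier F.A"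
  by simp

lemma nat_word_closed: "set w \<subseteq> {..<n} \<Longrightarrow> scaled_word c (map letter w) \<in> carrier F.A"
  by (rule word_closed) (rule map_letter_closed[OF n])

lemma coset_relation: "x - y \<in> relations \<Longrightarrow> Q.coset x = Q.coset y"
  unfolding Q.coset_eq_iff using ring.genideal_self[OF F.ring relations_closed] by (rule subsetD)

lemma relations_mem:
  shows "1 \<le> i \<Longrightarrow> i < n \<Longrightarrow> word [U i, U i] - scaled_word \<delta> [U i] \<in> relations"
    and "1 \<le> i \<Longrightarrow> i < n \<Longrightarrow> 1 \<le> j \<Longrightarrow> j < n \<Longrightarrow> \<bar>int i - int j\<bar> = 1 \<Longrightarrow>
      word [U i, U j, U i] - word [U i] \<in> relations"
    and "1 \<le> i \<Longrightarrow> i < n \<Longrightarrow> 1 \<le> j \<Longrightarrow> j < n \<Longrightarrow> \<bar>int i - int j\<bar> \<noteq> 1 \<Longrightarrow>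
      word [U i, U j] - word [U j, U i] \<in> relations"
    and "1 < n \<Longrightarrow> word [U 1, E, U 1] - scaled_word \<gamma> [U 1] \<in> relations"
    and "word [E, E] - scaled_word \<delta>\<^sub>e [E] \<in> relations"
    and "1 < i \<Longrightarrow> i < n \<Longrightarrow> word [U i, E] - word [E, U i] \<in> relations"
  unfolding blob_relations_def Un_iff mem_Collect_eq atLeastLessThan_iff
  by (blast | force)+

lemma coset_scale: "Q.coset x = Q.coset y \<Longrightarrow> x \<in> carrier F.A \<Longrightarrow> y \<in> carrier F.A \<Longrightarrow>
    Q.coset (c \<odot>\<^bsub>F.A\<^esub> x) = Q.coset (c \<odot>\<^bsub>F.A\<^esub> y)"
  using Q.quotient_smult[of x c] Q.quotient_smult[of y c] by simp

lemma coset_mult: "Q.coset x = Q.coset x' \<Longrightarrow> Q.coset y = Q.coset y' \<Longrightarrow>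
    x \<in> carrier F.A \<Longrightarrow> x' \<in> carrier F.A \<Longrightarrow> y \<in> carrier F.A \<Longrightarrow> y' \<in> carrier F.A \<Longrightarrow>
    Q.coset (x \<otimes>\<^bsub>F.A\<^esub> y) = Q.coset (x' \<otimes>\<^bsub>F.A\<^esub> y')"
  using Q.quotient_algebra_simps(4)[of x y] Q.quotient_algebra_simps(4)[of x' y'] by simp

text \<open>Each proper rewriting rule is an instance of a defining relation over K, so words are
  normalised before the extension of scalars; only the resulting scalar is moved across the tensor
  sign by \<open>h\<close> later.\<close>

lemma coset_reduces:
  "reduces \<delta> \<gamma> \<delta>\<^sub>e n u c v \<Longrightarrow> set u \<subseteq> {..<n} \<Longrightarrow>
    Q.coset (word (map letter u)) = Q.coset (scaled_word c (map letter v))"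
proof (induction rule: reduces.induct)
  case (compose u c v d w)
  have v: "set v \<subseteq> {..<n}" and w: "set w \<subseteq> {..<n}"
    using red_letters[OF compose.hyps(1) compose.prems] red_letters[OF compose.hyps(2)] by auto
  have "Q.coset (word (map letter u)) = Q.coset (c \<odot>\<^bsub>F.A\<^esub> word (map letter v))"
    using compose.IH(1)[OF compose.prems] by (simp add: scale_single)
  also have "\<dots> = Q.coset (c \<odot>\<^bsub>F.A\<^esub> scaled_word d (map letter w))"
    by (rule coset_scale[OF compose.IH(2)[OF v] nat_word_closed[OF v] nat_word_closed[OF w]])
  finally show ?case by (simp add: scale_single)
next
  case (in_context u c v x y)
  have s: "set u \<subseteq> {..<n}" "set x \<subseteq> {..<n}" "set y \<subseteq> {..<n}" using in_context.prems by auto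
  have v: "set v \<subseteq> {..<n}" by (rule red_letters[OF in_context.hyps s(1)])
  have uy: "Q.coset (word (map letter u) \<otimes>\<^bsub>F.A\<^esub> word (map letter y)) =
    Q.coset (scaled_word c (map letter v) \<otimes>\<^bsub>F.A\<^esub> word (map letter y))"
    by (rule coset_mult[OF in_context.IH[OF s(1)] refl nat_word_closed[OF s(1)] nat_word_closed[OF v]
        nat_word_closed[OF s(3)] nat_word_closed[OF s(3)]])
  have "Q.coset (word (map letter x) \<otimes>\<^bsub>F.A\<^esub> word (map letter (u @ y))) =
    Q.coset (word (map letter x) \<otimes>\<^bsub>F.A\<^esub> scaled_word c (map letter (v @ y)))"
    by (rule coset_mult[OF refl _ nat_word_closed nat_word_closed nat_word_closed nat_word_closed])
      (use uy s v in \<open>simp_all add: based_mult_single\<close>)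
  then show ?case by (simp add: based_mult_single)
next
  case (square i)
  show ?case
  proof (cases "i = 0")
    case True
    then show ?thesis using coset_relation[OF relations_mem(5)] by simp
  next
    case False
    then show ?thesis using coset_relation[OF relations_mem(1)[of i]] square by (simp add: letter_pos)
  qed
next
  case (cancel i j)
  then have "Q.coset (word [U i, U j, U i]) = Q.coset (word [U i])"
    by (intro coset_relation relations_mem) auto
  then show ?case using cancel by (simp add: letter_pos)
next
  case (uncancel i j)
  then have "Q.coset (word [U i, U j, U i]) = Q.coset (word [U i])"
    by (intro coset_relation relations_mem) auto
  then show ?case using uncancel by (simp add: letter_pos)
next
  case blob
  then show ?case using coset_relation[OF relations_mem(4)] by simp
next
  case (commute i j)
  consider "i = 0" "1 < j" | "j = 0" "1 < i" | "0 < i" "0 < j" using commute by linarith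
  then show ?case
  proof cases
    case 1
    then show ?thesis using coset_relation[OF relations_mem(6)[of j]] commute by (simp add: letter_pos)
  next
    case 2
    then show ?thesis using coset_relation[OF relations_mem(6)[of i]] commute by (simp add: letter_pos)
  next
    case 3
    then have "Q.coset (word [U i, U j]) = Q.coset (word [U j, U i])"
      using commute by (intro coset_relation relations_mem) auto
    then show ?thesis using 3 by (simp add: letter_pos)
  qed
qed simp

section \<open>Evaluation on the free algebra, the presented algebra and the tensor product\<close>

definition word_value :: "blob_gen list \<Rightarrow> 'K \<Rightarrow> (diagram \<Rightarrow>\<^sub>0 'k)" where
  "word_value w x = Poly_Mapping.single (word_diagram n (map letter_index w))
     (h x * word_scalar n (h \<delta>) (h \<gamma>) (h \<delta>\<^sub>e) (map letter_index w))"

definition eval_free :: "(blob_gen list \<Rightarrow>\<^sub>0 'K) \<Rightarrow> (diagram \<Rightarrow>\<^sub>0 'k)" where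
  "eval_free = linear_extension word_value"

lemma word_value_simps: "word_value w 0 = 0" "word_value w (x + y) = word_value w x + word_value w y"
  by (simp_all add: word_value_def distrib_right single_add)

lemma eval_free_add: "eval_free (f + g) = eval_free f + eval_free g"
  unfolding eval_free_def by (rule linear_extension_add) (simp_all add: word_value_simps)

lemma eval_free_diff: "eval_free (f - g) = eval_free f - eval_free g"
  unfolding eval_free_def by (rule linear_extension_diff) (simp_all add: word_value_simps)

lemma eval_free_zero [simp]: "eval_free 0 = 0"
  by (simp add: eval_free_def)

lemma eval_free_single: "eval_free (scaled_word x w) = word_value w x"
  unfolding eval_free_def by (rule linear_extension_single) (simp add: word_value_simps)

lemma eval_free_mult:
  assumes "f \<in> carrier F.A" "g \<in> carrier F.A"
  shows "eval_free (f \<otimes>\<^bsub>F.A\<^esub> g) = eval_free f \<otimes>\<^bsub>D.A\<^esub> eval_free g"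
  using assms(1)
proof (induction f rule: based_algebra_induct)
  case (single u x)
  show ?case using assms(2)
  proof (induction g rule: based_algebra_induct)
    case (single v y)
    have "set (map letter_index u) \<subseteq> {..<n}" "set (map letter_index v) \<subseteq> {..<n}"
      using letter_index_word_closed[OF n] \<open>u \<in> lists (blob_gens n)\<close> \<open>v \<in> lists (blob_gens n)\<close> by blast+
    then show ?case
      by (simp add: based_mult_single eval_free_single word_value_def word_diagram_append word_scalar_append mult_ac
          del: set_map)
  qed (simp_all add: eval_free_add based_mult_add_right)
qed (simp_all add: eval_free_add based_mult_add_left)

lemma eval_free_closed: "f \<in> carrier F.A \<Longrightarrow> eval_free f \<in> carrier D.A"
proof (induction f rule: based_algebra_induct)
  case (single w x)
  then show ?case
    using word_blob_diagram[OF letter_index_word_closed[OF n]] by (simp add: eval_free_single word_value_def del: set_map)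
next
  case (add f g)
  then show ?case using keys_add[of "eval_free f" "eval_free g"] by (auto simp: eval_free_add)
qed simp

lemma eval_free_scale:
  assumes "f \<in> carrier F.A"
  shows "eval_free (c \<odot>\<^bsub>F.A\<^esub> f) = h c \<odot>\<^bsub>D.A\<^esub> eval_free f"
  using assms
  by (induction f rule: based_algebra_induct)
    (simp_all add: scale_single eval_free_single word_value_def scale_add eval_free_add mult_ac)

lemma letter_index_comp_letter [simp]: "letter_index \<circ> letter = id"
  by auto

lemma word_value_relation:
  assumes "word_diagram n u = word_diagram n v"
    "word_scalar n (h \<delta>) (h \<gamma>) (h \<delta>\<^sub>e) u = h c * word_scalar n (h \<delta>) (h \<gamma>) (h \<delta>\<^sub>e) v"
  shows "word_value (map letter u) 1 = word_value (map letter v) c"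
  using assms by (simp add: word_value_def)

lemma eval_free_relation:
  assumes "r \<in> relations"
  shows "eval_free r = 0"
proof -
  have single: "word_scalar n (h \<delta>) (h \<gamma>) (h \<delta>\<^sub>e) [i] = 1" if "i < n" for i
    using word_scalar_single[OF that] .
  consider i where "r = word [U i, U i] - scaled_word \<delta> [U i]" "1 \<le> i" "i < n"
    | i j where "r = word [U i, U j, U i] - word [U i]" "1 \<le> i" "i < n" "1 \<le> j" "j < n" "\<bar>int i - int j\<bar> = 1"
    | i j where "r = word [U i, U j] - word [U j, U i]" "1 \<le> i" "i < n" "1 \<le> j" "j < n" "\<bar>int i - int j\<bar> \<noteq> 1"
    | "r = word [U 1, E, U 1] - scaled_word \<gamma> [U 1]" "1 < n"
    | "r = word [E, E] - scaled_word \<delta>\<^sub>e [E]"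
    | i where "r = word [U i, E] - word [E, U i]" "1 < i" "i < n"
    using assms unfolding blob_relations_def by fastforce
  then show ?thesis
  proof cases
    case (1 i)
    then have "word_value (map letter [i, i]) 1 = word_value (map letter [i]) \<delta>"
      using square_relation(1)[of i n] square_relation(2)[of i n "h \<delta>" "h \<gamma>" "h \<delta>\<^sub>e"] single[of i]
      by (intro word_value_relation) (simp_all del: word_diagram.simps word_scalar.simps)
    then show ?thesis using 1 by (simp add: eval_free_diff eval_free_single letter_pos)
  next
    case (2 i j)
    then have "0 < i" "0 < j" "i = Suc j \<or> j = Suc i" by auto
    then have "word_value (map letter [i, j, i]) 1 = word_value (map letter [i]) 1"
      using cancel_relation(1)[of i j n] cancel_relation(2)[of i j n "h \<delta>" "h \<gamma>" "h \<delta>\<^sub>e"] single[of i] 2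
      by (intro word_value_relation) (simp_all del: word_diagram.simps word_scalar.simps)
    then show ?thesis using 2 by (simp add: eval_free_diff eval_free_single letter_pos)
  next
    case (3 i j)
    show ?thesis
    \<comment> \<open>The commutation relations include i = j, where the relator is zero;
      \<open>commute_relation\<close> covers only distant letters.\<close>
    proof (cases "i = j")
      case False
      then have "Suc i < j \<or> Suc j < i" using 3 by auto
      then have "word_value (map letter [i, j]) 1 = word_value (map letter [j, i]) 1"
        using commute_relation(1)[of i n j] commute_relation(2)[of i n j "h \<delta>" "h \<gamma>" "h \<delta>\<^sub>e"] 3
        by (intro word_value_relation) (simp_all del: word_diagram.simps word_scalar.simps)
      then show ?thesis using 3 by (simp add: eval_free_diff eval_free_single letter_pos)
    qed (use 3 in simp)
  next
    case 4
    then have "word_value (map letter [1, 0, 1]) 1 = word_value (map letter [1]) \<gamma>"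
      using blob_relation(1)[of n] blob_relation(2)[of n "h \<delta>" "h \<gamma>" "h \<delta>\<^sub>e"] single[of 1]
      by (intro word_value_relation) (simp_all del: word_diagram.simps word_scalar.simps)
    then show ?thesis using 4 by (simp add: eval_free_diff eval_free_single)
  next
    case 5
    have "word_value (map letter [0, 0]) 1 = word_value (map letter [0]) \<delta>\<^sub>e"
      using square_relation(1)[of 0 n] square_relation(2)[of 0 n "h \<delta>" "h \<gamma>" "h \<delta>\<^sub>e"] single[of 0] n
      by (intro word_value_relation) (simp_all del: word_diagram.simps word_scalar.simps)
    then show ?thesis using 5 by (simp add: eval_free_diff eval_free_single)
  next
    case (6 i)
    then have "word_value (map letter [i, 0]) 1 = word_value (map letter [0, i]) 1"
      using commute_relation(1)[of i n 0] commute_relation(2)[of i n 0 "h \<delta>" "h \<gamma>" "h \<delta>\<^sub>e"] n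
      by (intro word_value_relation) (simp_all del: word_diagram.simps word_scalar.simps)
    then show ?thesis using 6 by (simp add: eval_free_diff eval_free_single letter_pos)
  qed
qed

lemma eval_free_ideal: "x \<in> I \<Longrightarrow> eval_free x = 0"
proof -
  have "ideal {x \<in> carrier F.A. eval_free x = 0} F.A"
    by (rule ideal_null_set[OF F.ambient_ring]) (simp_all add: eval_free_add eval_free_mult del: based_algebra_simps)
  then have "I \<subseteq> {x \<in> carrier F.A. eval_free x = 0}"
    using relations_closed eval_free_relation by (intro ring.genideal_minimal[OF F.ring]) auto
  then show "x \<in> I \<Longrightarrow> eval_free x = 0" by auto
qed

definition eval_K :: "(blob_gen list \<Rightarrow>\<^sub>0 'K) set \<Rightarrow> (diagram \<Rightarrow>\<^sub>0 'k)" where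
  "eval_K S = the_elem (eval_free ` S)"

lemma eval_K_coset: "f \<in> carrier F.A \<Longrightarrow> eval_K (Q.coset f) = eval_free f"
  unfolding eval_K_def by (rule Q.the_elem_coset) (simp_all add: eval_free_add eval_free_ideal del: based_algebra_simps)

lemma bK_cases:
  assumes "a \<in> carrier bK"
  obtains f where "f \<in> carrier F.A" "a = Q.coset f"
  using assms unfolding Q.quotient_algebra_simps(1) by blast

lemma eval_K_closed: "a \<in> carrier bK \<Longrightarrow> eval_K a \<in> carrier D.A"
  by (elim bK_cases) (simp add: eval_K_coset eval_free_closed del: based_algebra_simps)

lemma F_add_closed: "f \<in> carrier F.A \<Longrightarrow> g \<in> carrier F.A \<Longrightarrow> f + g \<in> carrier F.A"
  using keys_add[of f g] by auto

lemma F_scale_closed: "f \<in> carrier F.A \<Longrightarrow> c \<odot>\<^bsub>F.A\<^esub> f \<in> carrier F.A"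
  using keys_scale[of c f] by auto

lemma eval_K_add: "a \<in> carrier bK \<Longrightarrow> b \<in> carrier bK \<Longrightarrow> eval_K (a \<oplus>\<^bsub>bK\<^esub> b) = eval_K a + eval_K b"
  by (elim bK_cases) (simp add: eval_K_coset Q.quotient_algebra_simps(5) F_add_closed eval_free_add del: based_algebra_simps)

lemma eval_K_mult: "a \<in> carrier bK \<Longrightarrow> b \<in> carrier bK \<Longrightarrow> eval_K (a \<otimes>\<^bsub>bK\<^esub> b) = eval_K a \<otimes>\<^bsub>D.A\<^esub> eval_K b"
  by (elim bK_cases)
    (simp add: eval_K_coset Q.quotient_algebra_simps(4) F.mult_closed eval_free_mult del: based_algebra_simps)

lemma eval_K_scale: "a \<in> carrier bK \<Longrightarrow> eval_K (c \<odot>\<^bsub>bK\<^esub> a) = h c \<odot>\<^bsub>D.A\<^esub> eval_K a"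
proof (elim bK_cases)
  fix f assume f: "f \<in> carrier F.A" "a = Q.coset f"
  show "eval_K (c \<odot>\<^bsub>bK\<^esub> a) = h c \<odot>\<^bsub>D.A\<^esub> eval_K a"
    unfolding f(2) Q.quotient_smult[OF f(1)] eval_K_coset[OF F_scale_closed[OF f(1)]] eval_K_coset[OF f(1)]
    by (rule eval_free_scale[OF f(1)])
qed

lemma eval_K_one: "eval_K \<one>\<^bsub>bK\<^esub> = \<one>\<^bsub>D.A\<^esub>"
  by (simp add: Q.quotient_algebra_simps(2) eval_K_coset eval_free_single word_value_def)

text \<open>The integer multiplicity of a pair and its scalar component are fused into a single
  scalar of k.\<close>

definition pair_value :: "'k \<times> (blob_gen list \<Rightarrow>\<^sub>0 'K) set \<Rightarrow> int \<Rightarrow> (diagram \<Rightarrow>\<^sub>0 'k)" where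
  "pair_value p z = Poly_Mapping.map ((*) (of_int z * fst p)) (eval_K (snd p))"

definition eval_pairs :: "('k \<times> (blob_gen list \<Rightarrow>\<^sub>0 'K) set \<Rightarrow>\<^sub>0 int) \<Rightarrow> (diagram \<Rightarrow>\<^sub>0 'k)" where
  "eval_pairs = linear_extension pair_value"

lemma pair_value_simps: "pair_value p 0 = 0" "pair_value p (x + y) = pair_value p x + pair_value p y"
  by (simp_all add: pair_value_def distrib_right scale_add_left)

lemma eval_pairs_add: "eval_pairs (f + g) = eval_pairs f + eval_pairs g"
  unfolding eval_pairs_def by (rule linear_extension_add) (simp_all add: pair_value_simps)

lemma eval_pairs_diff: "eval_pairs (f - g) = eval_pairs f - eval_pairs g"
  unfolding eval_pairs_def by (rule linear_extension_diff) (simp_all add: pair_value_simps)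

lemma eval_pairs_zero [simp]: "eval_pairs 0 = 0"
  by (simp add: eval_pairs_def)

lemma eval_pairs_single: "eval_pairs (Poly_Mapping.single p z) = pair_value p z"
  unfolding eval_pairs_def by (rule linear_extension_single) (simp add: pair_value_simps)

lemma eval_pairs_pair: "eval_pairs (pair s a) = s \<odot>\<^bsub>D.A\<^esub> eval_K a"
  by (simp add: eval_pairs_single pair_value_def)

lemma eval_pairs_closed: "f \<in> carrier X.P.A \<Longrightarrow> eval_pairs f \<in> carrier D.A"
proof (induction f rule: based_algebra_induct)
  case (single p z)
  then have "eval_K (snd p) \<in> carrier D.A" by (intro eval_K_closed) auto
  then show ?case
    using keys_scale[of "of_int z * fst p" "eval_K (snd p)"] by (auto simp: eval_pairs_single pair_value_def)
next
  case (add f g)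
  then show ?case using keys_add[of "eval_pairs f" "eval_pairs g"] by (auto simp: eval_pairs_add)
qed simp

lemma eval_pairs_mult:
  assumes "f \<in> carrier X.P.A" "g \<in> carrier X.P.A"
  shows "eval_pairs (f \<otimes>\<^bsub>X.P.A\<^esub> g) = eval_pairs f \<otimes>\<^bsub>D.A\<^esub> eval_pairs g"
  using assms(1)
proof (induction f rule: based_algebra_induct)
  case (single p x)
  show ?case using assms(2)
  proof (induction g rule: based_algebra_induct)
    case (single q y)
    obtain s a t b where pq: "p = (s, a)" "q = (t, b)" "a \<in> carrier bK" "b \<in> carrier bK"
      using \<open>p \<in> UNIV \<times> carrier bK\<close> \<open>q \<in> UNIV \<times> carrier bK\<close> by auto
    note e = eval_K_closed[OF pq(3)] eval_K_closed[OF pq(4)]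
    have e': "r \<odot>\<^bsub>D.A\<^esub> eval_K b \<in> carrier D.A" for r
      using e(2) keys_scale[of r "eval_K b"] by auto
    have "((of_int x * s) \<odot>\<^bsub>D.A\<^esub> eval_K a) \<otimes>\<^bsub>D.A\<^esub> ((of_int y * t) \<odot>\<^bsub>D.A\<^esub> eval_K b) =
      (of_int (x * y) * (s * t)) \<odot>\<^bsub>D.A\<^esub> (eval_K a \<otimes>\<^bsub>D.A\<^esub> eval_K b)"
      unfolding D.smult_mult(1)[OF e(1) e'] D.smult_mult(2)[OF e] by (simp add: scale_scale mult_ac)
    then show ?case
      using eval_K_mult[OF pq(3,4)] by (simp add: pq based_mult_single eval_pairs_single pair_value_def)
  qed (simp_all add: eval_pairs_add based_mult_add_right)
qed (simp_all add: eval_pairs_add based_mult_add_left)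

lemma eval_pairs_relation:
  assumes "r \<in> bilinearity_relations h bK"
  shows "eval_pairs r = 0"
  using assms unfolding bilinearity_relations_def
  by (auto simp: eval_pairs_diff eval_pairs_pair scale_add scale_add_left scale_scale eval_K_add eval_K_scale)

lemma eval_pairs_ideal: "x \<in> tensor_ideal h bK \<Longrightarrow> eval_pairs x = 0"
proof -
  have "ideal {x \<in> carrier X.P.A. eval_pairs x = 0} X.P.A"
    by (rule ideal_null_set[OF X.P.ambient_ring]) (simp_all add: eval_pairs_add eval_pairs_mult del: based_algebra_simps)
  then have "tensor_ideal h bK \<subseteq> {x \<in> carrier X.P.A. eval_pairs x = 0}"
    unfolding tensor_ideal_def X.pair_ring_eq
    using X.relations_closed eval_pairs_relation by (intro ring.genideal_minimal[OF X.P.ring]) auto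
  then show "x \<in> tensor_ideal h bK \<Longrightarrow> eval_pairs x = 0" by auto
qed

abbreviation "b \<equiv> base_change h bK"

definition \<phi> :: "('k \<times> (blob_gen list \<Rightarrow>\<^sub>0 'K) set \<Rightarrow>\<^sub>0 int) set \<Rightarrow> (diagram \<Rightarrow>\<^sub>0 'k)" where
  "\<phi> S = the_elem (eval_pairs ` S)"

lemma \<phi>_coset: "p \<in> carrier X.P.A \<Longrightarrow> \<phi> (X.coset p) = eval_pairs p"
  unfolding \<phi>_def by (rule X.the_elem_coset) (simp_all add: eval_pairs_add eval_pairs_ideal del: based_algebra_simps)

lemma b_cases:
  assumes "x \<in> carrier b"
  obtains p where "p \<in> carrier X.P.A" "x = X.coset p"
  using assms unfolding X.base_change_simps(1) by blast

lemma P_add_closed: "f \<in> carrier X.P.A \<Longrightarrow> g \<in> carrier X.P.A \<Longrightarrow> f + g \<in> carrier X.P.A"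
  using keys_add[of f g] by auto

lemma \<phi>_hom: "\<phi> \<in> algebra_hom b D.A"
proof -
  have "\<phi> \<in> ring_hom b D.A"
  proof (rule ring_hom_memI)
    show "\<phi> x \<in> carrier D.A" if "x \<in> carrier b" for x
      using that by (elim b_cases) (simp add: \<phi>_coset eval_pairs_closed del: based_algebra_simps)
    show "\<phi> (x \<otimes>\<^bsub>b\<^esub> y) = \<phi> x \<otimes>\<^bsub>D.A\<^esub> \<phi> y" if "x \<in> carrier b" "y \<in> carrier b" for x y
      using that by (elim b_cases)
        (simp add: \<phi>_coset X.base_change_simps(4) X.P.mult_closed eval_pairs_mult del: based_algebra_simps)
    show "\<phi> (x \<oplus>\<^bsub>b\<^esub> y) = \<phi> x \<oplus>\<^bsub>D.A\<^esub> \<phi> y" if "x \<in> carrier b" "y \<in> carrier b" for x y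
      using that by (elim b_cases)
        (simp add: \<phi>_coset X.base_change_simps(5) P_add_closed eval_pairs_add based_algebra_simps(4) del: based_algebra_simps(1))
    show "\<phi> \<one>\<^bsub>b\<^esub> = \<one>\<^bsub>D.A\<^esub>"
      by (simp add: X.base_change_simps(2) \<phi>_coset eval_pairs_pair eval_K_one scale_one)
  qed
  moreover have "\<phi> (s \<odot>\<^bsub>b\<^esub> x) = s \<odot>\<^bsub>D.A\<^esub> \<phi> x" if "x \<in> carrier b" for s x
    using that
  proof (elim b_cases)
    fix p assume p: "p \<in> carrier X.P.A" "x = X.coset p"
    have one: "pair s \<one>\<^bsub>bK\<^esub> \<in> carrier X.P.A" by (rule X.pair_closed) simp
    have D1: "\<one>\<^bsub>D.A\<^esub> \<in> carrier D.A" using D.unit_closed by simp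
    have "\<phi> (s \<odot>\<^bsub>b\<^esub> x) = eval_pairs (pair s \<one>\<^bsub>bK\<^esub> \<otimes>\<^bsub>X.P.A\<^esub> p)"
      unfolding p(2) X.base_change_simps(6)[OF p(1)] by (rule \<phi>_coset[OF X.P.mult_closed[OF one p(1)]])
    also have "\<dots> = (s \<odot>\<^bsub>D.A\<^esub> \<one>\<^bsub>D.A\<^esub>) \<otimes>\<^bsub>D.A\<^esub> eval_pairs p"
      unfolding eval_pairs_mult[OF one p(1)] eval_pairs_pair eval_K_one ..
    also have "\<dots> = s \<odot>\<^bsub>D.A\<^esub> eval_pairs p"
      unfolding D.smult_mult(1)[OF D1 eval_pairs_closed[OF p(1)]] D.mult_one(1)[OF eval_pairs_closed[OF p(1)]] ..
    finally show "\<phi> (s \<odot>\<^bsub>b\<^esub> x) = s \<odot>\<^bsub>D.A\<^esub> \<phi> x" unfolding p(2) \<phi>_coset[OF p(1)] .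
  qed
  ultimately show ?thesis by (simp add: algebra_hom_def)
qed

section \<open>Normal words span the tensor product\<close>

abbreviation "bracket w \<equiv> Q.coset (word w)"

lemma bracket_closed: "w \<in> lists (blob_gens n) \<Longrightarrow> bracket w \<in> carrier bK"
  unfolding Q.quotient_algebra_simps(1) using word_closed[of w 1] by blast

text \<open>The tensors s \<otimes> w with \<open>w\<close> a word generate the additive group:
  additivity splits the right factor into scaled words, whose scalars move to the left factor.
  Closure is required under differences because elements of the pair ring are integer
  combinations.\<close>

lemma tensor_induct [consumes 1, case_names diff cong word]:
  assumes p: "p \<in> carrier X.P.A"
    and diff: "\<And>p q. p \<in> carrier X.P.A \<Longrightarrow> q \<in> carrier X.P.A \<Longrightarrow> P p \<Longrightarrow> P q \<Longrightarrow> P (p - q)"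
    and cong: "\<And>p q. p \<in> carrier X.P.A \<Longrightarrow> q \<in> carrier X.P.A \<Longrightarrow> X.coset p = X.coset q \<Longrightarrow> P p \<Longrightarrow> P q"
    and word: "\<And>s w. w \<in> lists (blob_gens n) \<Longrightarrow> P (pair s (bracket w))"
  shows "P p"
proof -
  have nil: "bracket [] \<in> carrier bK" by (rule bracket_closed) simp
  have P0: "P 0"
    using diff[OF _ _ word[of "[]" 0] word[of "[]" 0]] X.pair_closed[OF nil, of 0] by simp
  have Padd: "P (p + q)" if "p \<in> carrier X.P.A" "q \<in> carrier X.P.A" "P p" "P q" for p q
  proof -
    have "P (0 - q)" by (rule diff[OF X.ambient_closed(4)[OF that(2,2)] that(2) P0 that(4)])
    then have "P (p - (0 - q))"
      using X.ambient_closed(2)[OF that(2,2)] by (intro diff[OF that(1) _ that(3)]) simp_all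
    then show ?thesis by simp
  qed
  have Ppair: "P (pair s (Q.coset f))" if "f \<in> carrier F.A" for s f
  proof -
    have "Poly_Mapping.keys f \<subseteq> lists (blob_gens n)" using that by simp
    then have "Q.coset f \<in> carrier bK \<and> P (pair s (Q.coset f))"
    proof (induction f rule: poly_mapping_induct)
      case zero
      have z: "Q.coset 0 = \<zero>\<^bsub>bK\<^esub>" by (simp add: Q.quotient_algebra_simps(3))
      have "P (pair s \<zero>\<^bsub>bK\<^esub>)"
        by (rule cong[of 0]) (use X.coset_pair_zero(1)[of s] X.pair_closed[of "\<zero>\<^bsub>bK\<^esub>" s] P0 in simp_all)
      then show ?case by (simp add: z)
    next
      case (single w x)
      have w: "bracket w \<in> carrier bK" by (rule bracket_closed[OF single])
      have eq: "Q.coset (scaled_word x w) = x \<odot>\<^bsub>bK\<^esub> bracket w"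
        using Q.quotient_smult[OF word_closed[OF single, of 1], of x] by (simp add: scale_single)
      have c: "x \<odot>\<^bsub>bK\<^esub> bracket w \<in> carrier bK" by (rule X.scale_closed[OF w])
      have "P (pair s (x \<odot>\<^bsub>bK\<^esub> bracket w))"
        by (rule cong[OF X.pair_closed[OF w] X.pair_closed[OF c] X.coset_pair_scale[OF w] word[OF single]])
      then show ?case using c by (simp add: eq)
    next
      case (add f g)
      then have c: "Q.coset f \<in> carrier bK" "Q.coset g \<in> carrier bK"
        and P: "P (pair s (Q.coset f))" "P (pair s (Q.coset g))" by auto
      have eq: "Q.coset (f + g) = Q.coset f \<oplus>\<^bsub>bK\<^esub> Q.coset g"
        using Q.quotient_algebra_simps(5)[of f g] add.hyps by simp
      have cc: "Q.coset f \<oplus>\<^bsub>bK\<^esub> Q.coset g \<in> carrier bK"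
        using ring.ring_simprules(1)[OF Q.ring_quotient_algebra] c by blast
      have "P (pair s (Q.coset f \<oplus>\<^bsub>bK\<^esub> Q.coset g))"
        by (rule cong[OF P_add_closed[OF X.pair_closed[OF c(1)] X.pair_closed[OF c(2)]] X.pair_closed[OF cc]
              X.coset_pair_add_right[OF c, symmetric]
              Padd[OF X.pair_closed[OF c(1)] X.pair_closed[OF c(2)] P]])
      then show ?case using cc by (simp add: eq)
    qed
    then show ?thesis ..
  qed
  have "Poly_Mapping.keys p \<subseteq> UNIV \<times> carrier bK" using p by simp
  then have "p \<in> carrier X.P.A \<and> P p"
  proof (induction p rule: frag_induction)
    case zero
    then show ?case using P0 by simp
  next
    case (one x)
    obtain s a where x: "x = (s, a)" "a \<in> carrier bK" using one by auto
    from x(2) obtain f where "f \<in> carrier F.A" "a = Q.coset f" by (rule bK_cases)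
    then show ?case using Ppair[of f s] X.pair_closed[OF x(2), of s] x(1) by simp
  next
    case (diff p q)
    then show ?case using assms(2)[of p q] X.ambient_closed(3)[of p q] by blast
  qed
  then show "P p" ..
qed

definition normal_form :: "diagram \<Rightarrow> nat list" where
  "normal_form d = (SOME w. (\<exists>a. normal_word n a w) \<and> word_diagram n w = d)"

lemma normal_form_props:
  assumes "d \<in> blob_diagrams n"
  obtains a where "normal_word n a (normal_form d)" "word_diagram n (normal_form d) = d"
proof -
  obtain a w where "normal_word n a w" "word_diagram n w = d" using blob_diagram_normal_word[OF assms] .
  then have "\<exists>w. (\<exists>a. normal_word n a w) \<and> word_diagram n w = d" by blast
  from someI_ex[OF this] show thesis using that unfolding normal_form_def by blast
qed

lemma normal_form_word_diagram:
  assumes "normal_word n a w" "word_diagram n w \<in> blob_diagrams n"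
  shows "normal_form (word_diagram n w) = w"
  using normal_form_props[OF assms(2)] normal_word_diagram_inj[OF _ assms(1)] by (metis order.refl)

lemma finite_blob_diagrams: "finite (blob_diagrams n)"
proof (rule finite_subset)
  show "blob_diagrams n \<subseteq> Pow (Pow (vertices n)) \<times> Pow (Pow (vertices n))"
  proof
    fix d assume "d \<in> blob_diagrams n"
    then have "\<Union>(fst d) = vertices n" "snd d \<subseteq> fst d"
      using partition_diagramD(1,5) partition_diagram_blob by blast+
    then show "d \<in> Pow (Pow (vertices n)) \<times> Pow (Pow (vertices n))" by (cases d) auto
  qed
qed simp

abbreviation "basis d \<equiv> bracket (map letter (normal_form d))"

lemma basis_closed:
  assumes "d \<in> blob_diagrams n"
  shows "basis d \<in> carrier bK"
proof -
  obtain a where "normal_word n a (normal_form d)" using normal_form_props[OF assms] .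
  then show ?thesis by (intro bracket_closed map_letter_closed[OF n] normal_word_letters)
qed

lemma eval_K_basis:
  assumes "d \<in> blob_diagrams n"
  shows "eval_K (basis d) = Poly_Mapping.single d 1"
proof -
  obtain a where a: "normal_word n a (normal_form d)" "word_diagram n (normal_form d) = d" using normal_form_props[OF assms] .
  have "eval_K (basis d) = word_value (map letter (normal_form d)) 1"
    by (simp only: eval_K_coset[OF nat_word_closed[OF normal_word_letters[OF a(1)]]] eval_free_single)
  then show ?thesis
    using a(2) normal_word_invariants(5)[OF a(1) order.refl, of "h \<delta>" "h \<gamma>" "h \<delta>\<^sub>e"] by (simp add: word_value_def)
qed

text \<open>Summing over all diagrams fixes the index set, so combinations can be compared
  coefficientwise. A term with coefficient 0 is still non-zero in the pair ring, but it lies in the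
  tensor ideal.\<close>

definition combination :: "(diagram \<Rightarrow> 'k) \<Rightarrow> ('k \<times> (blob_gen list \<Rightarrow>\<^sub>0 'K) set \<Rightarrow>\<^sub>0 int)" where
  "combination c = (\<Sum>d \<in> blob_diagrams n. pair (c d) (basis d))"

lemma combination_closed: "combination c \<in> carrier X.P.A"
proof -
  have "(\<Sum>d \<in> S. pair (c d) (basis d)) \<in> carrier X.P.A" if "finite S" "S \<subseteq> blob_diagrams n" for S
    using that
  proof (induction S rule: finite_induct)
    case (insert d S)
    then show ?case using P_add_closed[OF X.pair_closed[OF basis_closed]] by simp
  qed simp
  then show ?thesis using finite_blob_diagrams by (simp add: combination_def)
qed

lemma eval_pairs_combination:
  "eval_pairs (combination c) = (\<Sum>d \<in> blob_diagrams n. Poly_Mapping.single d (c d))"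
proof -
  have "eval_pairs (\<Sum>d \<in> S. pair (c d) (basis d)) = (\<Sum>d \<in> S. eval_pairs (pair (c d) (basis d)))" if "finite S" for S
    using that by (induction S rule: finite_induct) (simp_all add: eval_pairs_add)
  moreover have "eval_pairs (pair (c d) (basis d)) = Poly_Mapping.single d (c d)" if "d \<in> blob_diagrams n" for d
    using eval_K_basis[OF that] by (simp add: eval_pairs_pair scale_single)
  ultimately show ?thesis using finite_blob_diagrams by (simp add: combination_def)
qed

lemma lookup_eval_pairs_combination:
  "Poly_Mapping.lookup (eval_pairs (combination c)) d = (if d \<in> blob_diagrams n then c d else 0)"
  using finite_blob_diagrams by (simp add: eval_pairs_combination lookup_sum lookup_single when_def)

lemma sum_in_tensor_ideal:
  "finite S \<Longrightarrow> (\<And>d. d \<in> S \<Longrightarrow> f d \<in> tensor_ideal h bK) \<Longrightarrow> sum f S \<in> tensor_ideal h bK"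
  by (induction S rule: finite_induct) (auto intro: X.ideal_closed)

lemma pair_zero_in_tensor_ideal: "a \<in> carrier bK \<Longrightarrow> pair 0 a \<in> tensor_ideal h bK"
  using X.coset_pair_zero(2)[of a] by (simp add: X.coset_eq_iff)

lemma combination_exists: "p \<in> carrier X.P.A \<Longrightarrow> \<exists>c. X.coset p = X.coset (combination c)"
proof (induction p rule: tensor_induct)
  case (diff p q)
  then obtain c c' where c: "p - combination c \<in> tensor_ideal h bK" "q - combination c' \<in> tensor_ideal h bK"
    by (auto simp: X.coset_eq_iff)
  \<comment> \<open>For each diagram this is additivity in the left factor, with c d split as (c d -
    c' d) + c' d.\<close>
  have "combination c - combination c' - combination (\<lambda>d. c d - c' d) =
    (\<Sum>d \<in> blob_diagrams n. pair (c d) (basis d) - (pair (c d - c' d) (basis d) + pair (c' d) (basis d)))"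
    by (simp add: combination_def sum_subtractf sum.distrib)
  also have "\<dots> \<in> tensor_ideal h bK"
  proof (rule sum_in_tensor_ideal[OF finite_blob_diagrams])
    fix d assume "d \<in> blob_diagrams n"
    from X.coset_pair_add_left[OF basis_closed[OF this], of "c d - c' d" "c' d"]
    show "pair (c d) (basis d) - (pair (c d - c' d) (basis d) + pair (c' d) (basis d)) \<in> tensor_ideal h bK"
      by (simp add: X.coset_eq_iff)
  qed
  finally have "(p - combination c - (q - combination c')) +
    (combination c - combination c' - combination (\<lambda>d. c d - c' d)) \<in> tensor_ideal h bK"
    by (rule X.ideal_closed(2)[OF X.ideal_closed(4)[OF c]])
  then show ?case unfolding X.coset_eq_iff by (intro exI[of _ "\<lambda>d. c d - c' d"]) (simp add: algebra_simps)
next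
  case (cong p q)
  then show ?case by auto
next
  case (word s w)
  let ?u = "map letter_index w"
  have u: "set ?u \<subseteq> {..<n}" using letter_index_word_closed[OF n word] .
  obtain c a v where v: "normal_word n a v" "reduces \<delta> \<gamma> \<delta>\<^sub>e n ?u c v" using red_normal_word[OF u] by blast
  have vn: "set v \<subseteq> {..<n}" by (rule normal_word_letters[OF v(1)])
  define d where "d = word_diagram n v"
  have d: "d \<in> blob_diagrams n" unfolding d_def by (rule word_blob_diagram[OF vn])
  have nf: "normal_form d = v" using normal_form_word_diagram[OF v(1)] d unfolding d_def by blast
  have "bracket w = Q.coset (scaled_word c (map letter v))"
    using coset_reduces[OF v(2) u] map_letter_letter_index[OF word] by simp
  also have "\<dots> = c \<odot>\<^bsub>bK\<^esub> basis d"
    using Q.quotient_smult[OF nat_word_closed[OF vn, of 1], of c] by (simp add: scale_single nf)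
  finally have 1: "X.coset (pair s (bracket w)) = X.coset (pair (s * h c) (basis d))"
    using X.coset_pair_scale[OF basis_closed[OF d], of s c] by simp
  \<comment> \<open>A single tensor is completed to a combination by terms with scalar 0, which the
    ideal contains.\<close>
  have "combination (\<lambda>d'. if d' = d then s * h c else 0) - pair (s * h c) (basis d) =
    (\<Sum>d' \<in> blob_diagrams n - {d}. pair 0 (basis d'))"
    unfolding combination_def by (subst sum.remove[OF finite_blob_diagrams d]) simp
  also have "\<dots> \<in> tensor_ideal h bK"
    using finite_blob_diagrams pair_zero_in_tensor_ideal basis_closed by (intro sum_in_tensor_ideal) auto
  finally show ?case using 1 X.coset_eq_iff by metis
qed

text \<open>The coefficients of a combination are the coordinates of its image. As every element is
  represented by a combination, equal images give combinations that coincide already in the pair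
  ring, and the coordinates of any target element give a preimage.\<close>

lemma \<phi>_bij: "bij_betw \<phi> (carrier b) (carrier D.A)"
proof (rule bij_betwI')
  fix x y assume xy: "x \<in> carrier b" "y \<in> carrier b"
  obtain p q where p: "p \<in> carrier X.P.A" "x = X.coset p" and q: "q \<in> carrier X.P.A" "y = X.coset q"
    using xy b_cases by metis
  obtain c c' where c: "x = X.coset (combination c)" and c': "y = X.coset (combination c')"
    using combination_exists p q by metis
  show "\<phi> x = \<phi> y \<longleftrightarrow> x = y"
  proof
    assume "\<phi> x = \<phi> y"
    then have "eval_pairs (combination c) = eval_pairs (combination c')"
      unfolding c c' \<phi>_coset[OF combination_closed] .
    then have "c d = c' d" if "d \<in> blob_diagrams n" for d
      using that lookup_eval_pairs_combination[of c d] lookup_eval_pairs_combination[of c' d] by simp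
    then have "combination c = combination c'" by (simp add: combination_def)
    then show "x = y" by (simp add: c c')
  qed simp
next
  fix x assume "x \<in> carrier b"
  then show "\<phi> x \<in> carrier D.A"
    by (elim b_cases) (simp only: \<phi>_coset eval_pairs_closed)
next
  fix y assume y: "y \<in> carrier D.A"
  have "y = eval_pairs (combination (Poly_Mapping.lookup y))"
    using y by (intro poly_mapping_eqI) (auto simp: lookup_eval_pairs_combination in_keys_iff)
  also have "\<dots> = \<phi> (X.coset (combination (Poly_Mapping.lookup y)))"
    by (simp only: \<phi>_coset[OF combination_closed])
  finally show "\<exists>x \<in> carrier b. y = \<phi> x"
    using combination_closed unfolding X.base_change_simps(1) by blast
qed

abbreviation "generator g \<equiv> X.coset (pair 1 (bracket [g]))"

lemma pure_tensor_generator: "pure_tensor h bK 1 (presented_blob_gen n \<delta> \<gamma> \<delta>\<^sub>e g) = generator g"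
  by (simp only: pure_tensor_def presented_blob_gen_eq X.pair_ring_eq)

lemma \<phi>_generator:
  assumes "g \<in> blob_gens n"
  shows "\<phi> (generator g) = diagram_blob_gen n g"
proof -
  have w: "[g] \<in> lists (blob_gens n)" using assms by simp
  have i: "letter_index g < n" by (rule letter_index_less[OF n assms])
  have "\<phi> (generator g) = 1 \<odot>\<^bsub>D.A\<^esub> word_value [g] 1"
    unfolding \<phi>_coset[OF X.pair_closed[OF bracket_closed[OF w]]] eval_pairs_pair
      eval_K_coset[OF word_closed[OF w]] eval_free_single ..
  also have "\<dots> = Poly_Mapping.single (generator_diagram n (letter_index g)) 1"
    using word_diagram_single[OF i] word_scalar_single[OF i, of "h \<delta>" "h \<gamma>" "h \<delta>\<^sub>e"]
    by (simp add: word_value_def scale_one del: word_diagram.simps word_scalar.simps)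
  also have "\<dots> = diagram_blob_gen n g"
    using assms by (auto simp: diagram_blob_gen_def generator_diagram_def blob_gens_def)
  finally show ?thesis .
qed

section \<open>Uniqueness of the homomorphism\<close>

lemma hom_diff:
  assumes f: "f \<in> ring_hom b D.A" and p: "p \<in> carrier X.P.A" "q \<in> carrier X.P.A"
  shows "f (X.coset (p - q)) = f (X.coset p) - f (X.coset q)"
proof -
  have pq: "p - q \<in> carrier X.P.A" by (rule X.ambient_closed(3)[OF p])
  have "f (X.coset (p - q) \<oplus>\<^bsub>b\<^esub> X.coset q) = f (X.coset (p - q)) \<oplus>\<^bsub>D.A\<^esub> f (X.coset q)"
    using pq p(2) by (intro ring_hom_add[OF f]) (simp_all add: X.base_change_simps(1) del: based_algebra_simps)
  then show ?thesis using X.base_change_simps(5)[OF pq p(2)] by (simp add: algebra_simps)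
qed

text \<open>Agreement spreads from generators to words by multiplicativity, to tensors s \<otimes> w
  by linearity over k, and to everything by additivity.\<close>

lemma hom_unique:
  assumes f: "f \<in> algebra_hom b D.A" and g: "g \<in> algebra_hom b D.A"
    and gens: "\<And>l. l \<in> blob_gens n \<Longrightarrow> f (generator l) = g (generator l)" and x: "x \<in> carrier b"
  shows "f x = g x"
proof -
  have rh: "f \<in> ring_hom b D.A" "g \<in> ring_hom b D.A" using f g by (auto simp: algebra_hom_def)
  have cl: "X.coset p \<in> carrier b" if "p \<in> carrier X.P.A" for p
    unfolding X.base_change_simps(1) using that by (rule imageI)
  have pc: "pair s (bracket w) \<in> carrier X.P.A" if "w \<in> lists (blob_gens n)" for s w
    by (rule X.pair_closed[OF bracket_closed[OF that]])
  have words: "f (X.coset (pair 1 (bracket w))) = g (X.coset (pair 1 (bracket w)))" if "w \<in> lists (blob_gens n)" for w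
    using that
  proof (induction w rule: list.induct)
    case Nil
    have "X.coset (pair 1 (bracket [])) = \<one>\<^bsub>b\<^esub>" by (simp add: X.base_change_simps(2) Q.quotient_algebra_simps(2))
    then show ?case using ring_hom_one[OF rh(1)] ring_hom_one[OF rh(2)] by simp
  next
    case (Cons l w)
    have l: "[l] \<in> lists (blob_gens n)" and w: "w \<in> lists (blob_gens n)" using Cons.prems by simp_all
    have "bracket [l] \<otimes>\<^bsub>bK\<^esub> bracket w = bracket (l # w)"
      using Q.quotient_algebra_simps(4)[OF word_closed[OF l] word_closed[OF w], of 1 1] by (simp add: based_mult_single)
    then have "generator l \<otimes>\<^bsub>b\<^esub> X.coset (pair 1 (bracket w)) = X.coset (pair 1 (bracket (l # w)))"
      using X.base_change_simps(4)[OF pc[OF l] pc[OF w], of 1 1] by (simp add: X.pair_mult)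
    then show ?case
      using ring_hom_mult[OF rh(1) cl[OF pc[OF l]] cl[OF pc[OF w]], of 1 1]
        ring_hom_mult[OF rh(2) cl[OF pc[OF l]] cl[OF pc[OF w]], of 1 1] Cons.IH[OF w] gens[of l] l by simp
  qed
  obtain p where p: "p \<in> carrier X.P.A" "x = X.coset p" using x by (rule b_cases)
  from p(1) have "f (X.coset p) = g (X.coset p)"
  proof (induction p rule: tensor_induct)
    case (diff p q)
    then show ?case by (simp add: hom_diff rh del: based_algebra_simps)
  next
    case (cong p q)
    then show ?case by simp
  next
    case (word s w)
    have "s \<odot>\<^bsub>b\<^esub> X.coset (pair 1 (bracket w)) = X.coset (pair s (bracket w))"
      using X.base_change_simps(6)[OF pc[OF word], of s 1] bracket_closed[OF word] by (simp add: X.pair_mult)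
    moreover have "f (s \<odot>\<^bsub>b\<^esub> X.coset (pair 1 (bracket w))) = s \<odot>\<^bsub>D.A\<^esub> f (X.coset (pair 1 (bracket w)))"
      "g (s \<odot>\<^bsub>b\<^esub> X.coset (pair 1 (bracket w))) = s \<odot>\<^bsub>D.A\<^esub> g (X.coset (pair 1 (bracket w)))"
      using f g cl[OF pc[OF word]] by (auto simp: algebra_hom_def)
    ultimately show ?case using words[OF word] by simp
  qed
  then show ?thesis by (simp add: p(2))
qed

end

theorem proposition16:
  fixes h :: "'K::comm_ring_1 \<Rightarrow> 'k::field"
    and x q \<delta> \<gamma> \<delta>\<^sub>e :: 'K
    and n :: nat
    and bK :: "('K, (blob_gen list \<Rightarrow>\<^sub>0 'K) set) module"
    and b :: "('k, ('k \<times> (blob_gen list \<Rightarrow>\<^sub>0 'K) set \<Rightarrow>\<^sub>0 int) set) module"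
    and gen :: "blob_gen \<Rightarrow> ('k \<times> (blob_gen list \<Rightarrow>\<^sub>0 'K) set \<Rightarrow>\<^sub>0 int) set"
    and b' :: "('k, diagram \<Rightarrow>\<^sub>0 'k) module"
  assumes "h \<in> ring_hom scalar_ring scalar_ring"
    and "x \<in> Units scalar_ring"
    and "q = x ^ 2"
    and "\<delta> = q + inv\<^bsub>scalar_ring\<^esub> q"
    and "n \<ge> 1"
    and "bK = presented_blob_algebra n \<delta> \<gamma> \<delta>\<^sub>e"
    and "b = base_change h bK"
    and "\<And>g. gen g = pure_tensor h bK 1 (presented_blob_gen n \<delta> \<gamma> \<delta>\<^sub>e g)"
    and "b' = diagram_blob_algebra n (h \<delta>) (h \<gamma>) (h \<delta>\<^sub>e)"
  shows "unital_algebra scalar_ring b \<and> unital_algebra scalar_ring b' \<and>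
    (\<exists>\<phi> \<in> algebra_iso b b'.
       (\<forall>i \<in> {1..<n}. \<phi> (gen (U i)) = diagram_blob_gen n (U i)) \<and>
       \<phi> (gen E) = diagram_blob_gen n E \<and>
       (\<forall>\<psi> \<in> algebra_hom b b'.
          (\<forall>i \<in> {1..<n}. \<psi> (gen (U i)) = diagram_blob_gen n (U i)) \<and>
          \<psi> (gen E) = diagram_blob_gen n E \<longrightarrow>
          (\<forall>a \<in> carrier b. \<psi> a = \<phi> a)))"
proof -
  interpret blob_presentation h n \<delta> \<gamma> \<delta>\<^sub>e
    by unfold_locales (use assms(1,5) in auto)
  have bK: "bK = quotient_algebra F.A I" using assms(6) by (simp only: presented_blob_algebra_eq)
  have b: "b = base_change h (quotient_algebra F.A I)" using assms(7) bK by simp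
  have b': "b' = D.A" using assms(9) by (simp only: diagram_blob_algebra_def)
  have gen: "gen g = generator g" for g using assms(8)[of g] by (simp only: bK pure_tensor_generator)
  have gens: "E \<in> blob_gens n" "\<And>i. i \<in> {1..<n} \<Longrightarrow> U i \<in> blob_gens n" by (auto simp: blob_gens_def)
  show ?thesis
  proof (intro conjI bexI[of _ \<phi>] ballI impI)
    show "unital_algebra scalar_ring b" unfolding b by (rule X.unital_algebra_base_change)
    show "unital_algebra scalar_ring b'" unfolding b' by (rule D.unital_algebra)
    show "\<phi> \<in> algebra_iso b b'" unfolding b b' algebra_iso_def using \<phi>_hom \<phi>_bij by simp
    show "\<phi> (gen (U i)) = diagram_blob_gen n (U i)" if "i \<in> {1..<n}" for i
      unfolding gen by (rule \<phi>_generator[OF gens(2)[OF that]])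
    show "\<phi> (gen E) = diagram_blob_gen n E" unfolding gen by (rule \<phi>_generator[OF gens(1)])
    fix \<psi> a
    assume \<psi>: "\<psi> \<in> algebra_hom b b'" and vals: "(\<forall>i \<in> {1..<n}. \<psi> (gen (U i)) = diagram_blob_gen n (U i)) \<and>
      \<psi> (gen E) = diagram_blob_gen n E" and a: "a \<in> carrier b"
    have "\<psi> (generator l) = \<phi> (generator l)" if "l \<in> blob_gens n" for l
      using vals \<phi>_generator[OF that] that by (auto simp: gen blob_gens_def)
    then show "\<psi> a = \<phi> a"
      using hom_unique[OF \<psi>[unfolded b b'] \<phi>_hom _ a[unfolded b]] by blast
  qed
qed

end
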